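(* Let $(Q,I)$ be a $\mathbb Z$-graded bound quiver such that the algebra $A=kQ/I$ is finite dimensional and of finite global dimension. Consider the functor $\Gamma:\mathrm{mod}\,A^\ltimes\to\mathrm{Dif}(A)$ defined as follows: for an $A^\ltimes$-module $M$, $\Gamma(M)=(M_{|A},d_M)$, where $M_{|A}$ is the restriction of $M$ to $\mathrm{mod}\,A$ and $d_M$ is given by the action of $1\otimes\varepsilon$ on $M$; for a morphism $f:M\to N$ in $\mathrm{mod}\,A^\ltimes$, $\Gamma(f):(M_{|A},d_M)\to(N_{|A},d_N)$ is the restriction $f_{|A}$ of $f$ to $\mathrm{mod}\,A$. This functor is an equivalence of categories that restricts to an equivalence $$\mathrm{CM}(A^\ltimes)\ \overset{\sim}{\longrightarrow}\ \mathcal P(A).$$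
   Context: $k$ is a field. $(Q,I)$ graded means that arrows of $Q$ carry integer degrees and $I$ is homogeneous, so $A$ is $\mathbb Z$-graded. Modules are right modules; $\mathrm{mod}\,A$ is the category of finitely generated (ungraded) right $A$-modules. $A^\ltimes:=A\otimes_kk[\varepsilon]/\langle\varepsilon^2\rangle$ is the graded tensor product with $\varepsilon$ of degree $1$, i.e. with multiplication $(a\otimes\varepsilon^\ell)(b\otimes\varepsilon^m)=(-1)^{\ell|b|}ab\otimes\varepsilon^{\ell+m}$ for $b$ homogeneous; it is then considered as an ungraded algebra, and $\mathrm{mod}\,A^\ltimes$ is its category of finitely generated (ungraded) right modules. Restriction to $A$ is along $a\mapsto a\otimes 1$. An $A^\ltimes$-module $M\in\mathrm{mod}\,A^\ltimes$ is maximal Cohen-Macaulay if $\mathrm{Ext}^i_{A^\ltimes}(M,A^\ltimes)=0$ for all $i>0$; $\mathrm{CM}(A^\ltimes)$ is the full subcategory of such modules. $\mathrm{Dif}(A)$ is the category of (finitely generated) differential $A$-modules: objects are pairs $(M,d_M)$ with $M\in\mathrm{mod}\,A$ ungraded and $d_M:M\to M$ a $k$-linear map such that $d_M^2=0$ and $d_M(m\cdot a)=(-1)^{|a|}d_M(m)\cdot a$ for all $m\in M$ and homogeneous $a\in A$; morphisms $(M,d_M)\to(N,d_N)$ are $A$-linear maps $f:M\to N$ with $f\circ d_M=d_N\circ f$. $\mathcal P(A)$ is the full subcategory of objects $(P,d_P)$ with $P$ a projective $A$-module. *)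

theory Defs
  imports
    "HOL-Algebra.QuotRing"
    "HOL-Algebra.Embedded_Algebras"
    "HOL-Algebra.Elementary_Groups"
    "Graph_Theory.Arc_Walk"
begin

section \<open>Categories and equivalences\<close>

text \<open>
  Arrows do not record their domain and codomain, so homs and composition are indexed by objects.
\<close>

record ('o, 'f) cat =
  Ob :: "'o set"
  Hom :: "'o \<Rightarrow> 'o \<Rightarrow> 'f set"
  Comp :: "'o \<Rightarrow> 'o \<Rightarrow> 'o \<Rightarrow> 'f \<Rightarrow> 'f \<Rightarrow> 'f"   \<comment> \<open>\<open>Comp C X Y Z g f\<close> is \<open>g \<circ> f\<close> for \<open>f : X \<rightarrow> Y\<close>, \<open>g : Y \<rightarrow> Z\<close>\<close>
  Idn :: "'o \<Rightarrow> 'f"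

locale category =
  fixes C :: "('o, 'f) cat" (structure)
  assumes id_in_hom: "X \<in> Ob C \<Longrightarrow> Idn C X \<in> Hom C X X"
    and comp_in_hom: "\<lbrakk>X \<in> Ob C; Y \<in> Ob C; Z \<in> Ob C; f \<in> Hom C X Y; g \<in> Hom C Y Z\<rbrakk>
      \<Longrightarrow> Comp C X Y Z g f \<in> Hom C X Z"
    and comp_id_left: "\<lbrakk>X \<in> Ob C; Y \<in> Ob C; f \<in> Hom C X Y\<rbrakk> \<Longrightarrow> Comp C X Y Y (Idn C Y) f = f"
    and comp_id_right: "\<lbrakk>X \<in> Ob C; Y \<in> Ob C; f \<in> Hom C X Y\<rbrakk> \<Longrightarrow> Comp C X X Y f (Idn C X) = f"
    and comp_assoc: "\<lbrakk>W \<in> Ob C; X \<in> Ob C; Y \<in> Ob C; Z \<in> Ob C;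
        f \<in> Hom C W X; g \<in> Hom C X Y; h \<in> Hom C Y Z\<rbrakk>
      \<Longrightarrow> Comp C W X Z (Comp C X Y Z h g) f = Comp C W Y Z h (Comp C W X Y g f)"

definition full_subcat :: "('o, 'f) cat \<Rightarrow> ('o \<Rightarrow> bool) \<Rightarrow> ('o, 'f) cat" where
  "full_subcat C P = C\<lparr>Ob := {X \<in> Ob C. P X}\<rparr>"

record ('o, 'f, 'p, 'g) ftor =
  FOb :: "'o \<Rightarrow> 'p"
  FArr :: "'o \<Rightarrow> 'o \<Rightarrow> 'f \<Rightarrow> 'g"

definition is_functor :: "('o, 'f) cat \<Rightarrow> ('p, 'g) cat \<Rightarrow> ('o, 'f, 'p, 'g) ftor \<Rightarrow> bool" where
  "is_functor C D F \<longleftrightarrow> category C \<and> category D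
    \<and> (\<forall>X\<in>Ob C. FOb F X \<in> Ob D)
    \<and> (\<forall>X\<in>Ob C. \<forall>Y\<in>Ob C. \<forall>f\<in>Hom C X Y. FArr F X Y f \<in> Hom D (FOb F X) (FOb F Y))
    \<and> (\<forall>X\<in>Ob C. FArr F X X (Idn C X) = Idn D (FOb F X))
    \<and> (\<forall>X\<in>Ob C. \<forall>Y\<in>Ob C. \<forall>Z\<in>Ob C. \<forall>f\<in>Hom C X Y. \<forall>g\<in>Hom C Y Z.
         FArr F X Z (Comp C X Y Z g f)
           = Comp D (FOb F X) (FOb F Y) (FOb F Z) (FArr F Y Z g) (FArr F X Y f))"

definition id_ftor :: "('o, 'f, 'o, 'f) ftor" where
  "id_ftor = \<lparr>FOb = (\<lambda>X. X), FArr = (\<lambda>X Y f. f)\<rparr>"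

definition comp_ftor ::
  "('p, 'g, 'q, 'h) ftor \<Rightarrow> ('o, 'f, 'p, 'g) ftor \<Rightarrow> ('o, 'f, 'q, 'h) ftor" where
  "comp_ftor G F = \<lparr>FOb = (\<lambda>X. FOb G (FOb F X)),
     FArr = (\<lambda>X Y f. FArr G (FOb F X) (FOb F Y) (FArr F X Y f))\<rparr>"

definition iso_arrow :: "('o, 'f) cat \<Rightarrow> 'o \<Rightarrow> 'o \<Rightarrow> 'f \<Rightarrow> bool" where
  "iso_arrow C X Y f \<longleftrightarrow> f \<in> Hom C X Y
    \<and> (\<exists>g\<in>Hom C Y X. Comp C X Y X g f = Idn C X \<and> Comp C Y X Y f g = Idn C Y)"

definition naturally_isomorphic ::
  "('o, 'f) cat \<Rightarrow> ('p, 'g) cat \<Rightarrow> ('o, 'f, 'p, 'g) ftor \<Rightarrow> ('o, 'f, 'p, 'g) ftor \<Rightarrow> bool" where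
  "naturally_isomorphic C D F G \<longleftrightarrow> (\<exists>\<eta> :: 'o \<Rightarrow> 'g.
      (\<forall>X\<in>Ob C. iso_arrow D (FOb F X) (FOb G X) (\<eta> X))
    \<and> (\<forall>X\<in>Ob C. \<forall>Y\<in>Ob C. \<forall>f\<in>Hom C X Y.
         Comp D (FOb F X) (FOb F Y) (FOb G Y) (\<eta> Y) (FArr F X Y f)
           = Comp D (FOb F X) (FOb G X) (FOb G Y) (FArr G X Y f) (\<eta> X)))"

definition is_equivalence :: "('o, 'f) cat \<Rightarrow> ('p, 'g) cat \<Rightarrow> ('o, 'f, 'p, 'g) ftor \<Rightarrow> bool" where
  "is_equivalence C D F \<longleftrightarrow> is_functor C D F
    \<and> (\<exists>G. is_functor D C G
         \<and> naturally_isomorphic C C (comp_ftor G F) id_ftor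
         \<and> naturally_isomorphic D D (comp_ftor F G) id_ftor)"


section \<open>Right modules over rings\<close>

text \<open>
  As in \<^locale>\<open>module\<close>, the underlying abelian group is the additive part of a ring record;
  the fields \<^const>\<open>mult\<close> and \<^const>\<open>one\<close> of a module carry no meaning.
\<close>

record ('a, 'm) rmodule = "'m ring" +
  ract :: "'m \<Rightarrow> 'a \<Rightarrow> 'm" (infixl \<open>\<triangleleft>\<index>\<close> 70)

locale right_module = R?: ring R + M?: abelian_group M
  for R :: "('a, 'b) ring_scheme" (structure) and M :: "('a, 'm) rmodule" (structure) +
  assumes ract_closed: "\<lbrakk>m \<in> carrier M; a \<in> carrier R\<rbrakk> \<Longrightarrow> m \<triangleleft>\<^bsub>M\<^esub> a \<in> carrier M"
    and ract_add_right: "\<lbrakk>m \<in> carrier M; a \<in> carrier R; b \<in> carrier R\<rbrakk>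
      \<Longrightarrow> m \<triangleleft>\<^bsub>M\<^esub> (a \<oplus>\<^bsub>R\<^esub> b) = m \<triangleleft>\<^bsub>M\<^esub> a \<oplus>\<^bsub>M\<^esub> m \<triangleleft>\<^bsub>M\<^esub> b"
    and ract_add_left: "\<lbrakk>m \<in> carrier M; n \<in> carrier M; a \<in> carrier R\<rbrakk>
      \<Longrightarrow> (m \<oplus>\<^bsub>M\<^esub> n) \<triangleleft>\<^bsub>M\<^esub> a = m \<triangleleft>\<^bsub>M\<^esub> a \<oplus>\<^bsub>M\<^esub> n \<triangleleft>\<^bsub>M\<^esub> a"
    and ract_assoc: "\<lbrakk>m \<in> carrier M; a \<in> carrier R; b \<in> carrier R\<rbrakk>
      \<Longrightarrow> m \<triangleleft>\<^bsub>M\<^esub> (a \<otimes>\<^bsub>R\<^esub> b) = m \<triangleleft>\<^bsub>M\<^esub> a \<triangleleft>\<^bsub>M\<^esub> b"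
    and ract_one: "m \<in> carrier M \<Longrightarrow> m \<triangleleft>\<^bsub>M\<^esub> \<one>\<^bsub>R\<^esub> = m"

definition fg_right_module :: "('a, 'b) ring_scheme \<Rightarrow> ('a, 'm) rmodule \<Rightarrow> bool" where
  "fg_right_module R M \<longleftrightarrow> right_module R M
    \<and> (\<exists>S. finite S \<and> S \<subseteq> carrier M
         \<and> (\<forall>m\<in>carrier M. \<exists>r \<in> S \<rightarrow> carrier R. m = (\<Oplus>\<^bsub>M\<^esub>s\<in>S. s \<triangleleft>\<^bsub>M\<^esub> r s)))"

text \<open>
  Homomorphisms are extensional, so that they are equal iff they agree on the carrier.
\<close>

definition rhom :: "('a, 'b) ring_scheme \<Rightarrow> ('a, 'm) rmodule \<Rightarrow> ('a, 'n) rmodule \<Rightarrow> ('m \<Rightarrow> 'n) set" where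
  "rhom R M N = {f \<in> carrier M \<rightarrow>\<^sub>E carrier N.
      (\<forall>x\<in>carrier M. \<forall>y\<in>carrier M. f (x \<oplus>\<^bsub>M\<^esub> y) = f x \<oplus>\<^bsub>N\<^esub> f y)
    \<and> (\<forall>x\<in>carrier M. \<forall>a\<in>carrier R. f (x \<triangleleft>\<^bsub>M\<^esub> a) = f x \<triangleleft>\<^bsub>N\<^esub> a)}"

definition rkernel :: "('a, 'm) rmodule \<Rightarrow> ('a, 'n) rmodule \<Rightarrow> ('m \<Rightarrow> 'n) \<Rightarrow> 'm set" where
  "rkernel M N f = {x \<in> carrier M. f x = \<zero>\<^bsub>N\<^esub>}"

definition regular_rmodule :: "('a, 'b) ring_scheme \<Rightarrow> ('a, 'a) rmodule" where
  "regular_rmodule R = \<lparr>carrier = carrier R, monoid.mult = mult R, one = one R,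
     zero = zero R, add = add R, ract = mult R\<rparr>"

definition restrict_scalars :: "('a \<Rightarrow> 'c) \<Rightarrow> ('c, 'm) rmodule \<Rightarrow> ('a, 'm) rmodule" where
  "restrict_scalars \<phi> M = \<lparr>carrier = carrier M, monoid.mult = mult M, one = one M,
     zero = zero M, add = add M, ract = (\<lambda>m a. m \<triangleleft>\<^bsub>M\<^esub> \<phi> a)\<rparr>"

definition mod_cat :: "('a, 'b) ring_scheme \<Rightarrow> (('a, 'm) rmodule, 'm \<Rightarrow> 'm) cat" where
  "mod_cat R = \<lparr>Ob = {M. fg_right_module R M}, Hom = rhom R,
     Comp = (\<lambda>L M N g f. compose (carrier L) g f), Idn = (\<lambda>M. \<lambda>m\<in>carrier M. m)\<rparr>"


section \<open>Projective modules, global dimension and Ext\<close>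

text \<open>
  A definition cannot quantify over types. In the lifting property \<open>N\<close> ranges over the modules
  with elements in the type \<open>'m\<close> of the elements of \<open>P\<close>, and \<open>M\<close> over those with elements in
  \<open>'m \<Rightarrow> 'a\<close>. These include \<open>P\<close> itself and the free module on the set \<open>carrier P\<close>, so that the
  property implies the lifting property for modules with elements in any types.
\<close>

definition projective_rmodule :: "('a, 'b) ring_scheme \<Rightarrow> ('a, 'm) rmodule \<Rightarrow> bool" where
  "projective_rmodule R P \<longleftrightarrow> right_module R P
    \<and> (\<forall>(M :: ('a, 'm \<Rightarrow> 'a) rmodule) (N :: ('a, 'm) rmodule). \<forall>g\<in>rhom R M N. \<forall>f\<in>rhom R P N.
         right_module R M \<and> right_module R N \<and> g ` carrier M = carrier N
         \<longrightarrow> (\<exists>h\<in>rhom R P M. compose (carrier P) g h = f))"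

text \<open>
  Resolutions by finitely generated projectives. Each of these is, up to isomorphism, a direct
  summand of some \<open>R\<^sup>n\<close>, so it can be realised with elements in \<open>nat \<Rightarrow> 'a\<close>.
\<close>

definition proj_resolution ::
  "('a, 'b) ring_scheme \<Rightarrow> ('a, 'm) rmodule \<Rightarrow> (nat \<Rightarrow> ('a, nat \<Rightarrow> 'a) rmodule)
    \<Rightarrow> (nat \<Rightarrow> (nat \<Rightarrow> 'a) \<Rightarrow> (nat \<Rightarrow> 'a)) \<Rightarrow> ((nat \<Rightarrow> 'a) \<Rightarrow> 'm) \<Rightarrow> bool" where
  "proj_resolution R M P d e \<longleftrightarrow>
      (\<forall>n. fg_right_module R (P n) \<and> projective_rmodule R (P n))
    \<and> (\<forall>n. d n \<in> rhom R (P (Suc n)) (P n))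
    \<and> e \<in> rhom R (P 0) M
    \<and> e ` carrier (P 0) = carrier M
    \<and> d 0 ` carrier (P (Suc 0)) = rkernel (P 0) M e
    \<and> (\<forall>n. d (Suc n) ` carrier (P (Suc (Suc n))) = rkernel (P (Suc n)) (P n) (d n))"

definition proj_dim_le :: "('a, 'b) ring_scheme \<Rightarrow> ('a, 'm) rmodule \<Rightarrow> nat \<Rightarrow> bool" where
  "proj_dim_le R M n \<longleftrightarrow> (\<exists>P d e. proj_resolution R M P d e
    \<and> (\<forall>i>n. carrier (P i) = {\<zero>\<^bsub>P i\<^esub>}))"

text \<open>
  Every finitely generated module is isomorphic to a quotient of some \<open>R\<^sup>n\<close>, hence to one with
  elements in \<open>(nat \<Rightarrow> 'a) set\<close>.
\<close>

definition finite_global_dim :: "('a, 'b) ring_scheme \<Rightarrow> bool" where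
  "finite_global_dim R \<longleftrightarrow>
    (\<exists>n. \<forall>M :: ('a, (nat \<Rightarrow> 'a) set) rmodule. fg_right_module R M \<longrightarrow> proj_dim_le R M n)"

definition ext_cocycles ::
  "('a, 'b) ring_scheme \<Rightarrow> (nat \<Rightarrow> ('a, 'p) rmodule) \<Rightarrow> (nat \<Rightarrow> 'p \<Rightarrow> 'p) \<Rightarrow> ('a, 'n) rmodule
    \<Rightarrow> nat \<Rightarrow> ('p \<Rightarrow> 'n) set" where
  "ext_cocycles R P d N i =
     {f \<in> rhom R (P i) N. \<forall>x\<in>carrier (P (Suc i)). f (d i x) = \<zero>\<^bsub>N\<^esub>}"

definition ext_coboundaries ::
  "('a, 'b) ring_scheme \<Rightarrow> (nat \<Rightarrow> ('a, 'p) rmodule) \<Rightarrow> (nat \<Rightarrow> 'p \<Rightarrow> 'p) \<Rightarrow> ('a, 'n) rmodule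
    \<Rightarrow> nat \<Rightarrow> ('p \<Rightarrow> 'n) set" where
  "ext_coboundaries R P d N i = (case i of
       0 \<Rightarrow> {\<lambda>x\<in>carrier (P 0). \<zero>\<^bsub>N\<^esub>}
     | Suc j \<Rightarrow> {compose (carrier (P i)) f (d j) | f. f \<in> rhom R (P j) N})"

definition Ext :: "('a, 'b) ring_scheme \<Rightarrow> nat \<Rightarrow> ('a, 'm) rmodule \<Rightarrow> ('a, 'n) rmodule
    \<Rightarrow> ((nat \<Rightarrow> 'a) \<Rightarrow> 'n) set monoid" where
  "Ext R i M N =
    (let (P, d, e) = (SOME (P, d, e). proj_resolution R M P d e) in
       \<lparr>carrier = ext_cocycles R P d N i,
        monoid.mult = (\<lambda>f g. \<lambda>x\<in>carrier (P i). f x \<oplus>\<^bsub>N\<^esub> g x),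
        one = (\<lambda>x\<in>carrier (P i). \<zero>\<^bsub>N\<^esub>)\<rparr> Mod ext_coboundaries R P d N i)"

definition maximal_CM :: "('a, 'b) ring_scheme \<Rightarrow> ('a, 'm) rmodule \<Rightarrow> bool" where
  "maximal_CM R M \<longleftrightarrow> fg_right_module R M
    \<and> (\<forall>i>0. trivial_group (Ext R i M (regular_rmodule R)))"

definition CM_cat :: "('a, 'b) ring_scheme \<Rightarrow> (('a, 'm) rmodule, 'm \<Rightarrow> 'm) cat" where
  "CM_cat R = full_subcat (mod_cat R) (maximal_CM R)"


section \<open>Differential modules\<close>

text \<open>
  A graded \<open>k\<close>-algebra is given by a ring \<open>A\<close>, its structure map \<open>\<iota> : k \<rightarrow> A\<close> and the sets \<open>G n\<close> of
  its homogeneous elements of degree \<open>n\<close>. The scalar \<open>c\<close> acts on a right \<open>A\<close>-module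
  by \<open>m \<mapsto> m \<triangleleft> \<iota> c\<close>.
\<close>

definition differential_module ::
  "('a, 'b) ring_scheme \<Rightarrow> ('k \<Rightarrow> 'a) \<Rightarrow> (int \<Rightarrow> 'a set) \<Rightarrow> ('a, 'm) rmodule \<times> ('m \<Rightarrow> 'm) \<Rightarrow> bool" where
  "differential_module A \<iota> G X \<longleftrightarrow> (case X of (M, d) \<Rightarrow>
      fg_right_module A M
    \<and> d \<in> carrier M \<rightarrow>\<^sub>E carrier M
    \<and> (\<forall>x\<in>carrier M. \<forall>y\<in>carrier M. d (x \<oplus>\<^bsub>M\<^esub> y) = d x \<oplus>\<^bsub>M\<^esub> d y)
    \<and> (\<forall>x\<in>carrier M. \<forall>c. d (x \<triangleleft>\<^bsub>M\<^esub> \<iota> c) = d x \<triangleleft>\<^bsub>M\<^esub> \<iota> c)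
    \<and> (\<forall>x\<in>carrier M. d (d x) = \<zero>\<^bsub>M\<^esub>)
    \<and> (\<forall>n. \<forall>a\<in>G n. \<forall>x\<in>carrier M.
         d (x \<triangleleft>\<^bsub>M\<^esub> a) = (if even n then d x \<triangleleft>\<^bsub>M\<^esub> a else \<ominus>\<^bsub>M\<^esub> (d x \<triangleleft>\<^bsub>M\<^esub> a))))"

definition dif_hom :: "('a, 'b) ring_scheme
    \<Rightarrow> ('a, 'm) rmodule \<times> ('m \<Rightarrow> 'm) \<Rightarrow> ('a, 'm) rmodule \<times> ('m \<Rightarrow> 'm) \<Rightarrow> ('m \<Rightarrow> 'm) set" where
  "dif_hom A X Y = {f \<in> rhom A (fst X) (fst Y). \<forall>x\<in>carrier (fst X). f (snd X x) = snd Y (f x)}"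

definition Dif_cat :: "('a, 'b) ring_scheme \<Rightarrow> ('k \<Rightarrow> 'a) \<Rightarrow> (int \<Rightarrow> 'a set)
    \<Rightarrow> (('a, 'm) rmodule \<times> ('m \<Rightarrow> 'm), 'm \<Rightarrow> 'm) cat" where
  "Dif_cat A \<iota> G = \<lparr>Ob = {X. differential_module A \<iota> G X}, Hom = dif_hom A,
     Comp = (\<lambda>X Y Z g f. compose (carrier (fst X)) g f),
     Idn = (\<lambda>X. \<lambda>x\<in>carrier (fst X). x)\<rparr>"

definition proj_Dif_cat :: "('a, 'b) ring_scheme \<Rightarrow> ('k \<Rightarrow> 'a) \<Rightarrow> (int \<Rightarrow> 'a set)
    \<Rightarrow> (('a, 'm) rmodule \<times> ('m \<Rightarrow> 'm), 'm \<Rightarrow> 'm) cat" where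
  "proj_Dif_cat A \<iota> G = full_subcat (Dif_cat A \<iota> G) (\<lambda>X. projective_rmodule A (fst X))"


section \<open>The graded tensor product with the dual numbers\<close>

text \<open>
  Since \<open>1, \<epsilon>\<close> is a basis of \<open>k[\<epsilon>]/(\<epsilon>\<^sup>2)\<close>, elements of the tensor product are uniquely of the form
  \<open>a \<otimes> 1 + b \<otimes> \<epsilon>\<close>; this element is encoded as the pair \<open>(a, b)\<close>. The map \<open>\<sigma>\<close> is the additive
  endomorphism of \<open>A\<close> given by \<open>\<sigma> c = (-1)\<^bsup>|c|\<^esup> c\<close> for homogeneous \<open>c\<close>, so the
  multiplication is the biadditive one with \<open>(b \<otimes> \<epsilon>)(c \<otimes> 1) = (-1)\<^bsup>|c|\<^esup> bc \<otimes> \<epsilon>\<close>.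
\<close>

definition dual_ext :: "('a, 'b) ring_scheme \<Rightarrow> ('a \<Rightarrow> 'a) \<Rightarrow> ('a \<times> 'a) ring" where
  "dual_ext A \<sigma> = \<lparr>carrier = carrier A \<times> carrier A,
     monoid.mult = (\<lambda>(a, b) (c, d). (a \<otimes>\<^bsub>A\<^esub> c, a \<otimes>\<^bsub>A\<^esub> d \<oplus>\<^bsub>A\<^esub> b \<otimes>\<^bsub>A\<^esub> \<sigma> c)),
     one = (\<one>\<^bsub>A\<^esub>, \<zero>\<^bsub>A\<^esub>),
     zero = (\<zero>\<^bsub>A\<^esub>, \<zero>\<^bsub>A\<^esub>),
     add = (\<lambda>(a, b) (c, d). (a \<oplus>\<^bsub>A\<^esub> c, b \<oplus>\<^bsub>A\<^esub> d))\<rparr>"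

lemma ring_dual_ext:
  assumes "ring A" "\<sigma> \<in> ring_hom A A"
  shows "ring (dual_ext A \<sigma>)"
proof -
  interpret ring A by fact
  note hom = ring_hom_closed[OF assms(2)] ring_hom_add[OF assms(2)] ring_hom_mult[OF assms(2)]
    ring_hom_one[OF assms(2)]
  show ?thesis
  proof (rule ringI)
    show "abelian_group (dual_ext A \<sigma>)"
    proof (rule abelian_groupI)
      show "\<exists>y\<in>carrier (dual_ext A \<sigma>). y \<oplus>\<^bsub>dual_ext A \<sigma>\<^esub> x = \<zero>\<^bsub>dual_ext A \<sigma>\<^esub>"
        if "x \<in> carrier (dual_ext A \<sigma>)" for x
        using that
        by (intro bexI[of _ "(\<ominus>\<^bsub>A\<^esub> fst x, \<ominus>\<^bsub>A\<^esub> snd x)"]) (auto simp: dual_ext_def l_neg)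
    qed (auto simp: dual_ext_def a_ac)
    show "monoid (dual_ext A \<sigma>)"
      by (rule monoidI) (auto simp: dual_ext_def hom l_distr r_distr m_assoc a_assoc)
  qed (auto simp: dual_ext_def hom l_distr r_distr a_ac)
qed

text \<open>\<open>pure_tensor A a l\<close> is \<open>a \<otimes> \<epsilon>\<^sup>l\<close>.\<close>

definition pure_tensor :: "('a, 'b) ring_scheme \<Rightarrow> 'a \<Rightarrow> nat \<Rightarrow> 'a \<times> 'a" where
  "pure_tensor A a l =
     (if l = 0 then (a, \<zero>\<^bsub>A\<^esub>) else if l = 1 then (\<zero>\<^bsub>A\<^esub>, a) else (\<zero>\<^bsub>A\<^esub>, \<zero>\<^bsub>A\<^esub>))"

text \<open>The defining multiplication rule of the graded tensor product.\<close>

lemma dual_ext_mult_pure_tensor: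
  assumes "ring A" "\<sigma> \<zero>\<^bsub>A\<^esub> = \<zero>\<^bsub>A\<^esub>"
    and "a \<in> carrier A" "b \<in> carrier A"
    and "\<sigma> b = (if even n then b else \<ominus>\<^bsub>A\<^esub> b)"
  shows "pure_tensor A a l \<otimes>\<^bsub>dual_ext A \<sigma>\<^esub> pure_tensor A b m =
    pure_tensor A (if even (int l * n) then a \<otimes>\<^bsub>A\<^esub> b else \<ominus>\<^bsub>A\<^esub> (a \<otimes>\<^bsub>A\<^esub> b)) (l + m)"
proof -
  interpret ring A by fact
  show ?thesis
    using assms(2-) by (auto simp: pure_tensor_def dual_ext_def r_minus)
qed

definition Gamma :: "('a, 'b) ring_scheme \<Rightarrow>
    (('a \<times> 'a, 'm) rmodule, 'm \<Rightarrow> 'm, ('a, 'm) rmodule \<times> ('m \<Rightarrow> 'm), 'm \<Rightarrow> 'm) ftor" where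
  "Gamma A = \<lparr>FOb = (\<lambda>M. (restrict_scalars (\<lambda>a. pure_tensor A a 0) M,
                          \<lambda>m\<in>carrier M. m \<triangleleft>\<^bsub>M\<^esub> pure_tensor A \<one>\<^bsub>A\<^esub> 1)),
              FArr = (\<lambda>M N f. f)\<rparr>"


section \<open>Graded bound quivers\<close>

text \<open>
  A quiver is a \<^typ>\<open>('v, 'e) pre_digraph\<close> with sources \<^const>\<open>tail\<close> and targets \<^const>\<open>head\<close>. A path
  is a triple of its start, its list of arrows and its end; \<open>(v, [], v)\<close> is the trivial
  path at \<open>v\<close>. Paths are composed from left to right.
\<close>

type_synonym ('v, 'e) path = "'v \<times> 'e list \<times> 'v"

definition paths :: "('v, 'e) pre_digraph \<Rightarrow> ('v, 'e) path set" where
  "paths Q = {(u, p, v). pre_digraph.awalk Q u p v}"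

definition path_length :: "('v, 'e) path \<Rightarrow> nat" where
  "path_length p = length (fst (snd p))"

definition path_deg :: "('e \<Rightarrow> int) \<Rightarrow> ('v, 'e) path \<Rightarrow> int" where
  "path_deg \<delta> p = sum_list (map \<delta> (fst (snd p)))"

text \<open>Pairs of composable paths with composite \<open>p\<close>.\<close>

definition path_splits :: "('v, 'e) pre_digraph \<Rightarrow> ('v, 'e) path \<Rightarrow> (('v, 'e) path \<times> ('v, 'e) path) set" where
  "path_splits Q p = {((u, q, v), (v', r, w)). (u, q, v) \<in> paths Q \<and> (v', r, w) \<in> paths Q
     \<and> v = v' \<and> p = (u, q @ r, w)}"

definition path_scalar :: "('v, 'e) pre_digraph \<Rightarrow> 'k::field \<Rightarrow> ('v, 'e) path \<Rightarrow> 'k" where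
  "path_scalar Q c = (\<lambda>p. if p \<in> paths Q \<and> path_length p = 0 then c else 0)"

definition path_algebra :: "('v, 'e) pre_digraph \<Rightarrow> (('v, 'e) path \<Rightarrow> 'k::field) ring" where
  "path_algebra Q = \<lparr>carrier = {x. finite {p. x p \<noteq> 0} \<and> {p. x p \<noteq> 0} \<subseteq> paths Q},
     monoid.mult = (\<lambda>x y p. \<Sum>(q, r)\<in>path_splits Q p. x q * y r),
     one = path_scalar Q 1,
     zero = (\<lambda>p. 0),
     add = (\<lambda>x y p. x p + y p)\<rparr>"

lemma paths_append:
  assumes "(u, q, v) \<in> paths Q" "(v, r, w) \<in> paths Q"
  shows "(u, q @ r, w) \<in> paths Q"
proof -
  have "pre_digraph.cas Q u q v \<Longrightarrow> pre_digraph.cas Q v r w \<Longrightarrow> pre_digraph.cas Q u (q @ r) w"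
    by (induction q arbitrary: u) (auto simp: pre_digraph.cas.simps)
  then show ?thesis using assms by (auto simp: paths_def pre_digraph.awalk_def)
qed

lemma finite_path_splits: "finite (path_splits Q p)"
proof -
  let ?f = "\<lambda>(i, v). ((fst p, take i (fst (snd p)), v), (v, drop i (fst (snd p)), snd (snd p)))"
  let ?g = "\<lambda>i. (SOME v. (fst p, take i (fst (snd p)), v) \<in> paths Q)"
  have uniq: "v = ?g i" if "(fst p, take i (fst (snd p)), v) \<in> paths Q" for i v
  proof -
    have "(fst p, take i (fst (snd p)), ?g i) \<in> paths Q" using that by (rule someI)
    moreover have "pre_digraph.cas Q u q v \<Longrightarrow> pre_digraph.cas Q u q v' \<Longrightarrow> v = v'" for u q v v'
      by (induction q arbitrary: u) (auto simp: pre_digraph.cas.simps)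
    ultimately show ?thesis using that
      unfolding paths_def pre_digraph.awalk_def by blast
  qed
  have "path_splits Q p \<subseteq> (\<lambda>i. ?f (i, ?g i)) ` {..length (fst (snd p))}"
  proof
    fix z assume "z \<in> path_splits Q p"
    then obtain u q v r w where z: "z = ((u, q, v), (v, r, w))" "(u, q, v) \<in> paths Q" "p = (u, q @ r, w)"
      by (auto simp: path_splits_def)
    with uniq[of "length q" v] have "z = ?f (length q, ?g (length q))" by simp
    moreover have "length q \<in> {..length (fst (snd p))}" using z(3) by simp
    ultimately show "z \<in> (\<lambda>i. ?f (i, ?g i)) ` {..length (fst (snd p))}" by (rule image_eqI)
  qed
  then show ?thesis by (rule finite_subset) simp
qed

lemma path_splits_assoc_sum:
  fixes f :: "('v, 'e) path \<Rightarrow> ('v, 'e) path \<Rightarrow> ('v, 'e) path \<Rightarrow> 'k::comm_monoid_add"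
  shows "(\<Sum>(s, t)\<in>path_splits Q p. \<Sum>(q, r)\<in>path_splits Q s. f q r t)
       = (\<Sum>(q, s)\<in>path_splits Q p. \<Sum>(r, t)\<in>path_splits Q s. f q r t)"
proof -
  have "(\<Sum>(s, t)\<in>path_splits Q p. \<Sum>(q, r)\<in>path_splits Q s. f q r t)
      = (\<Sum>((s, t), (q, r))\<in>(SIGMA st:path_splits Q p. path_splits Q (fst st)). f q r t)"
    by (subst sum.Sigma[symmetric]) (auto simp: finite_path_splits split_def)
  also have "\<dots> = (\<Sum>((q, s), (r, t))\<in>(SIGMA qs:path_splits Q p. path_splits Q (snd qs)). f q r t)"
    by (rule sum.reindex_bij_witness
        [where i = "\<lambda>((q, s), (r, t)). (((fst q, fst (snd q) @ fst (snd r), snd (snd r)), t), (q, r))"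
           and j = "\<lambda>((s, t), (q, r)). ((q, (fst r, fst (snd r) @ fst (snd t), snd (snd t))), (r, t))"])
      (auto simp: path_splits_def intro: paths_append)
  also have "\<dots> = (\<Sum>(q, s)\<in>path_splits Q p. \<Sum>(r, t)\<in>path_splits Q s. f q r t)"
    by (subst sum.Sigma[symmetric]) (auto simp: finite_path_splits split_def)
  finally show ?thesis .
qed

lemma path_algebra_mult_closed:
  assumes "x \<in> carrier (path_algebra Q)" "y \<in> carrier (path_algebra Q)"
  shows "x \<otimes>\<^bsub>path_algebra Q\<^esub> y \<in> carrier (path_algebra Q)"
proof -
  let ?S = "{p. x p \<noteq> 0}" and ?T = "{p. y p \<noteq> 0}"
  have ex: "\<exists>q r. (q, r) \<in> path_splits Q p \<and> x q \<noteq> 0 \<and> y r \<noteq> 0"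
    if nz: "(x \<otimes>\<^bsub>path_algebra Q\<^esub> y) p \<noteq> 0" for p
  proof -
    have "(\<Sum>(q, r)\<in>path_splits Q p. x q * y r) \<noteq> 0" using nz by (simp add: path_algebra_def)
    then obtain z where "z \<in> path_splits Q p" "(case z of (q, r) \<Rightarrow> x q * y r) \<noteq> 0"
      by (rule sum.not_neutral_contains_not_neutral)
    then show ?thesis by (cases z) (metis case_prod_conv mult_eq_0_iff)
  qed
  have "{p. (x \<otimes>\<^bsub>path_algebra Q\<^esub> y) p \<noteq> 0}
      \<subseteq> (\<lambda>(q, r). (fst q, fst (snd q) @ fst (snd r), snd (snd r))) ` (?S \<times> ?T)"
    using ex by (fastforce simp: path_splits_def image_iff)
  moreover have "finite (?S \<times> ?T)" using assms by (simp add: path_algebra_def)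
  ultimately have "finite {p. (x \<otimes>\<^bsub>path_algebra Q\<^esub> y) p \<noteq> 0}"
    by (meson finite_imageI finite_subset)
  moreover have "{p. (x \<otimes>\<^bsub>path_algebra Q\<^esub> y) p \<noteq> 0} \<subseteq> paths Q"
    using ex by (fastforce simp: path_splits_def intro: paths_append)
  ultimately show ?thesis by (simp add: path_algebra_def)
qed

lemma path_scalar_mult:
  assumes "wf_digraph Q" "x \<in> carrier (path_algebra Q)"
  shows "path_scalar Q c \<otimes>\<^bsub>path_algebra Q\<^esub> x = (\<lambda>p. c * x p)"
    and "x \<otimes>\<^bsub>path_algebra Q\<^esub> path_scalar Q c = (\<lambda>p. x p * c)"
proof -
  have supp: "x p = 0" "path_splits Q p = {}" if "p \<notin> paths Q" for p
    using that assms(2) by (auto simp: path_algebra_def path_splits_def intro: paths_append)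
  have ends: "(u, [], u) \<in> paths Q" "(w, [], w) \<in> paths Q" if "(u, r, w) \<in> paths Q" for u r w
    using that wf_digraph.awalk_last_in_verts[OF assms(1)]
    by (auto simp: paths_def pre_digraph.awalk_def pre_digraph.cas.simps)
  have triv: "path_scalar Q c (u, r, w) = (if (u, r, w) \<in> paths Q \<and> r = [] then c else 0)" for u r w
    by (simp add: path_scalar_def path_length_def)
  have triv2: "(u, [], w) \<in> paths Q \<Longrightarrow> u = w" for u w
    by (auto simp: paths_def pre_digraph.awalk_def pre_digraph.cas.simps)
  show "path_scalar Q c \<otimes>\<^bsub>path_algebra Q\<^esub> x = (\<lambda>p. c * x p)"
  proof
    fix p
    show "(path_scalar Q c \<otimes>\<^bsub>path_algebra Q\<^esub> x) p = c * x p"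
    proof (cases "p \<in> paths Q")
      case True
      obtain u r w where p: "p = (u, r, w)" by (cases p)
      have "(\<Sum>(q, r)\<in>path_splits Q p. path_scalar Q c q * x r)
          = (\<Sum>(q, r)\<in>{((u, [], u), p)}. path_scalar Q c q * x r)"
        using True ends[of u r w]
        by (intro sum.mono_neutral_right finite_path_splits)
          (auto simp: p path_splits_def triv dest: triv2 split: if_splits)
      then show ?thesis using True ends[of u r w] by (simp add: path_algebra_def triv p)
    qed (simp add: path_algebra_def supp)
  qed
  show "x \<otimes>\<^bsub>path_algebra Q\<^esub> path_scalar Q c = (\<lambda>p. x p * c)"
  proof
    fix p
    show "(x \<otimes>\<^bsub>path_algebra Q\<^esub> path_scalar Q c) p = x p * c"
    proof (cases "p \<in> paths Q")
      case True
      obtain u r w where p: "p = (u, r, w)" by (cases p)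
      have "(\<Sum>(q, r)\<in>path_splits Q p. x q * path_scalar Q c r)
          = (\<Sum>(q, r)\<in>{(p, (w, [], w))}. x q * path_scalar Q c r)"
        using True ends[of u r w]
        by (intro sum.mono_neutral_right finite_path_splits)
          (auto simp: p path_splits_def triv dest: triv2 split: if_splits)
      then show ?thesis using True ends[of u r w] by (simp add: path_algebra_def triv p)
    qed (simp add: path_algebra_def supp)
  qed
qed

lemma finite_paths_length_0: "finite (verts Q) \<Longrightarrow> finite {p \<in> paths Q. path_length p = 0}"
  by (rule finite_subset[where B = "(\<lambda>v. (v, [], v)) ` verts Q"])
    (auto simp: paths_def path_length_def pre_digraph.awalk_def pre_digraph.cas.simps)

lemma path_scalar_closed:
  assumes "finite (verts Q)"
  shows "path_scalar Q c \<in> carrier (path_algebra Q)"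
  using finite_paths_length_0[OF assms]
  by (auto simp: path_algebra_def path_scalar_def)

lemma ring_path_algebra:
  assumes "fin_digraph Q"
  shows "ring (path_algebra Q :: (('v, 'e) path \<Rightarrow> 'k::field) ring)"
proof -
  interpret fin_digraph Q by fact
  let ?R = "path_algebra Q :: (('v, 'e) path \<Rightarrow> 'k) ring"
  have add: "x \<oplus>\<^bsub>?R\<^esub> y \<in> carrier ?R" if "x \<in> carrier ?R" "y \<in> carrier ?R" for x y
  proof -
    have "{p. x p + y p \<noteq> 0} \<subseteq> {p. x p \<noteq> 0} \<union> {p. y p \<noteq> 0}" by auto
    moreover have "finite ({p. x p \<noteq> 0} \<union> {p. y p \<noteq> 0})" "{p. x p \<noteq> 0} \<union> {p. y p \<noteq> 0} \<subseteq> paths Q"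
      using that by (auto simp: path_algebra_def)
    ultimately have "finite {p. x p + y p \<noteq> 0}" "{p. x p + y p \<noteq> 0} \<subseteq> paths Q"
      by (meson finite_subset, meson subset_trans)
    then show ?thesis by (simp add: path_algebra_def)
  qed
  have assoc: "x \<otimes>\<^bsub>?R\<^esub> y \<otimes>\<^bsub>?R\<^esub> z = x \<otimes>\<^bsub>?R\<^esub> (y \<otimes>\<^bsub>?R\<^esub> z)" for x y z
  proof
    fix p
    have "(x \<otimes>\<^bsub>?R\<^esub> y \<otimes>\<^bsub>?R\<^esub> z) p
        = (\<Sum>(s, t)\<in>path_splits Q p. \<Sum>(q, r)\<in>path_splits Q s. x q * y r * z t)"
      by (simp add: path_algebra_def sum_distrib_right split_def)
    also have "\<dots> = (\<Sum>(q, s)\<in>path_splits Q p. \<Sum>(r, t)\<in>path_splits Q s. x q * y r * z t)"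
      by (rule path_splits_assoc_sum)
    also have "\<dots> = (x \<otimes>\<^bsub>?R\<^esub> (y \<otimes>\<^bsub>?R\<^esub> z)) p"
      by (simp add: path_algebra_def sum_distrib_left split_def mult.assoc)
    finally show "(x \<otimes>\<^bsub>?R\<^esub> y \<otimes>\<^bsub>?R\<^esub> z) p = (x \<otimes>\<^bsub>?R\<^esub> (y \<otimes>\<^bsub>?R\<^esub> z)) p" .
  qed
  have neg: "(\<lambda>p. - x p) \<in> carrier ?R" if "x \<in> carrier ?R" for x
    using that by (simp add: path_algebra_def)
  show ?thesis
  proof (rule ringI)
    show "abelian_group ?R"
    proof (rule abelian_groupI)
      show "\<exists>y\<in>carrier ?R. y \<oplus>\<^bsub>?R\<^esub> x = \<zero>\<^bsub>?R\<^esub>" if "x \<in> carrier ?R" for x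
        by (rule bexI[OF _ neg[OF that]]) (simp add: path_algebra_def)
    qed (fact add, simp_all add: path_algebra_def add_ac)
    show "monoid ?R"
    proof (rule monoidI)
      show "\<one>\<^bsub>?R\<^esub> \<in> carrier ?R"
        using path_scalar_closed[of Q 1] by (simp add: path_algebra_def)
      have one: "\<one>\<^bsub>?R\<^esub> = path_scalar Q 1" by (simp add: path_algebra_def)
      show "\<one>\<^bsub>?R\<^esub> \<otimes>\<^bsub>?R\<^esub> x = x" "x \<otimes>\<^bsub>?R\<^esub> \<one>\<^bsub>?R\<^esub> = x" if "x \<in> carrier ?R" for x
        unfolding one using path_scalar_mult[OF wf_digraph_axioms that, of 1] by simp_all
    qed (rule path_algebra_mult_closed, assumption, assumption, rule assoc)
    show "(x \<oplus>\<^bsub>?R\<^esub> y) \<otimes>\<^bsub>?R\<^esub> z = x \<otimes>\<^bsub>?R\<^esub> z \<oplus>\<^bsub>?R\<^esub> y \<otimes>\<^bsub>?R\<^esub> z" for x y z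
      by (simp add: path_algebra_def fun_eq_iff split_def distrib_right sum.distrib)
    show "z \<otimes>\<^bsub>?R\<^esub> (x \<oplus>\<^bsub>?R\<^esub> y) = z \<otimes>\<^bsub>?R\<^esub> x \<oplus>\<^bsub>?R\<^esub> z \<otimes>\<^bsub>?R\<^esub> y" for x y z
      by (simp add: path_algebra_def fun_eq_iff split_def distrib_left sum.distrib)
  qed
qed

text \<open>The \<open>m\<close>-th power of the arrow ideal is spanned by the paths of length at least \<open>m\<close>.\<close>

definition arrow_ideal_power :: "('v, 'e) pre_digraph \<Rightarrow> nat \<Rightarrow> (('v, 'e) path \<Rightarrow> 'k::field) set" where
  "arrow_ideal_power Q m = {x \<in> carrier (path_algebra Q). \<forall>p. x p \<noteq> 0 \<longrightarrow> m \<le> path_length p}"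

definition admissible_ideal :: "('v, 'e) pre_digraph \<Rightarrow> (('v, 'e) path \<Rightarrow> 'k::field) set \<Rightarrow> bool" where
  "admissible_ideal Q I \<longleftrightarrow> ideal I (path_algebra Q) \<and> I \<subseteq> arrow_ideal_power Q 2
     \<and> (\<exists>m\<ge>2. arrow_ideal_power Q m \<subseteq> I)"

definition homogeneous_component ::
  "('e \<Rightarrow> int) \<Rightarrow> int \<Rightarrow> (('v, 'e) path \<Rightarrow> 'k::field) \<Rightarrow> ('v, 'e) path \<Rightarrow> 'k" where
  "homogeneous_component \<delta> n x = (\<lambda>p. if path_deg \<delta> p = n then x p else 0)"

definition homogeneous_ideal :: "('e \<Rightarrow> int) \<Rightarrow> (('v, 'e) path \<Rightarrow> 'k::field) set \<Rightarrow> bool" where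
  "homogeneous_ideal \<delta> I \<longleftrightarrow> (\<forall>x\<in>I. \<forall>n. homogeneous_component \<delta> n x \<in> I)"

definition graded_bound_quiver ::
  "('v, 'e) pre_digraph \<Rightarrow> ('e \<Rightarrow> int) \<Rightarrow> (('v, 'e) path \<Rightarrow> 'k::field) set \<Rightarrow> bool" where
  "graded_bound_quiver Q \<delta> I \<longleftrightarrow>
     fin_digraph Q \<and> admissible_ideal Q I \<and> homogeneous_ideal \<delta> I"

definition quiver_algebra ::
  "('v, 'e) pre_digraph \<Rightarrow> (('v, 'e) path \<Rightarrow> 'k::field) set \<Rightarrow> (('v, 'e) path \<Rightarrow> 'k) set ring" where
  "quiver_algebra Q I = path_algebra Q Quot I"

definition quiver_algebra_scalar ::
  "('v, 'e) pre_digraph \<Rightarrow> (('v, 'e) path \<Rightarrow> 'k::field) set \<Rightarrow> 'k \<Rightarrow> (('v, 'e) path \<Rightarrow> 'k) set" where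
  "quiver_algebra_scalar Q I c = I +>\<^bsub>path_algebra Q\<^esub> path_scalar Q c"

definition quiver_algebra_degree ::
  "('v, 'e) pre_digraph \<Rightarrow> ('e \<Rightarrow> int) \<Rightarrow> (('v, 'e) path \<Rightarrow> 'k::field) set
     \<Rightarrow> int \<Rightarrow> (('v, 'e) path \<Rightarrow> 'k) set set" where
  "quiver_algebra_degree Q \<delta> I n =
     {I +>\<^bsub>path_algebra Q\<^esub> x | x. x \<in> carrier (path_algebra Q) \<and> (\<forall>p. x p \<noteq> 0 \<longrightarrow> path_deg \<delta> p = n)}"

definition finite_dimensional_algebra :: "('a, 'b) ring_scheme \<Rightarrow> ('k \<Rightarrow> 'a) \<Rightarrow> bool" where
  "finite_dimensional_algebra A \<iota> \<longleftrightarrow> (\<exists>n. ring.dimension A n (range \<iota>) (carrier A))"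

text \<open>
  The map \<open>\<sigma>\<close> on \<open>A = kQ/I\<close>: it changes the signs of the odd paths in each representative of a
  class. As \<open>I\<close> is homogeneous, the result is again a class modulo \<open>I\<close>.
\<close>

definition path_sign :: "('e \<Rightarrow> int) \<Rightarrow> (('v, 'e) path \<Rightarrow> 'k::field) \<Rightarrow> ('v, 'e) path \<Rightarrow> 'k" where
  "path_sign \<delta> x = (\<lambda>p. if even (path_deg \<delta> p) then x p else - x p)"

definition quiver_algebra_sign ::
  "('e \<Rightarrow> int) \<Rightarrow> (('v, 'e) path \<Rightarrow> 'k::field) set \<Rightarrow> (('v, 'e) path \<Rightarrow> 'k) set" where
  "quiver_algebra_sign \<delta> X = path_sign \<delta> ` X"

lemma quiver_algebra_sign_coset:
  assumes "ideal I (path_algebra Q)" "homogeneous_ideal \<delta> I"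
  shows "quiver_algebra_sign \<delta> (I +>\<^bsub>path_algebra Q\<^esub> x) = I +>\<^bsub>path_algebra Q\<^esub> path_sign \<delta> x"
proof -
  interpret ideal I "path_algebra Q" by fact
  have sgn: "path_sign \<delta> y \<in> I" if y: "y \<in> I" for y
  proof -
    have fin: "finite {p. y p \<noteq> 0}" using y a_subset by (auto simp: path_algebra_def)
    let ?N = "path_deg \<delta> ` {p. y p \<noteq> 0}"
    have uminus: "(\<lambda>p. - z p) \<in> I" if "z \<in> I" for z
    proof -
      have z: "z \<in> carrier (path_algebra Q)" using that a_subset by auto
      have "(\<lambda>p. - z p) \<in> carrier (path_algebra Q)" using z by (simp add: path_algebra_def)
      moreover have "(\<lambda>p. - z p) \<oplus>\<^bsub>path_algebra Q\<^esub> z = \<zero>\<^bsub>path_algebra Q\<^esub>"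
        by (simp add: path_algebra_def)
      ultimately have "\<ominus>\<^bsub>path_algebra Q\<^esub> z = (\<lambda>p. - z p)" using z minus_equality by blast
      then show ?thesis using additive_subgroup.a_inv_closed[OF is_additive_subgroup that] by simp
    qed
    have plus: "(\<lambda>p. z p + z' p) \<in> I" if "z \<in> I" "z' \<in> I" for z z'
      using additive_subgroup.a_closed[OF is_additive_subgroup that] by (simp add: path_algebra_def)
    have zero: "(\<lambda>p. 0) \<in> I" using additive_subgroup.zero_closed[OF is_additive_subgroup]
      by (simp add: path_algebra_def)
    have "(\<lambda>p. \<Sum>n\<in>N. path_sign \<delta> (homogeneous_component \<delta> n y) p) \<in> I" if "finite N" for N
      using that
    proof induction
      case (insert n N)
      have "homogeneous_component \<delta> n y \<in> I"
        using assms(2) y by (simp add: homogeneous_ideal_def)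
      moreover have "path_sign \<delta> (homogeneous_component \<delta> n y)
          = (if even n then homogeneous_component \<delta> n y else (\<lambda>p. - homogeneous_component \<delta> n y p))"
        by (auto simp: path_sign_def homogeneous_component_def)
      ultimately have "path_sign \<delta> (homogeneous_component \<delta> n y) \<in> I" using uminus by simp
      then show ?case using plus[OF _ insert.IH] insert.hyps by simp
    qed (use zero in simp)
    moreover have "(\<lambda>p. \<Sum>n\<in>?N. path_sign \<delta> (homogeneous_component \<delta> n y) p) = path_sign \<delta> y"
    proof
      fix p
      have "(\<Sum>n\<in>?N. path_sign \<delta> (homogeneous_component \<delta> n y) p)
          = (\<Sum>n\<in>?N. if n = path_deg \<delta> p then path_sign \<delta> y p else 0)"
        by (intro sum.cong) (auto simp: path_sign_def homogeneous_component_def)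
      also have "\<dots> = path_sign \<delta> y p" using fin by (auto simp: path_sign_def)
      finally show "(\<Sum>n\<in>?N. path_sign \<delta> (homogeneous_component \<delta> n y) p) = path_sign \<delta> y p" .
    qed
    ultimately show ?thesis using fin by (metis finite_imageI)
  qed
  have inv: "path_sign \<delta> (path_sign \<delta> y) = y" for y :: "('a, 'b) path \<Rightarrow> 'c"
    by (auto simp: path_sign_def)
  have add: "path_sign \<delta> (y \<oplus>\<^bsub>path_algebra Q\<^esub> z) = path_sign \<delta> y \<oplus>\<^bsub>path_algebra Q\<^esub> path_sign \<delta> z"
    for y z :: "('a, 'b) path \<Rightarrow> 'c"
    by (auto simp: path_sign_def path_algebra_def)
  show ?thesis
  proof (intro equalityI subsetI)
    fix z assume "z \<in> quiver_algebra_sign \<delta> (I +>\<^bsub>path_algebra Q\<^esub> x)"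
    then show "z \<in> I +>\<^bsub>path_algebra Q\<^esub> path_sign \<delta> x"
      using sgn by (auto simp: quiver_algebra_sign_def a_r_coset_def' add)
  next
    fix z assume "z \<in> I +>\<^bsub>path_algebra Q\<^esub> path_sign \<delta> x"
    then obtain h where h: "h \<in> I" "z = h \<oplus>\<^bsub>path_algebra Q\<^esub> path_sign \<delta> x"
      by (auto simp: a_r_coset_def')
    have "z = path_sign \<delta> (path_sign \<delta> h \<oplus>\<^bsub>path_algebra Q\<^esub> x)" by (simp only: add inv h(2))
    moreover have "path_sign \<delta> h \<oplus>\<^bsub>path_algebra Q\<^esub> x \<in> I +>\<^bsub>path_algebra Q\<^esub> x"
      using sgn[OF h(1)] by (auto simp: a_r_coset_def')
    ultimately show "z \<in> quiver_algebra_sign \<delta> (I +>\<^bsub>path_algebra Q\<^esub> x)"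
      unfolding quiver_algebra_sign_def by (rule image_eqI)
  qed
qed

text \<open>The sign map is the one required in \<^const>\<open>dual_ext\<close>.\<close>

lemma quiver_algebra_sign_homogeneous:
  assumes "graded_bound_quiver Q \<delta> I" and a: "a \<in> quiver_algebra_degree Q \<delta> I n"
  shows "quiver_algebra_sign \<delta> a = (if even n then a else \<ominus>\<^bsub>quiver_algebra Q I\<^esub> a)"
proof -
  have id: "ideal I (path_algebra Q)" and hom: "homogeneous_ideal \<delta> I"
    using assms(1) by (auto simp: graded_bound_quiver_def admissible_ideal_def)
  interpret ideal I "path_algebra Q" by fact
  interpret A: ring "quiver_algebra Q I"
    unfolding quiver_algebra_def by (rule quotient_is_ring)
  obtain x where x: "x \<in> carrier (path_algebra Q)" "a = I +>\<^bsub>path_algebra Q\<^esub> x"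
    "\<And>p. x p \<noteq> 0 \<Longrightarrow> path_deg \<delta> p = n"
    using a by (auto simp: quiver_algebra_degree_def)
  have sx: "path_sign \<delta> x = (if even n then x else (\<lambda>p. - x p))"
  proof
    fix p show "path_sign \<delta> x p = (if even n then x else (\<lambda>p. - x p)) p"
      using x(3)[of p] by (cases "x p = 0") (auto simp: path_sign_def)
  qed
  have mc: "(\<lambda>p. - x p) \<in> carrier (path_algebra Q)" using x(1) by (simp add: path_algebra_def)
  have "(\<lambda>p. - x p) \<oplus>\<^bsub>path_algebra Q\<^esub> x = \<zero>\<^bsub>path_algebra Q\<^esub>" by (simp add: path_algebra_def)
  then have "(I +>\<^bsub>path_algebra Q\<^esub> (\<lambda>p. - x p)) \<oplus>\<^bsub>quiver_algebra Q I\<^esub> a = \<zero>\<^bsub>quiver_algebra Q I\<^esub>"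
    using a_rcos_sum[OF mc x(1)] x(2) a_rcos_const[of "\<zero>\<^bsub>path_algebra Q\<^esub>"]
    by (simp add: quiver_algebra_def FactRing_def)
  moreover have "a \<in> carrier (quiver_algebra Q I)" "I +>\<^bsub>path_algebra Q\<^esub> (\<lambda>p. - x p) \<in> carrier (quiver_algebra Q I)"
    using x mc by (auto simp: quiver_algebra_def FactRing_def A_RCOSETS_def')
  ultimately have "\<ominus>\<^bsub>quiver_algebra Q I\<^esub> a = I +>\<^bsub>path_algebra Q\<^esub> (\<lambda>p. - x p)"
    using A.minus_equality by blast
  then show ?thesis
    using quiver_algebra_sign_coset[OF id hom, of x] x(2) sx by simp
qed

definition quiver_dual_ext ::
  "('v, 'e) pre_digraph \<Rightarrow> ('e \<Rightarrow> int) \<Rightarrow> (('v, 'e) path \<Rightarrow> 'k::field) set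
     \<Rightarrow> ((('v, 'e) path \<Rightarrow> 'k) set \<times> (('v, 'e) path \<Rightarrow> 'k) set) ring" where
  "quiver_dual_ext Q \<delta> I = dual_ext (quiver_algebra Q I) (quiver_algebra_sign \<delta>)"

lemma ring_quiver_dual_ext:
  assumes "graded_bound_quiver Q \<delta> I"
  shows "ring (quiver_dual_ext Q \<delta> I)"
proof -
  have id: "ideal I (path_algebra Q)" and hom: "homogeneous_ideal \<delta> I"
    using assms(1) by (auto simp: graded_bound_quiver_def admissible_ideal_def)
  interpret ideal I "path_algebra Q" by fact
  have closed: "path_sign \<delta> x \<in> carrier (path_algebra Q)" if "x \<in> carrier (path_algebra Q)" for x
  proof -
    have "{p. path_sign \<delta> x p \<noteq> 0} = {p. x p \<noteq> 0}" by (auto simp: path_sign_def)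
    then show ?thesis using that by (simp add: path_algebra_def)
  qed
  have mult: "path_sign \<delta> (x \<otimes>\<^bsub>path_algebra Q\<^esub> y) = path_sign \<delta> x \<otimes>\<^bsub>path_algebra Q\<^esub> path_sign \<delta> y" for x y
  proof
    fix p
    have "(\<Sum>(q, r)\<in>path_splits Q p. path_sign \<delta> x q * path_sign \<delta> y r)
        = (\<Sum>(q, r)\<in>path_splits Q p. if even (path_deg \<delta> p) then x q * y r else - (x q * y r))"
      by (rule sum.cong) (auto simp: path_splits_def path_sign_def path_deg_def)
    then show "path_sign \<delta> (x \<otimes>\<^bsub>path_algebra Q\<^esub> y) p = (path_sign \<delta> x \<otimes>\<^bsub>path_algebra Q\<^esub> path_sign \<delta> y) p"
      by (auto simp: path_algebra_def path_sign_def split_def sum_negf)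
  qed
  have add: "path_sign \<delta> (x \<oplus>\<^bsub>path_algebra Q\<^esub> y) = path_sign \<delta> x \<oplus>\<^bsub>path_algebra Q\<^esub> path_sign \<delta> y" for x y
    by (auto simp: path_sign_def path_algebra_def)
  have one: "path_sign \<delta> \<one>\<^bsub>path_algebra Q\<^esub> = \<one>\<^bsub>path_algebra Q\<^esub>"
    by (auto simp: path_sign_def path_algebra_def path_scalar_def path_length_def path_deg_def)
  note sign = quiver_algebra_sign_coset[OF id hom]
  have coset: "X \<in> carrier (quiver_algebra Q I) \<longleftrightarrow>
      (\<exists>x\<in>carrier (path_algebra Q). X = I +>\<^bsub>path_algebra Q\<^esub> x)" for X
    by (auto simp: quiver_algebra_def FactRing_def A_RCOSETS_def')
  have "quiver_algebra_sign \<delta> \<in> ring_hom (quiver_algebra Q I) (quiver_algebra Q I)"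
  proof (rule ring_hom_memI)
    fix X Y assume "X \<in> carrier (quiver_algebra Q I)" "Y \<in> carrier (quiver_algebra Q I)"
    then obtain x y where xy: "x \<in> carrier (path_algebra Q)" "y \<in> carrier (path_algebra Q)"
      "X = I +>\<^bsub>path_algebra Q\<^esub> x" "Y = I +>\<^bsub>path_algebra Q\<^esub> y" unfolding coset by blast
    show "quiver_algebra_sign \<delta> (X \<otimes>\<^bsub>quiver_algebra Q I\<^esub> Y)
        = quiver_algebra_sign \<delta> X \<otimes>\<^bsub>quiver_algebra Q I\<^esub> quiver_algebra_sign \<delta> Y"
      using xy closed[of x] closed[of y]
      by (simp add: quiver_algebra_def FactRing_def rcoset_mult_add sign mult)
    show "quiver_algebra_sign \<delta> (X \<oplus>\<^bsub>quiver_algebra Q I\<^esub> Y)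
        = quiver_algebra_sign \<delta> X \<oplus>\<^bsub>quiver_algebra Q I\<^esub> quiver_algebra_sign \<delta> Y"
      using xy closed[of x] closed[of y]
      by (simp add: quiver_algebra_def FactRing_def a_rcos_sum sign add)
  next
    fix X assume "X \<in> carrier (quiver_algebra Q I)"
    then show "quiver_algebra_sign \<delta> X \<in> carrier (quiver_algebra Q I)"
      unfolding coset using sign closed by blast
  next
    show "quiver_algebra_sign \<delta> \<one>\<^bsub>quiver_algebra Q I\<^esub> = \<one>\<^bsub>quiver_algebra Q I\<^esub>"
      by (simp add: quiver_algebra_def FactRing_def sign one)
  qed
  then show ?thesis
    unfolding quiver_dual_ext_def
    by (intro ring_dual_ext) (simp add: quiver_algebra_def quotient_is_ring)
qed

end

theory Submission
  imports Defs
begin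

text \<open>
  An \<open>A\<^sup>\<ltimes>\<close>-module is an \<open>A\<close>-module with the action of \<open>\<epsilon>\<close>, a square-zero endomorphism that is linear up to
  the twist \<open>\<sigma>\<close>; this gives the first equivalence.

  For the second one, \<open>A\<^sup>\<ltimes>\<close> is coinduced from \<open>A\<close>, so \<open>Hom(X, A\<^sup>\<ltimes>)\<close> over \<open>A\<^sup>\<ltimes>\<close> is \<open>Hom(X, A)\<close> over \<open>A\<close>.
  Restriction to \<open>A\<close> is exact and preserves projectives, hence \<open>Ext\<^sup>i(M, A\<^sup>\<ltimes>)\<close> over \<open>A\<^sup>\<ltimes>\<close> is \<open>Ext\<^sup>i(M, A)\<close>
  over \<open>A\<close>. As \<open>A\<close> has finite global dimension, some syzygy of \<open>M\<close> over \<open>A\<close> is projective. If \<open>Ext\<^sup>i(M, A) = 0\<close>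
  for all \<open>i > 0\<close>, the inclusion of a projective syzygy into the preceding projective splits, so the syzygy
  before it is projective too; descending, \<open>M\<close> itself is projective.
\<close>

section \<open>Right modules\<close>

text \<open>Two features of the definitions shape the work. \<open>Ext\<close> is computed from a
  resolution picked by \<open>SOME\<close>, so its value carries information only once some
  resolution is known to exist; finite dimensionality of \<open>A\<close> enters here, by making the
  dual extension right noetherian. Moreover, \<open>projective_rmodule\<close>,
  \<open>proj_resolution\<close> and \<open>finite_global_dim\<close> each fix the types of the
  modules that they speak of, while restriction turns a resolution over the dual extension, with
  elements in \<open>nat \<Rightarrow> 'a \<times> 'a\<close>, into one over \<open>A\<close>
  outside these types. Hence lifting is extended to arbitrary types, the locale
  \<open>resolution\<close> leaves the type open, and finite global dimension, which only yields a
  bounded resolution of an isomorphic copy of the module, is carried over by comparing syzygies. The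
  coinduced module of \<open>A\<close> is the dual extension because the sign map \<sigma> is an
  involution; the identification is (x, y) \<mapsto> (\<sigma> y, \<sigma> x). The composites of
  \<open>Gamma\<close> with its quasi-inverse may change an action outside the carrier, so they are
  compared with the identity functors through identity maps.\<close>

context right_module
begin

lemma ract_zero_left [simp]:
  assumes "a \<in> carrier R" shows "\<zero>\<^bsub>M\<^esub> \<triangleleft>\<^bsub>M\<^esub> a = \<zero>\<^bsub>M\<^esub>"
proof -
  have "\<zero>\<^bsub>M\<^esub> \<triangleleft>\<^bsub>M\<^esub> a \<oplus>\<^bsub>M\<^esub> \<zero>\<^bsub>M\<^esub> \<triangleleft>\<^bsub>M\<^esub> a = \<zero>\<^bsub>M\<^esub> \<triangleleft>\<^bsub>M\<^esub> a"
    using ract_add_left[of "\<zero>\<^bsub>M\<^esub>" "\<zero>\<^bsub>M\<^esub>" a] assms by simp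
  then show ?thesis using M.add.r_cancel_one assms ract_closed by simp
qed

lemma ract_zero_right [simp]:
  assumes "x \<in> carrier M" shows "x \<triangleleft>\<^bsub>M\<^esub> \<zero>\<^bsub>R\<^esub> = \<zero>\<^bsub>M\<^esub>"
proof -
  have "x \<triangleleft>\<^bsub>M\<^esub> \<zero>\<^bsub>R\<^esub> \<oplus>\<^bsub>M\<^esub> x \<triangleleft>\<^bsub>M\<^esub> \<zero>\<^bsub>R\<^esub> = x \<triangleleft>\<^bsub>M\<^esub> \<zero>\<^bsub>R\<^esub>"
    using ract_add_right[of x "\<zero>\<^bsub>R\<^esub>" "\<zero>\<^bsub>R\<^esub>"] assms by simp
  then show ?thesis using M.add.r_cancel_one assms ract_closed by simp
qed

lemma ract_minus_left:
  assumes "x \<in> carrier M" "a \<in> carrier R"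
  shows "(\<ominus>\<^bsub>M\<^esub> x) \<triangleleft>\<^bsub>M\<^esub> a = \<ominus>\<^bsub>M\<^esub> (x \<triangleleft>\<^bsub>M\<^esub> a)"
  using ract_add_left[of "\<ominus>\<^bsub>M\<^esub> x" x a] assms
  by (intro M.minus_equality[symmetric]) (auto simp: M.l_neg ract_closed)

lemma ract_minus_right:
  assumes "x \<in> carrier M" "a \<in> carrier R"
  shows "x \<triangleleft>\<^bsub>M\<^esub> (\<ominus>\<^bsub>R\<^esub> a) = \<ominus>\<^bsub>M\<^esub> (x \<triangleleft>\<^bsub>M\<^esub> a)"
  using ract_add_right[of x "\<ominus>\<^bsub>R\<^esub> a" a] assms
  by (intro M.minus_equality[symmetric]) (auto simp: R.l_neg ract_closed)

lemma finsum_ract: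
  assumes "finite S" "f \<in> S \<rightarrow> carrier M" "a \<in> carrier R"
  shows "(\<Oplus>\<^bsub>M\<^esub>s\<in>S. f s) \<triangleleft>\<^bsub>M\<^esub> a = (\<Oplus>\<^bsub>M\<^esub>s\<in>S. f s \<triangleleft>\<^bsub>M\<^esub> a)"
  using assms
proof (induction S)
  case (insert s S)
  have "f \<in> S \<rightarrow> carrier M" "f s \<in> carrier M" "(\<lambda>s. f s \<triangleleft>\<^bsub>M\<^esub> a) \<in> S \<rightarrow> carrier M"
    using insert.prems ract_closed by auto
  with insert show ?case by (simp add: M.finsum_insert ract_add_left ract_closed)
qed simp

end

section \<open>Submodules\<close>

definition submodule_of :: "('a, 'b) ring_scheme \<Rightarrow> ('a, 'm) rmodule \<Rightarrow> 'm set \<Rightarrow> bool" where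
  "submodule_of R M N \<longleftrightarrow> N \<subseteq> carrier M \<and> \<zero>\<^bsub>M\<^esub> \<in> N
    \<and> (\<forall>x\<in>N. \<forall>y\<in>N. x \<oplus>\<^bsub>M\<^esub> y \<in> N) \<and> (\<forall>x\<in>N. \<forall>a\<in>carrier R. x \<triangleleft>\<^bsub>M\<^esub> a \<in> N)"

lemma submodule_of_carrier: "right_module R M \<Longrightarrow> submodule_of R M (carrier M)"
proof -
  assume "right_module R M"
  then interpret right_module R M .
  show ?thesis by (auto simp: submodule_of_def ract_closed)
qed

text \<open>Acting by the negative of the unit turns closure under scalars into closure under
  negatives.\<close>

lemma submodule_of_minus:
  assumes "right_module R M" "submodule_of R M N" "x \<in> N"
  shows "\<ominus>\<^bsub>M\<^esub> x \<in> N"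
proof -
  interpret right_module R M by fact
  have "x \<in> carrier M" using assms by (auto simp: submodule_of_def)
  then have "\<ominus>\<^bsub>M\<^esub> x = x \<triangleleft>\<^bsub>M\<^esub> (\<ominus>\<^bsub>R\<^esub> \<one>\<^bsub>R\<^esub>)" by (simp add: ract_minus_right ract_one)
  then show ?thesis using assms by (simp add: submodule_of_def)
qed

text \<open>A submodule is the same record with a smaller carrier. It inherits all operations and
  equations, so only closure and the existence of negatives have to be checked.\<close>

lemma right_module_submodule:
  assumes "right_module R M" "submodule_of R M N"
  shows "right_module R (M\<lparr>carrier := N\<rparr>)"
proof -
  interpret right_module R M by fact
  have sub: "x \<in> carrier M" if "x \<in> N" for x using that assms by (auto simp: submodule_of_def)
  note cl = assms(2)[unfolded submodule_of_def]
  have "abelian_group (M\<lparr>carrier := N\<rparr>)"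
  proof (rule abelian_groupI)
    show "\<exists>y\<in>carrier (M\<lparr>carrier := N\<rparr>). y \<oplus>\<^bsub>M\<lparr>carrier := N\<rparr>\<^esub> x = \<zero>\<^bsub>M\<lparr>carrier := N\<rparr>\<^esub>"
      if "x \<in> carrier (M\<lparr>carrier := N\<rparr>)" for x
      using that sub submodule_of_minus[OF assms]
      by (intro bexI[of _ "\<ominus>\<^bsub>M\<^esub> x"]) (auto simp: M.l_neg)
  qed (use cl sub in \<open>auto simp: M.a_ac\<close>)
  then show ?thesis
    using cl sub
    by (intro right_module.intro right_module_axioms.intro)
      (auto simp: R.ring_axioms ract_add_left ract_add_right ract_assoc ract_one)
qed


subsection \<open>Homomorphisms\<close>

lemma rhomD:
  assumes "f \<in> rhom R M N"
  shows "x \<in> carrier M \<Longrightarrow> f x \<in> carrier N"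
    and "\<lbrakk>x \<in> carrier M; y \<in> carrier M\<rbrakk> \<Longrightarrow> f (x \<oplus>\<^bsub>M\<^esub> y) = f x \<oplus>\<^bsub>N\<^esub> f y"
    and "\<lbrakk>x \<in> carrier M; a \<in> carrier R\<rbrakk> \<Longrightarrow> f (x \<triangleleft>\<^bsub>M\<^esub> a) = f x \<triangleleft>\<^bsub>N\<^esub> a"
    and "f \<in> extensional (carrier M)"
  using assms by (auto simp: rhom_def PiE_def)

lemma rhomI:
  assumes "\<And>x. x \<in> carrier M \<Longrightarrow> f x \<in> carrier N"
    and "\<And>x y. \<lbrakk>x \<in> carrier M; y \<in> carrier M\<rbrakk> \<Longrightarrow> f (x \<oplus>\<^bsub>M\<^esub> y) = f x \<oplus>\<^bsub>N\<^esub> f y"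
    and "\<And>x a. \<lbrakk>x \<in> carrier M; a \<in> carrier R\<rbrakk> \<Longrightarrow> f (x \<triangleleft>\<^bsub>M\<^esub> a) = f x \<triangleleft>\<^bsub>N\<^esub> a"
    and "f \<in> extensional (carrier M)"
  shows "f \<in> rhom R M N"
  using assms by (auto simp: rhom_def PiE_def)

lemma rhom_restrictI:
  assumes "right_module R M"
    and "\<And>x. x \<in> carrier M \<Longrightarrow> f x \<in> carrier N"
    and "\<And>x y. \<lbrakk>x \<in> carrier M; y \<in> carrier M\<rbrakk> \<Longrightarrow> f (x \<oplus>\<^bsub>M\<^esub> y) = f x \<oplus>\<^bsub>N\<^esub> f y"
    and "\<And>x a. \<lbrakk>x \<in> carrier M; a \<in> carrier R\<rbrakk> \<Longrightarrow> f (x \<triangleleft>\<^bsub>M\<^esub> a) = f x \<triangleleft>\<^bsub>N\<^esub> a"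
  shows "(\<lambda>x\<in>carrier M. f x) \<in> rhom R M N"
proof -
  interpret right_module R M by fact
  show ?thesis using assms by (intro rhomI) (auto simp: ract_closed)
qed

lemma rhom_eqI:
  assumes "f \<in> rhom R M N" "g \<in> rhom R M N'" "\<And>x. x \<in> carrier M \<Longrightarrow> f x = g x"
  shows "f = g"
  using assms by (auto intro: extensionalityI dest: rhomD(4))

text \<open>Acting by the zero scalar gives zero on both sides, and \<open>f\<close> commutes with
  the action.\<close>

lemma rhom_zero:
  assumes "right_module R M" "right_module R N" "f \<in> rhom R M N"
  shows "f \<zero>\<^bsub>M\<^esub> = \<zero>\<^bsub>N\<^esub>"
proof -
  interpret M: right_module R M by fact
  interpret N: right_module R N by fact
  have "f (\<zero>\<^bsub>M\<^esub> \<triangleleft>\<^bsub>M\<^esub> \<zero>\<^bsub>R\<^esub>) = f \<zero>\<^bsub>M\<^esub> \<triangleleft>\<^bsub>N\<^esub> \<zero>\<^bsub>R\<^esub>" using rhomD(3)[OF assms(3)] by blast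
  then show ?thesis using rhomD(1)[OF assms(3)] by simp
qed

lemma rhom_minus:
  assumes "right_module R M" "right_module R N" "f \<in> rhom R M N" "x \<in> carrier M"
  shows "f (\<ominus>\<^bsub>M\<^esub> x) = \<ominus>\<^bsub>N\<^esub> f x"
proof -
  interpret M: right_module R M by fact
  interpret N: right_module R N by fact
  have "f (\<ominus>\<^bsub>M\<^esub> x) \<oplus>\<^bsub>N\<^esub> f x = \<zero>\<^bsub>N\<^esub>"
    using rhomD(2)[OF assms(3), of "\<ominus>\<^bsub>M\<^esub> x" x] assms(4) rhom_zero[OF assms(1-3)]
    by (simp add: M.M.l_neg)
  then show ?thesis using rhomD(1)[OF assms(3)] assms(4) by (simp add: N.M.minus_equality)
qed

lemma rhom_compose:
  assumes "right_module R L" "f \<in> rhom R L M" "g \<in> rhom R M N"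
  shows "compose (carrier L) g f \<in> rhom R L N"
  unfolding compose_def
  using assms(1) by (rule rhom_restrictI) (simp_all add: rhomD[OF assms(2)] rhomD[OF assms(3)])

lemma rhom_id: "right_module R M \<Longrightarrow> (\<lambda>x\<in>carrier M. x) \<in> rhom R M M"
  by (erule rhom_restrictI) auto

lemma rhom_add:
  assumes "right_module R M" "right_module R N" "f \<in> rhom R M N" "g \<in> rhom R M N"
  shows "(\<lambda>x\<in>carrier M. f x \<oplus>\<^bsub>N\<^esub> g x) \<in> rhom R M N"
proof -
  interpret N: right_module R N by fact
  show ?thesis
    using assms(1) by (rule rhom_restrictI)
      (simp_all add: rhomD(1-3)[OF assms(3)] rhomD(1-3)[OF assms(4)] N.M.a_ac N.ract_add_left)
qed

lemma rhom_uminus: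
  assumes "right_module R M" "right_module R N" "f \<in> rhom R M N"
  shows "(\<lambda>x\<in>carrier M. \<ominus>\<^bsub>N\<^esub> f x) \<in> rhom R M N"
proof -
  interpret N: right_module R N by fact
  show ?thesis
    using assms(1) by (rule rhom_restrictI)
      (simp_all add: rhomD(1-3)[OF assms(3)] N.M.minus_add N.ract_minus_left)
qed

lemma rhom_diff:
  assumes "right_module R M" "right_module R N" "f \<in> rhom R M N" "g \<in> rhom R M N"
  shows "(\<lambda>x\<in>carrier M. f x \<ominus>\<^bsub>N\<^esub> g x) \<in> rhom R M N"
  using rhom_add[OF assms(1,2,3) rhom_uminus[OF assms(1,2,4)]]
  by (simp add: a_minus_def cong: restrict_cong)

lemma rhom_into_submodule:
  assumes "f \<in> rhom R X M" "f ` carrier X \<subseteq> N"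
  shows "f \<in> rhom R X (M\<lparr>carrier := N\<rparr>)"
  using assms by (auto simp: rhom_def PiE_def)

lemma rhom_from_submodule_into:
  assumes "f \<in> rhom R X (M\<lparr>carrier := N\<rparr>)" "N \<subseteq> carrier M"
  shows "f \<in> rhom R X M"
  using assms by (auto simp: rhom_def PiE_def)

lemma rhom_restrict_submodule:
  assumes "submodule_of R M N" "f \<in> rhom R M X"
  shows "restrict f N \<in> rhom R (M\<lparr>carrier := N\<rparr>) X"
  using assms by (auto simp: rhom_def submodule_of_def subset_iff)

lemma submodule_of_rkernel:
  assumes "right_module R M" "right_module R N" "f \<in> rhom R M N"
  shows "submodule_of R M (rkernel M N f)"
proof -
  interpret M: right_module R M by fact
  interpret N: right_module R N by fact
  show ?thesis
    by (auto simp: submodule_of_def rkernel_def rhomD[OF assms(3)] rhom_zero[OF assms] M.ract_closed)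
qed

lemma submodule_of_preimage:
  assumes "right_module R M" "right_module R N" "f \<in> rhom R M N" "submodule_of R N W"
  shows "submodule_of R M {x \<in> carrier M. f x \<in> W}"
proof -
  interpret M: right_module R M by fact
  show ?thesis using assms(4)
    by (auto simp: submodule_of_def rhomD[OF assms(3)] rhom_zero[OF assms(1-3)] M.ract_closed)
qed

lemma submodule_of_image:
  assumes "right_module R M" "right_module R N" "f \<in> rhom R M N"
  shows "submodule_of R N (f ` carrier M)"
proof -
  interpret M: right_module R M by fact
  show ?thesis
    unfolding submodule_of_def
  proof (intro conjI ballI)
    show "f ` carrier M \<subseteq> carrier N" using rhomD(1)[OF assms(3)] by blast
    show "\<zero>\<^bsub>N\<^esub> \<in> f ` carrier M"
      using rhom_zero[OF assms] M.M.zero_closed by (metis imageI)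
    show "y \<oplus>\<^bsub>N\<^esub> z \<in> f ` carrier M" if yz: "y \<in> f ` carrier M" "z \<in> f ` carrier M" for y z
    proof -
      obtain y' z' where "y' \<in> carrier M" "z' \<in> carrier M" "y = f y'" "z = f z'" using yz by blast
      then show ?thesis
        using rhomD(2)[OF assms(3)] by (intro image_eqI[where x = "y' \<oplus>\<^bsub>M\<^esub> z'"]) auto
    qed
    show "y \<triangleleft>\<^bsub>N\<^esub> a \<in> f ` carrier M" if y: "y \<in> f ` carrier M" and a: "a \<in> carrier R" for y a
    proof -
      obtain y' where "y' \<in> carrier M" "y = f y'" using y by blast
      then show ?thesis
        using rhomD(3)[OF assms(3)] a M.ract_closed by (intro image_eqI[where x = "y' \<triangleleft>\<^bsub>M\<^esub> a"]) auto
    qed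
  qed
qed

lemma submodule_of_equalizer:
  assumes "right_module R M" "right_module R N" "f \<in> rhom R M N" "g \<in> rhom R M N"
  shows "submodule_of R M {x \<in> carrier M. f x = g x}"
proof -
  interpret M: right_module R M by fact
  show ?thesis
    by (auto simp: submodule_of_def rhomD[OF assms(3)] rhomD[OF assms(4)] M.ract_closed
        rhom_zero[OF assms(1-3)] rhom_zero[OF assms(1,2,4)])
qed

text \<open>The homomorphism theorem: \<open>f\<close> kills the kernel of the surjection
  \<open>p\<close>, hence is constant on the fibres of \<open>p\<close> and descends to
  \<open>K\<close>.\<close>

lemma rhom_factor:
  assumes "right_module R P" "right_module R K" "right_module R N"
    and "p \<in> rhom R P K" "p ` carrier P = carrier K" "f \<in> rhom R P N"
    and "\<And>x. x \<in> carrier P \<Longrightarrow> p x = \<zero>\<^bsub>K\<^esub> \<Longrightarrow> f x = \<zero>\<^bsub>N\<^esub>"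
  obtains u where "u \<in> rhom R K N" "\<And>x. x \<in> carrier P \<Longrightarrow> u (p x) = f x"
proof -
  interpret P: right_module R P by fact
  interpret K: right_module R K by fact
  interpret N: right_module R N by fact
  have eq: "f x = f y" if "x \<in> carrier P" "y \<in> carrier P" "p x = p y" for x y
  proof -
    have "p (x \<ominus>\<^bsub>P\<^esub> y) = \<zero>\<^bsub>K\<^esub>"
      using that by (simp add: a_minus_def rhomD[OF assms(4)] rhom_minus[OF assms(1,2,4)] K.M.r_neg)
    then have "f (x \<ominus>\<^bsub>P\<^esub> y) = \<zero>\<^bsub>N\<^esub>" using assms(7) that by simp
    then have "f x \<oplus>\<^bsub>N\<^esub> \<ominus>\<^bsub>N\<^esub> f y = \<zero>\<^bsub>N\<^esub>"
      using that by (simp add: a_minus_def rhomD[OF assms(6)] rhom_minus[OF assms(1,3,6)])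
    then show ?thesis
      using that rhomD(1)[OF assms(6)] N.M.minus_equality[of "f x" "\<ominus>\<^bsub>N\<^esub> f y"] N.M.minus_minus by simp
  qed
  \<comment> \<open>Any preimage would serve, by \<open>eq\<close>; \<open>inv_into\<close> picks
    one.\<close>
  define u where "u = (\<lambda>y\<in>carrier K. f (inv_into (carrier P) p y))"
  have u: "u (p x) = f x" if "x \<in> carrier P" for x
  proof -
    have "p x \<in> p ` carrier P" using that by simp
    then have "f (inv_into (carrier P) p (p x)) = f x"
      by (intro eq that inv_into_into f_inv_into_f)
    then show ?thesis using that rhomD(1)[OF assms(4)] by (simp add: u_def)
  qed
  have "u \<in> rhom R K N"
  proof (rule rhomI)
    show "u \<in> extensional (carrier K)" by (simp add: u_def)
    fix y assume "y \<in> carrier K"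
    then obtain x where x: "x \<in> carrier P" "y = p x" using assms(5) by blast
    show "u y \<in> carrier N" using x u rhomD(1)[OF assms(6)] by simp
    show "u (y \<triangleleft>\<^bsub>K\<^esub> a) = u y \<triangleleft>\<^bsub>N\<^esub> a" if "a \<in> carrier R" for a
      using x that u[of x] u[of "x \<triangleleft>\<^bsub>P\<^esub> a"]
      by (simp add: rhomD(1-3)[OF assms(4)] rhomD(1-3)[OF assms(6)] P.ract_closed)
    fix y' assume "y' \<in> carrier K"
    then obtain x' where x': "x' \<in> carrier P" "y' = p x'" using assms(5) by blast
    show "u (y \<oplus>\<^bsub>K\<^esub> y') = u y \<oplus>\<^bsub>N\<^esub> u y'"
      using x x' u[of x] u[of x'] u[of "x \<oplus>\<^bsub>P\<^esub> x'"]
      by (simp add: rhomD(1-3)[OF assms(4)] rhomD(1-3)[OF assms(6)])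
  qed
  then show ?thesis using u that by blast
qed


subsection \<open>Free and finitely generated modules\<close>

definition free_rmodule :: "('a, 'b) ring_scheme \<Rightarrow> 's set \<Rightarrow> ('a, 's \<Rightarrow> 'a) rmodule" where
  "free_rmodule R S = \<lparr>carrier = S \<rightarrow>\<^sub>E carrier R, monoid.mult = (\<lambda>x y. x), one = (\<lambda>s\<in>S. \<zero>\<^bsub>R\<^esub>),
     zero = (\<lambda>s\<in>S. \<zero>\<^bsub>R\<^esub>), add = (\<lambda>x y. \<lambda>s\<in>S. x s \<oplus>\<^bsub>R\<^esub> y s), ract = (\<lambda>x a. \<lambda>s\<in>S. x s \<otimes>\<^bsub>R\<^esub> a)\<rparr>"

definition unit_vec :: "('a, 'b) ring_scheme \<Rightarrow> 's set \<Rightarrow> 's \<Rightarrow> 's \<Rightarrow> 'a" where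
  "unit_vec R S s = (\<lambda>t\<in>S. if t = s then \<one>\<^bsub>R\<^esub> else \<zero>\<^bsub>R\<^esub>)"

definition lin_comb ::
  "('a, 'b) ring_scheme \<Rightarrow> ('a, 'm) rmodule \<Rightarrow> 's set \<Rightarrow> ('s \<Rightarrow> 'm) \<Rightarrow> ('s \<Rightarrow> 'a) \<Rightarrow> 'm" where
  "lin_comb R M S m = (\<lambda>r\<in>S \<rightarrow>\<^sub>E carrier R. \<Oplus>\<^bsub>M\<^esub>s\<in>S. m s \<triangleleft>\<^bsub>M\<^esub> r s)"

lemma PiE_constD: "x \<in> S \<rightarrow>\<^sub>E A \<Longrightarrow> s \<in> S \<Longrightarrow> x s \<in> A"
  by auto

lemma right_module_free:
  assumes "ring R" shows "right_module R (free_rmodule R S)"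
proof -
  interpret ring R by fact
  have "abelian_group (free_rmodule R S)"
  proof (rule abelian_groupI)
    show "\<exists>y\<in>carrier (free_rmodule R S). y \<oplus>\<^bsub>free_rmodule R S\<^esub> x = \<zero>\<^bsub>free_rmodule R S\<^esub>"
      if "x \<in> carrier (free_rmodule R S)" for x
      using that
      by (intro bexI[of _ "\<lambda>s\<in>S. \<ominus>\<^bsub>R\<^esub> x s"])
        (auto simp: free_rmodule_def l_neg PiE_constD intro!: restrict_ext)
    show "\<zero>\<^bsub>free_rmodule R S\<^esub> \<oplus>\<^bsub>free_rmodule R S\<^esub> x = x"
      if "x \<in> carrier (free_rmodule R S)" for x
      using that by (intro extensionalityI[where A = S]) (auto simp: free_rmodule_def Pi_iff PiE_def)
  qed (auto simp: free_rmodule_def a_ac PiE_def Pi_iff intro!: restrict_ext)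
  then show ?thesis
    by (intro right_module.intro right_module_axioms.intro ring_axioms)
      (auto simp: free_rmodule_def l_distr r_distr m_assoc PiE_def Pi_iff
         intro!: restrict_ext intro: extensionalityI[where A = S])
qed

lemma unit_vec_closed: "ring R \<Longrightarrow> unit_vec R S s \<in> carrier (free_rmodule R S)"
proof -
  assume "ring R" then interpret ring R .
  show ?thesis by (auto simp: unit_vec_def free_rmodule_def)
qed

text \<open>The coordinates of \<open>x\<close> are switched on one at a time: by induction on
  \<open>T\<close>, the family that agrees with \<open>x\<close> on \<open>T\<close> and vanishes
  elsewhere lies in \<open>W\<close>. The case \<open>T = S\<close> is \<open>x\<close>
  itself.\<close>

lemma free_rmodule_generated:
  assumes "ring R" "finite S" "submodule_of R (free_rmodule R S) W" "unit_vec R S ` S \<subseteq> W"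
  shows "W = carrier (free_rmodule R S)"
proof (intro equalityI subsetI)
  interpret ring R by fact
  interpret F: right_module R "free_rmodule R S" by (rule right_module_free) fact
  note W = assms(3)[unfolded submodule_of_def]
  show "x \<in> carrier (free_rmodule R S)" if "x \<in> W" for x using that W by blast
  fix x assume x: "x \<in> carrier (free_rmodule R S)"
  have "(\<lambda>s\<in>S. if s \<in> T then x s else \<zero>\<^bsub>R\<^esub>) \<in> W" if "finite T" "T \<subseteq> S" for T
    using that
  proof (induction T)
    case empty
    have "(\<lambda>s\<in>S. \<zero>\<^bsub>R\<^esub>) = \<zero>\<^bsub>free_rmodule R S\<^esub>" by (simp add: free_rmodule_def)
    then show ?case using W by simp
  next
    case (insert t T)
    have xc: "\<And>s. s \<in> S \<Longrightarrow> x s \<in> carrier R" using x by (auto simp: free_rmodule_def)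
    have "unit_vec R S t \<triangleleft>\<^bsub>free_rmodule R S\<^esub> x t \<in> W"
      using W insert.prems assms(4) xc by auto
    then have "(\<lambda>s\<in>S. if s \<in> T then x s else \<zero>\<^bsub>R\<^esub>)
        \<oplus>\<^bsub>free_rmodule R S\<^esub> unit_vec R S t \<triangleleft>\<^bsub>free_rmodule R S\<^esub> x t \<in> W"
      using W insert.IH insert.prems by (simp del: restrict_apply)
    moreover have "(\<lambda>s\<in>S. if s \<in> T then x s else \<zero>\<^bsub>R\<^esub>)
        \<oplus>\<^bsub>free_rmodule R S\<^esub> unit_vec R S t \<triangleleft>\<^bsub>free_rmodule R S\<^esub> x t
        = (\<lambda>s\<in>S. if s \<in> insert t T then x s else \<zero>\<^bsub>R\<^esub>)"
      using insert xc by (auto simp: free_rmodule_def unit_vec_def)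
    ultimately show ?case by metis
  qed
  from this[of S] have "(\<lambda>s\<in>S. if s \<in> S then x s else \<zero>\<^bsub>R\<^esub>) \<in> W" using assms(2) by simp
  moreover have "(\<lambda>s\<in>S. if s \<in> S then x s else \<zero>\<^bsub>R\<^esub>) = x"
    using x by (intro extensionalityI[where A = S]) (auto simp: free_rmodule_def PiE_def)
  ultimately show "x \<in> W" by simp
qed

text \<open>This is the hom of the universal property of the free module: by
  \<open>lin_comb_unit_vec\<close> it sends the unit vectors to the prescribed values
  \<open>m\<close>.\<close>

lemma rhom_lin_comb:
  assumes "right_module R M" "finite S" "m \<in> S \<rightarrow> carrier M"
  shows "lin_comb R M S m \<in> rhom R (free_rmodule R S) M"
proof -
  interpret right_module R M by fact
  have cl: "(\<lambda>s. m s \<triangleleft>\<^bsub>M\<^esub> r s) \<in> S \<rightarrow> carrier M" if "r \<in> S \<rightarrow>\<^sub>E carrier R" for r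
    using that assms(3) by (auto intro!: ract_closed)
  have "(\<lambda>r\<in>carrier (free_rmodule R S). \<Oplus>\<^bsub>M\<^esub>s\<in>S. m s \<triangleleft>\<^bsub>M\<^esub> r s) \<in> rhom R (free_rmodule R S) M"
  proof (rule rhom_restrictI)
    show "right_module R (free_rmodule R S)" by (rule right_module_free) (rule R.ring_axioms)
    fix x assume x: "x \<in> carrier (free_rmodule R S)"
    then have x': "x \<in> S \<rightarrow>\<^sub>E carrier R" by (simp add: free_rmodule_def)
    show "(\<Oplus>\<^bsub>M\<^esub>s\<in>S. m s \<triangleleft>\<^bsub>M\<^esub> x s) \<in> carrier M" using cl[OF x'] by (rule M.finsum_closed)
    show "(\<Oplus>\<^bsub>M\<^esub>s\<in>S. m s \<triangleleft>\<^bsub>M\<^esub> (x \<triangleleft>\<^bsub>free_rmodule R S\<^esub> a) s) = (\<Oplus>\<^bsub>M\<^esub>s\<in>S. m s \<triangleleft>\<^bsub>M\<^esub> x s) \<triangleleft>\<^bsub>M\<^esub> a"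
      if "a \<in> carrier R" for a
      unfolding finsum_ract[OF assms(2) cl[OF x'] that]
      using that x' assms(3)
      by (intro M.finsum_cong') (auto simp: free_rmodule_def ract_assoc PiE_constD Pi_iff ract_closed)
    fix y assume y: "y \<in> carrier (free_rmodule R S)"
    then have y': "y \<in> S \<rightarrow>\<^sub>E carrier R" by (simp add: free_rmodule_def)
    show "(\<Oplus>\<^bsub>M\<^esub>s\<in>S. m s \<triangleleft>\<^bsub>M\<^esub> (x \<oplus>\<^bsub>free_rmodule R S\<^esub> y) s)
        = (\<Oplus>\<^bsub>M\<^esub>s\<in>S. m s \<triangleleft>\<^bsub>M\<^esub> x s) \<oplus>\<^bsub>M\<^esub> (\<Oplus>\<^bsub>M\<^esub>s\<in>S. m s \<triangleleft>\<^bsub>M\<^esub> y s)"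
      unfolding M.finsum_addf[OF cl[OF x'] cl[OF y'], symmetric]
      using x' y' assms(3)
      by (intro M.finsum_cong') (auto simp: free_rmodule_def ract_add_right PiE_constD Pi_iff ract_closed)
  qed
  then show ?thesis by (simp add: lin_comb_def free_rmodule_def)
qed

lemma lin_comb_unit_vec:
  assumes "right_module R M" "finite S" "m \<in> S \<rightarrow> carrier M" "s \<in> S"
  shows "lin_comb R M S m (unit_vec R S s) = m s"
proof -
  interpret right_module R M by fact
  have "unit_vec R S s \<in> S \<rightarrow>\<^sub>E carrier R"
    using unit_vec_closed[OF R.ring_axioms, of S s] by (simp add: free_rmodule_def)
  then have "lin_comb R M S m (unit_vec R S s) = (\<Oplus>\<^bsub>M\<^esub>t\<in>S. m t \<triangleleft>\<^bsub>M\<^esub> unit_vec R S s t)"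
    by (simp add: lin_comb_def)
  also have "\<dots> = (\<Oplus>\<^bsub>M\<^esub>t\<in>S. if s = t then m t else \<zero>\<^bsub>M\<^esub>)"
    using assms(3,4) by (intro M.finsum_cong') (auto simp: unit_vec_def Pi_iff ract_one)
  also have "\<dots> = m s" using assms by (intro M.finsum_singleton) auto
  finally show ?thesis .
qed

text \<open>The equalizer of \<open>f\<close> and \<open>g\<close> is a submodule containing the
  unit vectors.\<close>

lemma rhom_free_eqI:
  assumes "ring R" "finite S" "right_module R M"
    and "f \<in> rhom R (free_rmodule R S) M" "g \<in> rhom R (free_rmodule R S) M"
    and "\<And>s. s \<in> S \<Longrightarrow> f (unit_vec R S s) = g (unit_vec R S s)" "x \<in> carrier (free_rmodule R S)"
  shows "f x = g x"
proof -
  have "{x \<in> carrier (free_rmodule R S). f x = g x} = carrier (free_rmodule R S)"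
    using assms unit_vec_closed[OF assms(1)]
    by (intro free_rmodule_generated submodule_of_equalizer) (auto intro: right_module_free)
  then show ?thesis using assms(7) by blast
qed

lemma submodule_of_lin_comb:
  assumes "right_module R M" "finite S" "submodule_of R M W" "m \<in> S \<rightarrow> W" "r \<in> S \<rightarrow> carrier R"
  shows "(\<Oplus>\<^bsub>M\<^esub>s\<in>S. m s \<triangleleft>\<^bsub>M\<^esub> r s) \<in> W"
proof -
  interpret right_module R M by fact
  note W = assms(3)[unfolded submodule_of_def]
  show ?thesis using assms(2,4,5)
  proof (induction S)
    case (insert s S)
    have "(\<lambda>s. m s \<triangleleft>\<^bsub>M\<^esub> r s) \<in> S \<rightarrow> carrier M" "m s \<triangleleft>\<^bsub>M\<^esub> r s \<in> carrier M"
      using insert.prems W by (auto intro!: ract_closed)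
    then show ?case using insert W by (simp add: M.finsum_insert)
  qed (use W in simp)
qed

text \<open>Phrased through submodules instead of linear combinations, so that passing to quotients,
  to preimages or along ring maps involves no sums. The link to the given notion of finite
  generation is \<open>fg_right_module_iff\<close>.\<close>

definition generates :: "('a, 'b) ring_scheme \<Rightarrow> ('a, 'm) rmodule \<Rightarrow> 'm set \<Rightarrow> bool" where
  "generates R M S \<longleftrightarrow> S \<subseteq> carrier M \<and> (\<forall>W. submodule_of R M W \<and> S \<subseteq> W \<longrightarrow> W = carrier M)"

lemma lin_comb_surj:
  assumes "right_module R M" "finite S" "generates R M S"
  shows "lin_comb R M S (\<lambda>s. s) ` carrier (free_rmodule R S) = carrier M"
proof -
  interpret right_module R M by fact
  interpret F: right_module R "free_rmodule R S" by (rule right_module_free) (rule R.ring_axioms)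
  let ?p = "lin_comb R M S (\<lambda>s. s)"
  have p: "?p \<in> rhom R (free_rmodule R S) M"
    using assms by (intro rhom_lin_comb) (auto simp: generates_def)
  have "submodule_of R M (?p ` carrier (free_rmodule R S))"
    by (rule submodule_of_image[OF F.right_module_axioms assms(1) p])
  moreover have "s \<in> ?p ` carrier (free_rmodule R S)" if "s \<in> S" for s
    using that assms lin_comb_unit_vec[OF assms(1,2), of "\<lambda>s. s" s] unit_vec_closed[OF R.ring_axioms, of S s]
    by (intro image_eqI[where x = "unit_vec R S s"]) (auto simp: generates_def Pi_iff subset_iff)
  then have "S \<subseteq> ?p ` carrier (free_rmodule R S)" by blast
  ultimately show ?thesis using assms(3) by (simp add: generates_def)
qed

text \<open>A submodule containing \<open>S\<close> contains all linear combinations of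
  \<open>S\<close>; conversely these combinations are the image of a free module, hence a submodule
  containing \<open>S\<close>.\<close>

lemma fg_right_module_iff:
  "fg_right_module R M \<longleftrightarrow> right_module R M \<and> (\<exists>S. finite S \<and> generates R M S)"
proof (intro iffI conjI)
  assume fg: "fg_right_module R M"
  then show M: "right_module R M" by (simp add: fg_right_module_def)
  obtain S where S: "finite S" "S \<subseteq> carrier M"
    "\<And>m. m \<in> carrier M \<Longrightarrow> \<exists>r\<in>S \<rightarrow> carrier R. m = (\<Oplus>\<^bsub>M\<^esub>s\<in>S. s \<triangleleft>\<^bsub>M\<^esub> r s)"
    using fg unfolding fg_right_module_def by metis
  have "m \<in> W" if "submodule_of R M W" "S \<subseteq> W" "m \<in> carrier M" for W m
    using S(3)[OF that(3)] submodule_of_lin_comb[OF M S(1) that(1), of "\<lambda>s. s"] that(2) by auto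
  then have "generates R M S" using S(2) unfolding generates_def submodule_of_def by blast
  then show "\<exists>S. finite S \<and> generates R M S" using S(1) by blast
next
  assume "right_module R M \<and> (\<exists>S. finite S \<and> generates R M S)"
  then obtain S where S: "right_module R M" "finite S" "generates R M S" by blast
  have "\<exists>r\<in>S \<rightarrow> carrier R. m = (\<Oplus>\<^bsub>M\<^esub>s\<in>S. s \<triangleleft>\<^bsub>M\<^esub> r s)" if "m \<in> carrier M" for m
  proof -
    have "m \<in> lin_comb R M S (\<lambda>s. s) ` carrier (free_rmodule R S)" using lin_comb_surj[OF S] that by simp
    then obtain r where "r \<in> S \<rightarrow>\<^sub>E carrier R" "m = lin_comb R M S (\<lambda>s. s) r"
      by (auto simp: free_rmodule_def)
    then show ?thesis by (intro bexI[of _ r]) (auto simp: lin_comb_def)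
  qed
  then show "fg_right_module R M" using S unfolding fg_right_module_def generates_def by blast
qed

lemma fg_right_moduleD: "fg_right_module R M \<Longrightarrow> right_module R M"
  by (simp add: fg_right_module_def)

lemma generates_free_rmodule:
  "ring R \<Longrightarrow> finite S \<Longrightarrow> generates R (free_rmodule R S) (unit_vec R S ` S)"
  using free_rmodule_generated[of R S] unit_vec_closed[of R S]
  by (simp add: generates_def image_subset_iff)

lemma fg_free_rmodule:
  assumes "ring R" "finite S"
  shows "fg_right_module R (free_rmodule R S)"
  unfolding fg_right_module_iff
  by (intro conjI exI[of _ "unit_vec R S ` S"] right_module_free generates_free_rmodule finite_imageI assms)

lemma generates_image:
  assumes "right_module R M" "right_module R N" "f \<in> rhom R M N" "f ` carrier M = carrier N"
    and "generates R M S"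
  shows "generates R N (f ` S)"
  unfolding generates_def
proof (intro conjI allI impI)
  show "f ` S \<subseteq> carrier N" using assms(4,5) by (auto simp: generates_def)
  fix W assume W: "submodule_of R N W \<and> f ` S \<subseteq> W"
  have "S \<subseteq> {x \<in> carrier M. f x \<in> W}" using W assms(5) by (auto simp: generates_def)
  then have "{x \<in> carrier M. f x \<in> W} = carrier M"
    using W assms(5) submodule_of_preimage[OF assms(1-3)] unfolding generates_def by blast
  then have "f ` carrier M \<subseteq> W" by blast
  then show "W = carrier N" using W assms(4) by (auto simp: submodule_of_def)
qed

lemma fg_image:
  assumes "fg_right_module R M" "right_module R N" "f \<in> rhom R M N" "f ` carrier M = carrier N"
  shows "fg_right_module R N"
proof -
  obtain S where S: "right_module R M" "finite S" "generates R M S"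
    using fg_right_module_iff[THEN iffD1, OF assms(1)] by blast
  have "generates R N (f ` S)" by (rule generates_image[OF S(1) assms(2-4) S(3)])
  then show ?thesis using S(2) assms(2) fg_right_module_iff finite_imageI by blast
qed

text \<open>The generators are numbered, so that the free module has elements in
  \<open>nat \<Rightarrow> 'a\<close>, the type prescribed by
  \<open>proj_resolution\<close>.\<close>

lemma fg_cover:
  assumes "fg_right_module R (M :: ('a, 'm) rmodule)"
  obtains n :: nat and f where "f \<in> rhom R (free_rmodule R {..<n}) M"
    "f ` carrier (free_rmodule R {..<n}) = carrier M"
proof -
  have M: "right_module R M" using assms by (rule fg_right_moduleD)
  then interpret right_module R M .
  obtain S where S: "finite S" "generates R M S" using assms unfolding fg_right_module_iff by blast
  obtain e where e: "bij_betw e {..<card S} S"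
    using ex_bij_betw_nat_finite[OF S(1)] by (auto simp: atLeast0LessThan)
  let ?n = "card S" and ?f = "lin_comb R M {..<card S} e"
  interpret F: right_module R "free_rmodule R {..<?n}" by (rule right_module_free) (rule R.ring_axioms)
  have eS: "e ` {..<?n} = S" using e by (simp add: bij_betw_def)
  then have ec: "e \<in> {..<?n} \<rightarrow> carrier M" using S(2) by (auto simp: generates_def)
  have f: "?f \<in> rhom R (free_rmodule R {..<?n}) M" using ec M by (intro rhom_lin_comb) auto
  have "submodule_of R M (?f ` carrier (free_rmodule R {..<?n}))"
    by (rule submodule_of_image[OF F.right_module_axioms M f])
  moreover have "e s \<in> ?f ` carrier (free_rmodule R {..<?n})" if "s < ?n" for s
    using that ec lin_comb_unit_vec[OF M, of "{..<?n}" e s] unit_vec_closed[OF R.ring_axioms, of "{..<?n}" s]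
    by (intro image_eqI[where x = "unit_vec R {..<?n} s"]) auto
  then have "S \<subseteq> ?f ` carrier (free_rmodule R {..<?n})" by (subst eS[symmetric]) auto
  ultimately have "?f ` carrier (free_rmodule R {..<?n}) = carrier M" using S(2) by (simp add: generates_def)
  then show ?thesis using f that by blast
qed

section \<open>Projective modules\<close>

lemma projective_rmoduleD: "projective_rmodule R P \<Longrightarrow> right_module R P"
  by (simp add: projective_rmodule_def)

text \<open>Lifting for modules \<open>M\<close> and \<open>N\<close> in arbitrary types. The
  restricted property in \<open>projective_rmodule\<close> is applied only once, to the free cover
  of \<open>P\<close> on its own generators. This splits \<open>P\<close> off a free module, and
  homs out of a free module can be lifted against any surjection by lifting the values at unit
  vectors.\<close>

lemma projective_lift:
  fixes P :: "('a, 'm) rmodule"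
  assumes P: "projective_rmodule R P" "fg_right_module R P"
    and M: "right_module R M" and N: "right_module R N"
    and g: "g \<in> rhom R M N" "g ` carrier M = carrier N" and f: "f \<in> rhom R P N"
  obtains h where "h \<in> rhom R P M" "\<And>x. x \<in> carrier P \<Longrightarrow> g (h x) = f x"
proof -
  have rP: "right_module R P" using P(1) by (rule projective_rmoduleD)
  then interpret right_module R P .
  obtain S where S: "finite S" "generates R P S" using P(2) unfolding fg_right_module_iff by blast
  let ?F = "free_rmodule R S" and ?p = "lin_comb R P S (\<lambda>s. s)"
  have F: "right_module R ?F" by (rule right_module_free) (rule R.ring_axioms)
  have SP: "S \<subseteq> carrier P" using S(2) by (simp add: generates_def)
  have p: "?p \<in> rhom R ?F P" using SP by (intro rhom_lin_comb rP S(1)) auto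
  have "\<exists>h\<in>rhom R P ?F. compose (carrier P) ?p h = (\<lambda>x\<in>carrier P. x)"
    using P(1)[unfolded projective_rmodule_def] p rhom_id[OF rP] F rP lin_comb_surj[OF rP S] by blast
  then obtain i where i: "i \<in> rhom R P ?F" "compose (carrier P) ?p i = (\<lambda>x\<in>carrier P. x)" by blast
  have pi: "?p (i x) = x" if "x \<in> carrier P" for x
    using fun_cong[OF i(2), of x] that by (simp add: compose_def)
  have "\<exists>m. m \<in> carrier M \<and> g m = f s" if "s \<in> S" for s
  proof -
    have "f s \<in> g ` carrier M" using g(2) rhomD(1)[OF f] SP that by auto
    then show ?thesis by auto
  qed
  then obtain m where m: "\<And>s. s \<in> S \<Longrightarrow> m s \<in> carrier M" "\<And>s. s \<in> S \<Longrightarrow> g (m s) = f s" by metis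
  let ?q = "lin_comb R M S m"
  have q: "?q \<in> rhom R ?F M" using m(1) by (intro rhom_lin_comb M S(1)) auto
  have gq: "g (?q y) = f (?p y)" if y: "y \<in> carrier ?F" for y
  proof -
    have "compose (carrier ?F) g ?q y = compose (carrier ?F) f ?p y"
    proof (rule rhom_free_eqI[OF R.ring_axioms S(1) N _ _ _ y])
      show "compose (carrier ?F) g ?q \<in> rhom R ?F N" by (rule rhom_compose[OF F q g(1)])
      show "compose (carrier ?F) f ?p \<in> rhom R ?F N" by (rule rhom_compose[OF F p f])
      fix s assume s: "s \<in> S"
      have "?q (unit_vec R S s) = m s" using m(1) s by (intro lin_comb_unit_vec M S(1)) auto
      moreover have "?p (unit_vec R S s) = s" using SP s by (intro lin_comb_unit_vec rP S(1)) auto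
      ultimately show "compose (carrier ?F) g ?q (unit_vec R S s) = compose (carrier ?F) f ?p (unit_vec R S s)"
        using unit_vec_closed[OF R.ring_axioms, of S s] m(2)[OF s] by (simp add: compose_def)
    qed
    then show ?thesis using y by (simp add: compose_def)
  qed
  show ?thesis
  proof (rule that)
    show "compose (carrier P) ?q i \<in> rhom R P M" by (rule rhom_compose[OF rP i(1) q])
    show "g (compose (carrier P) ?q i x) = f x" if "x \<in> carrier P" for x
      using that gq[OF rhomD(1)[OF i(1) that]] pi[OF that] by (simp add: compose_def)
  qed
qed

text \<open>A lifting problem for \<open>K\<close> is pulled back along \<open>s\<close> to
  \<open>Q\<close>, solved there, and its solution restricted along \<open>t\<close>. As
  \<open>projective_lift\<close> is free in its types, \<open>K\<close> and \<open>Q\<close> may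
  live in different ones; this makes the lemma the vehicle for moving projectivity between types and
  along isomorphisms.\<close>

lemma projective_retract:
  assumes K: "right_module R K"
    and Q: "projective_rmodule R Q" "fg_right_module R Q"
    and t: "t \<in> rhom R K Q" and s: "s \<in> rhom R Q K" and st: "\<And>x. x \<in> carrier K \<Longrightarrow> s (t x) = x"
  shows "projective_rmodule R K"
  unfolding projective_rmodule_def
proof (intro conjI allI ballI impI K, elim conjE)
  fix M :: "('a, 'c \<Rightarrow> 'a) rmodule" and N :: "('a, 'c) rmodule" and g f
  assume M: "right_module R M" and N: "right_module R N"
    and g: "g \<in> rhom R M N" "g ` carrier M = carrier N" and f: "f \<in> rhom R K N"
  have rQ: "right_module R Q" using Q(2) by (rule fg_right_moduleD)
  obtain h where h: "h \<in> rhom R Q M" "\<And>x. x \<in> carrier Q \<Longrightarrow> g (h x) = compose (carrier Q) f s x"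
    using projective_lift[OF Q M N g rhom_compose[OF rQ s f]] by metis
  have "compose (carrier K) g (compose (carrier K) h t) = f"
  proof (rule extensionalityI)
    show "f \<in> extensional (carrier K)" using f by (rule rhomD)
    show "compose (carrier K) g (compose (carrier K) h t) x = f x" if "x \<in> carrier K" for x
      using that h(2)[of "t x"] rhomD(1)[OF t that] st[OF that] by (simp add: compose_def)
  qed (simp add: compose_def)
  then show "\<exists>h\<in>rhom R K M. compose (carrier K) g h = f" using rhom_compose[OF K t h(1)] by blast
qed

lemma projective_free_rmodule:
  assumes "ring R" "finite S"
  shows "projective_rmodule R (free_rmodule R (S :: 's set))"
  unfolding projective_rmodule_def
proof (intro conjI allI ballI impI, goal_cases)
  case 1 show ?case by (rule right_module_free[OF assms(1)])
next
  case (2 M N g f)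
  let ?F = "free_rmodule R S"
  have F: "right_module R ?F" by (rule right_module_free[OF assms(1)])
  have M: "right_module R M" and N: "right_module R N" and g: "g \<in> rhom R M N" "g ` carrier M = carrier N"
    and f: "f \<in> rhom R ?F N" using 2 by auto
  have uv: "unit_vec R S s \<in> carrier ?F" for s by (rule unit_vec_closed[OF assms(1)])
  have "\<exists>m. m \<in> carrier M \<and> g m = f (unit_vec R S s)" for s
  proof -
    have "f (unit_vec R S s) \<in> g ` carrier M" using g(2) rhomD(1)[OF f uv] by simp
    then show ?thesis by auto
  qed
  then obtain m where m: "\<And>s. m s \<in> carrier M" "\<And>s. g (m s) = f (unit_vec R S s)" by metis
  have q: "lin_comb R M S m \<in> rhom R ?F M" using m(1) by (intro rhom_lin_comb M assms(2)) auto
  have "compose (carrier ?F) g (lin_comb R M S m) = f"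
  proof (rule rhom_eqI[OF _ f])
    show gq: "compose (carrier ?F) g (lin_comb R M S m) \<in> rhom R ?F N" by (rule rhom_compose[OF F q g(1)])
    show "compose (carrier ?F) g (lin_comb R M S m) y = f y" if y: "y \<in> carrier ?F" for y
    proof (rule rhom_free_eqI[OF assms N gq f _ y])
      fix s assume "s \<in> S"
      then have "lin_comb R M S m (unit_vec R S s) = m s" using m(1) by (intro lin_comb_unit_vec M assms(2)) auto
      then show "compose (carrier ?F) g (lin_comb R M S m) (unit_vec R S s) = f (unit_vec R S s)"
        using uv m(2) by (simp add: compose_def)
    qed
  qed
  then show ?case using q by blast
qed


section \<open>Splitting and syzygies\<close>

lemma rhom_inclusion:
  assumes "right_module R P" "submodule_of R P L"
  shows "(\<lambda>x\<in>L. x) \<in> rhom R (P\<lparr>carrier := L\<rparr>) P"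
proof -
  have "restrict (\<lambda>x\<in>carrier P. x) L \<in> rhom R (P\<lparr>carrier := L\<rparr>) P"
    by (intro rhom_restrict_submodule assms rhom_id)
  moreover have "restrict (\<lambda>x\<in>carrier P. x) L = (\<lambda>x\<in>L. x)"
    using assms(2) by (auto simp: submodule_of_def fun_eq_iff restrict_def)
  ultimately show ?thesis by simp
qed

text \<open>If \<open>s\<close> is a section of \<open>p\<close>, then
  \<open>x \<mapsto> x - s (p x)\<close> is the projection of \<open>P\<close> onto the kernel along
  the image of \<open>s\<close>.\<close>

lemma kernel_retraction_of_projective:
  assumes P: "right_module R P" and K: "projective_rmodule R K" "fg_right_module R K"
    and p: "p \<in> rhom R P K" "p ` carrier P = carrier K"
  obtains r where "r \<in> rhom R P (P\<lparr>carrier := rkernel P K p\<rparr>)" "\<And>x. x \<in> rkernel P K p \<Longrightarrow> r x = x"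
proof -
  have rK: "right_module R K" using K(1) by (rule projective_rmoduleD)
  interpret P: right_module R P by fact
  interpret K: right_module R K by fact
  obtain s where s: "s \<in> rhom R K P" "\<And>y. y \<in> carrier K \<Longrightarrow> p (s y) = y"
    using projective_lift[OF K P rK p rhom_id[OF rK]] by (metis restrict_apply)
  define r where "r = (\<lambda>x\<in>carrier P. (\<lambda>x\<in>carrier P. x) x \<ominus>\<^bsub>P\<^esub> compose (carrier P) s p x)"
  have r: "r \<in> rhom R P P" unfolding r_def by (rule rhom_diff[OF P P rhom_id[OF P] rhom_compose[OF P p(1) s(1)]])
  have rx: "r x = x \<ominus>\<^bsub>P\<^esub> s (p x)" if "x \<in> carrier P" for x using that by (simp add: r_def compose_def)
  have spx: "s (p x) \<in> carrier P" if "x \<in> carrier P" for x using that rhomD(1)[OF p(1)] rhomD(1)[OF s(1)] by simp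
  have "p (r x) = \<zero>\<^bsub>K\<^esub>" if "x \<in> carrier P" for x
    using that spx[OF that] rhomD(1)[OF p(1) that] s(2)
    by (simp add: rx a_minus_def rhomD(2)[OF p(1)] rhom_minus[OF P rK p(1)] K.M.r_neg)
  then have "r \<in> rhom R P (P\<lparr>carrier := rkernel P K p\<rparr>)"
    using rhomD(1)[OF r] by (intro rhom_into_submodule[OF r]) (auto simp: rkernel_def)
  moreover have "r x = x" if "x \<in> rkernel P K p" for x
    using that rhom_zero[OF rK P s(1)] by (simp add: rx rkernel_def a_minus_def)
  ultimately show ?thesis using that by blast
qed

text \<open>The map \<open>x \<mapsto> x - r x\<close> vanishes on the kernel of \<open>p\<close>,
  so it factors as \<open>s\<close> after \<open>p\<close>. Since \<open>r\<close> takes values in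
  the kernel, \<open>s\<close> is a section of \<open>p\<close>, and \<open>K\<close> is a retract
  of \<open>P\<close>.\<close>

lemma projective_of_kernel_retraction:
  assumes P: "projective_rmodule R P" "fg_right_module R P" and K: "right_module R K"
    and p: "p \<in> rhom R P K" "p ` carrier P = carrier K"
    and r: "r \<in> rhom R P P" "r ` carrier P \<subseteq> rkernel P K p" "\<And>x. x \<in> rkernel P K p \<Longrightarrow> r x = x"
  shows "projective_rmodule R K"
proof -
  have rP: "right_module R P" using P(1) by (rule projective_rmoduleD)
  interpret P: right_module R P by fact
  interpret K: right_module R K by fact
  let ?q = "\<lambda>x\<in>carrier P. (\<lambda>x\<in>carrier P. x) x \<ominus>\<^bsub>P\<^esub> r x"
  have q: "?q \<in> rhom R P P" by (rule rhom_diff[OF rP rP rhom_id[OF rP] r(1)])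
  have q0: "?q x = \<zero>\<^bsub>P\<^esub>" if "x \<in> carrier P" "p x = \<zero>\<^bsub>K\<^esub>" for x
    using that r(3)[of x] by (simp add: rkernel_def a_minus_def P.M.r_neg)
  obtain s where s: "s \<in> rhom R K P" "\<And>x. x \<in> carrier P \<Longrightarrow> s (p x) = ?q x"
    using rhom_factor[OF rP K rP p q q0] by blast
  show ?thesis
  proof (rule projective_retract[OF K P s(1) p(1)])
    fix y assume "y \<in> carrier K"
    then obtain x where x: "x \<in> carrier P" "y = p x" using p(2) by blast
    have "p (r x) = \<zero>\<^bsub>K\<^esub>" using r(2) x(1) by (auto simp: rkernel_def)
    then show "p (s y) = y"
      using x s(2) rhomD(1)[OF r(1)] rhomD(1)[OF p(1)]
      by (simp add: a_minus_def rhomD(2)[OF p(1)] rhom_minus[OF rP K p(1)])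
  qed
qed

text \<open>
  A finitely generated projective \<open>L\<close> has a finite dual basis of homs \<open>L \<rightarrow> R\<close>; extending these to
  \<open>P\<close> yields a retraction \<open>P \<rightarrow> L\<close>.
\<close>

lemma projective_of_extension:
  fixes P :: "('a, 'p) rmodule"
  assumes P: "projective_rmodule R P" "fg_right_module R P" and K: "right_module R K"
    and p: "p \<in> rhom R P K" "p ` carrier P = carrier K"
    and L: "projective_rmodule R (P\<lparr>carrier := rkernel P K p\<rparr>)" "fg_right_module R (P\<lparr>carrier := rkernel P K p\<rparr>)"
    and ext: "\<And>u. u \<in> rhom R (P\<lparr>carrier := rkernel P K p\<rparr>) (regular_rmodule R)
      \<Longrightarrow> \<exists>v\<in>rhom R P (regular_rmodule R). \<forall>x\<in>rkernel P K p. v x = u x"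
  shows "projective_rmodule R K"
proof -
  let ?L = "P\<lparr>carrier := rkernel P K p\<rparr>"
  have rP: "right_module R P" using P(1) by (rule projective_rmoduleD)
  have rL: "right_module R ?L" using L(1) by (rule projective_rmoduleD)
  interpret P: right_module R P by fact
  obtain S where S: "finite S" "generates R ?L S" using L(2) unfolding fg_right_module_iff by blast
  let ?F = "free_rmodule R S" and ?c = "lin_comb R ?L S (\<lambda>s. s)"
  have F: "right_module R ?F" by (rule right_module_free) (rule P.R.ring_axioms)
  have SL: "S \<subseteq> rkernel P K p" using S(2) by (simp add: generates_def)
  have c: "?c \<in> rhom R ?F ?L" using SL by (intro rhom_lin_comb rL S(1)) auto
  obtain j where j: "j \<in> rhom R ?L ?F" "\<And>x. x \<in> rkernel P K p \<Longrightarrow> ?c (j x) = x"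
    using projective_lift[OF L F rL c lin_comb_surj[OF rL S] rhom_id[OF rL]] by (auto simp: restrict_def)
  \<comment> \<open>The coordinate functions of \<open>j\<close> form the functional half of the
    dual basis; each one is extended separately.\<close>
  have "\<exists>v\<in>rhom R P (regular_rmodule R). \<forall>x\<in>rkernel P K p. v x = j x s" if s: "s \<in> S" for s
  proof -
    have "(\<lambda>x\<in>carrier ?L. j x s) \<in> rhom R ?L (regular_rmodule R)"
      using s rhomD(1-3)[OF j(1)]
      by (intro rhom_restrictI rL) (auto simp: free_rmodule_def regular_rmodule_def)
    from ext[OF this] show ?thesis by auto
  qed
  then obtain v where v: "\<And>s. s \<in> S \<Longrightarrow> v s \<in> rhom R P (regular_rmodule R)"
    "\<And>s x. s \<in> S \<Longrightarrow> x \<in> rkernel P K p \<Longrightarrow> v s x = j x s" by metis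
  have vF: "(\<lambda>x\<in>carrier P. \<lambda>s\<in>S. v s x) \<in> rhom R P ?F"
    using v(1)[THEN rhomD(1)] v(1)[THEN rhomD(2)] v(1)[THEN rhomD(3)]
    by (intro rhom_restrictI rP) (auto simp: free_rmodule_def regular_rmodule_def intro!: restrict_ext)
  let ?r = "compose (carrier P) ?c (\<lambda>x\<in>carrier P. \<lambda>s\<in>S. v s x)"
  have r: "?r \<in> rhom R P ?L" by (rule rhom_compose[OF rP vF c])
  show ?thesis
  proof (rule projective_of_kernel_retraction[OF P K p])
    show "?r \<in> rhom R P P" using r by (rule rhom_from_submodule_into) (auto simp: rkernel_def)
    show "?r ` carrier P \<subseteq> rkernel P K p" using rhomD(1)[OF r] by auto
    fix x assume x: "x \<in> rkernel P K p"
    then have xP: "x \<in> carrier P" by (simp add: rkernel_def)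
    have "j x \<in> S \<rightarrow>\<^sub>E carrier R" using rhomD(1)[OF j(1), of x] x by (simp add: free_rmodule_def)
    then have "(\<lambda>s\<in>S. v s x) = j x"
      using v(2) x by (intro extensionalityI[where A = S]) (auto simp: PiE_def)
    then show "?r x = x" using xP j(2)[OF x] by (simp add: compose_def)
  qed
qed

text \<open>
  \<open>K\<close> is a retract of \<open>K'\<close> up to homs factoring through \<open>Q\<close>. For projective \<open>Q\<close> this passes to kernels of
  projective covers, which compares the syzygies of two resolutions without chain homotopies.
\<close>

definition stably_retracts ::
  "('a, 'b) ring_scheme \<Rightarrow> ('a, 'x) rmodule \<Rightarrow> ('a, 'y) rmodule \<Rightarrow> ('a, 'q) rmodule \<Rightarrow> bool" where
  "stably_retracts R K K' Q \<longleftrightarrow> (\<exists>\<alpha>\<in>rhom R K K'. \<exists>\<beta>\<in>rhom R K' K. \<exists>t\<in>rhom R K Q. \<exists>s\<in>rhom R Q K.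
     \<forall>x\<in>carrier K. x = \<beta> (\<alpha> x) \<oplus>\<^bsub>K\<^esub> s (t x))"

text \<open>Let \<open>a\<close>, \<open>b\<close>, \<open>s'\<close> lift \<alpha>, \<beta>,
  \<open>s\<close> to the covers. By the relation on \<open>K\<close>, the map
  \<open>c = id - b a - s' t p\<close> is killed by \<open>p\<close>, so it maps \<open>P\<close> to
  the kernel. On the kernel the last term vanishes and the identity becomes \<open>b a\<close> plus
  the restriction of \<open>c\<close>. This correction factors through \<open>P\<close>, which
  therefore takes the place of \<open>Q\<close>.\<close>

lemma stably_retracts_kernel:
  assumes st: "stably_retracts R K K' Q"
    and P: "projective_rmodule R P" "fg_right_module R P" and P': "projective_rmodule R P'" "fg_right_module R P'"
    and Q: "projective_rmodule R Q" "fg_right_module R Q"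
    and K: "right_module R K" and K': "right_module R K'"
    and p: "p \<in> rhom R P K" "p ` carrier P = carrier K"
    and p': "p' \<in> rhom R P' K'" "p' ` carrier P' = carrier K'"
  shows "stably_retracts R (P\<lparr>carrier := rkernel P K p\<rparr>) (P'\<lparr>carrier := rkernel P' K' p'\<rparr>) P"
proof -
  have rP: "right_module R P" and rP': "right_module R P'" and rQ: "right_module R Q"
    using P(1) P'(1) Q(1) by (auto intro: projective_rmoduleD)
  interpret P: right_module R P by fact
  interpret K: right_module R K by fact
  obtain \<alpha> \<beta> t s where h: "\<alpha> \<in> rhom R K K'" "\<beta> \<in> rhom R K' K" "t \<in> rhom R K Q" "s \<in> rhom R Q K"
    and eq: "\<And>x. x \<in> carrier K \<Longrightarrow> x = \<beta> (\<alpha> x) \<oplus>\<^bsub>K\<^esub> s (t x)"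
    using st unfolding stably_retracts_def by blast
  obtain a where a: "a \<in> rhom R P P'" "\<And>x. x \<in> carrier P \<Longrightarrow> p' (a x) = \<alpha> (p x)"
    using projective_lift[OF P rP' K' p' rhom_compose[OF rP p(1) h(1)]] by (auto simp: compose_def)
  obtain b where b: "b \<in> rhom R P' P" "\<And>x. x \<in> carrier P' \<Longrightarrow> p (b x) = \<beta> (p' x)"
    using projective_lift[OF P' rP K p rhom_compose[OF rP' p'(1) h(2)]] by (auto simp: compose_def)
  obtain s' where s': "s' \<in> rhom R Q P" "\<And>x. x \<in> carrier Q \<Longrightarrow> p (s' x) = s x"
    using projective_lift[OF Q rP K p h(4)] by auto
  let ?L = "rkernel P K p" and ?L' = "rkernel P' K' p'"
  have sL: "submodule_of R P ?L" by (rule submodule_of_rkernel[OF rP K p(1)])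
  have sL': "submodule_of R P' ?L'" by (rule submodule_of_rkernel[OF rP' K' p'(1)])
  have a': "restrict a ?L \<in> rhom R (P\<lparr>carrier := ?L\<rparr>) (P'\<lparr>carrier := ?L'\<rparr>)"
    using rhom_zero[OF K K' h(1)] rhomD(1)[OF a(1)] a(2)
    by (intro rhom_into_submodule rhom_restrict_submodule[OF sL a(1)]) (auto simp: rkernel_def)
  have b': "restrict b ?L' \<in> rhom R (P'\<lparr>carrier := ?L'\<rparr>) (P\<lparr>carrier := ?L\<rparr>)"
    using rhom_zero[OF K' K h(2)] rhomD(1)[OF b(1)] b(2)
    by (intro rhom_into_submodule rhom_restrict_submodule[OF sL' b(1)]) (auto simp: rkernel_def)
  define ba where "ba = compose (carrier P) b a"
  define stp where "stp = compose (carrier P) s' (compose (carrier P) t p)"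
  have ba: "ba \<in> rhom R P P" unfolding ba_def by (rule rhom_compose[OF rP a(1) b(1)])
  have stp: "stp \<in> rhom R P P" unfolding stp_def by (intro rhom_compose[OF rP _ s'(1)] rhom_compose[OF rP p(1) h(3)])
  have q0: "(\<lambda>x\<in>carrier P. ba x \<oplus>\<^bsub>P\<^esub> stp x) \<in> rhom R P P" by (rule rhom_add[OF rP rP ba stp])
  define c where "c = (\<lambda>x\<in>carrier P. (\<lambda>x\<in>carrier P. x) x \<ominus>\<^bsub>P\<^esub> (\<lambda>x\<in>carrier P. ba x \<oplus>\<^bsub>P\<^esub> stp x) x)"
  have c: "c \<in> rhom R P P" unfolding c_def by (rule rhom_diff[OF rP rP rhom_id[OF rP] q0])
  have cx: "c x = x \<ominus>\<^bsub>P\<^esub> (ba x \<oplus>\<^bsub>P\<^esub> stp x)" if "x \<in> carrier P" for x using that by (simp add: c_def)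
  have pc: "p (c x) = \<zero>\<^bsub>K\<^esub>" if x: "x \<in> carrier P" for x
  proof -
    note cl = rhomD(1)[OF p(1)] rhomD(1)[OF h(1)] rhomD(1)[OF h(2)] rhomD(1)[OF h(3)] rhomD(1)[OF h(4)]
      rhomD(1)[OF a(1)] rhomD(1)[OF b(1)] rhomD(1)[OF s'(1)]
    have "p (ba x) = \<beta> (\<alpha> (p x))" using x a(2)[OF x] b(2)[OF cl(6)[OF x]] by (simp add: ba_def compose_def)
    moreover have "p (stp x) = s (t (p x))" using x s'(2)[OF cl(4)[OF cl(1)[OF x]]] by (simp add: stp_def compose_def)
    ultimately have "p (ba x \<oplus>\<^bsub>P\<^esub> stp x) = p x"
      using eq[OF cl(1)[OF x]] x by (simp add: rhomD(2)[OF p(1)] rhomD(1)[OF ba] rhomD(1)[OF stp])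
    then show ?thesis
      using x cl(1) rhomD(1)[OF ba x] rhomD(1)[OF stp x]
      by (simp add: cx a_minus_def rhomD(2)[OF p(1)] rhom_minus[OF rP K p(1)] K.M.r_neg)
  qed
  have c': "c \<in> rhom R P (P\<lparr>carrier := ?L\<rparr>)"
    using pc rhomD(1)[OF c] by (intro rhom_into_submodule[OF c]) (auto simp: rkernel_def)
  have "x = restrict b ?L' (restrict a ?L x) \<oplus>\<^bsub>P\<lparr>carrier := ?L\<rparr>\<^esub> c ((\<lambda>x\<in>?L. x) x)" if xL: "x \<in> ?L" for x
  proof -
    have x: "x \<in> carrier P" "p x = \<zero>\<^bsub>K\<^esub>" using xL by (auto simp: rkernel_def)
    \<comment> \<open>On the kernel \<open>p x = 0\<close>, so the correction inherited from the
      previous stage disappears.\<close>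
    have "stp x = \<zero>\<^bsub>P\<^esub>" using x rhom_zero[OF K rQ h(3)] rhom_zero[OF rQ rP s'(1)] by (simp add: stp_def compose_def)
    moreover have "ba x = b (a x)" "b (a x) \<in> carrier P" using x rhomD(1)[OF ba x(1)] by (simp_all add: ba_def compose_def)
    moreover have "restrict b ?L' (restrict a ?L x) = b (a x)"
      using rhomD(1)[OF a', of x] xL by simp
    ultimately show ?thesis using x xL
      by (simp add: cx a_minus_def P.M.a_lcomm P.M.r_neg)
  qed
  then show ?thesis
    unfolding stably_retracts_def using a' b' c' rhom_inclusion[OF rP sL]
    by (intro bexI[of _ "restrict a ?L"] bexI[of _ "restrict b ?L'"] bexI[of _ "\<lambda>x\<in>?L. x"] bexI[of _ c]) auto
qed

text \<open>With \<beta> \<alpha> equal to zero, the relation says that \<open>s t\<close> is the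
  identity, so \<open>K\<close> is a retract of \<open>Q\<close>.\<close>

lemma stably_retracts_trivial:
  assumes st: "stably_retracts R K K' Q" and K: "right_module R K" and K': "right_module R K'"
    and triv: "carrier K' = {\<zero>\<^bsub>K'\<^esub>}"
    and Q: "projective_rmodule R Q" "fg_right_module R Q"
  shows "projective_rmodule R K"
proof -
  interpret K: right_module R K by fact
  obtain \<alpha> \<beta> t s where h: "\<alpha> \<in> rhom R K K'" "\<beta> \<in> rhom R K' K" "t \<in> rhom R K Q" "s \<in> rhom R Q K"
    and eq: "\<And>x. x \<in> carrier K \<Longrightarrow> x = \<beta> (\<alpha> x) \<oplus>\<^bsub>K\<^esub> s (t x)"
    using st unfolding stably_retracts_def by blast
  show ?thesis
  proof (rule projective_retract[OF K Q h(3,4)])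
    fix x assume x: "x \<in> carrier K"
    have "\<alpha> x = \<zero>\<^bsub>K'\<^esub>" using rhomD(1)[OF h(1) x] triv by simp
    then have "\<beta> (\<alpha> x) = \<zero>\<^bsub>K\<^esub>" using rhom_zero[OF K' K h(2)] by simp
    then show "s (t x) = x" using eq[OF x] rhomD(1)[OF h(4) rhomD(1)[OF h(3) x]] by simp
  qed
qed

section \<open>Syzygies of a resolution by finitely generated projectives\<close>

text \<open>Index \<open>i\<close> refers to the ambient module \<open>P i\<close>: index 0 is the
  kernel of the augmentation, which is usually called the first syzygy of \<open>M\<close>.\<close>

definition syzygy :: "(nat \<Rightarrow> ('a, 'p) rmodule) \<Rightarrow> (nat \<Rightarrow> 'p \<Rightarrow> 'p) \<Rightarrow> ('a, 'm) rmodule \<Rightarrow> ('p \<Rightarrow> 'm)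
    \<Rightarrow> nat \<Rightarrow> ('a, 'p) rmodule" where
  "syzygy P d M e i = P i\<lparr>carrier := (case i of 0 \<Rightarrow> rkernel (P 0) M e | Suc j \<Rightarrow> rkernel (P i) (P j) (d j))\<rparr>"

text \<open>The conditions are those of \<open>proj_resolution\<close>, but the type
  \<open>'p\<close> of the elements of the \<open>P i\<close> is free. This admits resolutions
  restricted from a larger ring, whose elements are families over that ring.\<close>

locale resolution =
  fixes R :: "('a, 'b) ring_scheme" and M :: "('a, 'm) rmodule"
    and P :: "nat \<Rightarrow> ('a, 'p) rmodule" and d :: "nat \<Rightarrow> 'p \<Rightarrow> 'p" and e :: "'p \<Rightarrow> 'm"
  assumes M: "right_module R M"
    and fg: "fg_right_module R (P i)"
    and proj: "projective_rmodule R (P i)"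
    and d: "d i \<in> rhom R (P (Suc i)) (P i)"
    and e: "e \<in> rhom R (P 0) M"
    and e_surj: "e ` carrier (P 0) = carrier M"
    and exact_0: "d 0 ` carrier (P (Suc 0)) = rkernel (P 0) M e"
    and exact_Suc: "d (Suc i) ` carrier (P (Suc (Suc i))) = rkernel (P (Suc i)) (P i) (d i)"
begin

abbreviation Z where "Z \<equiv> syzygy P d M e"

lemma P_module: "right_module R (P i)"
  using fg by (rule fg_right_moduleD)

lemma syzygy_submodule: "submodule_of R (P i) (carrier (Z i))"
  by (cases i) (auto simp: syzygy_def intro!: submodule_of_rkernel P_module M d e)

lemma syzygy_module: "right_module R (Z i)"
  using right_module_submodule[OF P_module syzygy_submodule[of i]] by (simp add: syzygy_def)

lemma d_surj: "d i ` carrier (P (Suc i)) = carrier (Z i)"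
  using exact_0 exact_Suc by (cases i) (auto simp: syzygy_def)

lemma d_syzygy: "d i \<in> rhom R (P (Suc i)) (Z i)"
  using rhom_into_submodule[OF d, of i "carrier (Z i)"] d_surj[of i] by (simp add: syzygy_def)

lemma syzygy_0: "P 0\<lparr>carrier := rkernel (P 0) M e\<rparr> = Z 0"
  by (simp add: syzygy_def)

text \<open>Seen as a map onto \<open>Z i\<close>, the differential \<open>d i\<close> keeps its
  kernel, since \<open>Z i\<close> shares the zero of \<open>P i\<close>. Thus the lemmas about a
  single surjection apply with \<open>K = Z i\<close> at every stage.\<close>

lemma syzygy_Suc: "P (Suc i)\<lparr>carrier := rkernel (P (Suc i)) (Z i) (d i)\<rparr> = Z (Suc i)"
  by (simp add: syzygy_def rkernel_def)

lemma carrier_syzygy_0: "carrier (Z 0) = rkernel (P 0) M e"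
  by (simp add: syzygy_def)

lemma carrier_syzygy_Suc: "carrier (Z (Suc i)) = rkernel (P (Suc i)) (Z i) (d i)"
  by (simp add: syzygy_def rkernel_def)

lemma syzygy_fg: "fg_right_module R (Z i)"
  by (rule fg_image[OF fg syzygy_module d_syzygy d_surj])

text \<open>\<open>Ext\<^sup>i(M, N) = 0\<close> for all \<open>i > 0\<close>, computed with the given resolution.\<close>

definition hom_exact :: "('a, 'n) rmodule \<Rightarrow> bool" where
  "hom_exact N \<longleftrightarrow> (\<forall>i. \<forall>f\<in>rhom R (P (Suc i)) N.
     (\<forall>x\<in>carrier (P (Suc (Suc i))). f (d (Suc i) x) = \<zero>\<^bsub>N\<^esub>)
       \<longrightarrow> (\<exists>v\<in>rhom R (P i) N. \<forall>x\<in>carrier (P (Suc i)). f x = v (d i x)))"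

lemma fg_M: "fg_right_module R M"
  by (rule fg_image[OF fg M e e_surj])

text \<open>Composing \<open>u\<close> with \<open>d i\<close> gives a cocycle on
  \<open>P (Suc i)\<close>. If it is the coboundary of \<open>v\<close>, then \<open>v\<close>
  agrees with \<open>u\<close> on the image of \<open>d i\<close>, which is all of
  \<open>Z i\<close>.\<close>

lemma hom_exact_extends:
  assumes "hom_exact N" "u \<in> rhom R (Z i) N" and N: "right_module R N"
  obtains v where "v \<in> rhom R (P i) N" "\<And>x. x \<in> carrier (Z i) \<Longrightarrow> v x = u x"
proof -
  let ?f = "compose (carrier (P (Suc i))) u (d i)"
  have f: "?f \<in> rhom R (P (Suc i)) N" by (rule rhom_compose[OF P_module d_syzygy assms(2)])
  have "?f (d (Suc i) x) = \<zero>\<^bsub>N\<^esub>" if "x \<in> carrier (P (Suc (Suc i)))" for x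
  proof -
    have "d (Suc i) x \<in> carrier (Z (Suc i))" using that d_surj[of "Suc i"] by blast
    then have "d (Suc i) x \<in> carrier (P (Suc i))" "d i (d (Suc i) x) = \<zero>\<^bsub>Z i\<^esub>"
      by (auto simp: carrier_syzygy_Suc rkernel_def)
    then show ?thesis using rhom_zero[OF syzygy_module N assms(2)] by (simp add: compose_def)
  qed
  then obtain v where v: "v \<in> rhom R (P i) N" "\<And>x. x \<in> carrier (P (Suc i)) \<Longrightarrow> ?f x = v (d i x)"
    using assms(1) f unfolding hom_exact_def by blast
  have "v y = u y" if y: "y \<in> carrier (Z i)" for y
  proof -
    obtain x where "x \<in> carrier (P (Suc i))" "y = d i x" using y d_surj[of i] by blast
    then show ?thesis using v(2)[of x] by (simp add: compose_def)
  qed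
  then show ?thesis using v(1) that by blast
qed

lemma projective_of_hom_exact:
  assumes "hom_exact (regular_rmodule R)" "right_module R (regular_rmodule R)"
    and "projective_rmodule R (Z n)"
  shows "projective_rmodule R M"
proof -
  have ext: "\<exists>v\<in>rhom R (P i) (regular_rmodule R). \<forall>x\<in>carrier (Z i). v x = u x"
    if "u \<in> rhom R (Z i) (regular_rmodule R)" for u i
    using hom_exact_extends[OF assms(1) that assms(2)] by metis
  have "projective_rmodule R (Z 0)"
    using assms(3)
  proof (induction n)
    case (Suc n)
    have "projective_rmodule R (Z n)"
    proof (rule projective_of_extension[OF proj fg syzygy_module d_syzygy d_surj], unfold syzygy_Suc)
      show "\<exists>v\<in>rhom R (P (Suc n)) (regular_rmodule R). \<forall>x\<in>rkernel (P (Suc n)) (Z n) (d n). v x = u x"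
        if "u \<in> rhom R (Z (Suc n)) (regular_rmodule R)" for u
        using ext[OF that] by (simp add: carrier_syzygy_Suc)
    qed (use Suc.prems syzygy_fg in auto)
    then show ?case by (rule Suc.IH)
  qed
  \<comment> \<open>One more step of the same kind, with the augmentation \<open>e\<close> in place
    of a differential.\<close>
  show ?thesis
  proof (rule projective_of_extension[OF proj fg M e e_surj], unfold syzygy_0)
    show "\<exists>v\<in>rhom R (P 0) (regular_rmodule R). \<forall>x\<in>rkernel (P 0) M e. v x = u x"
      if "u \<in> rhom R (Z 0) (regular_rmodule R)" for u
      using ext[OF that] by (simp add: syzygy_def)
  qed (use \<open>projective_rmodule R (Z 0)\<close> syzygy_fg in auto)
qed

text \<open>A resolution of a projective module splits everywhere: a retraction of
  \<open>P i\<close> onto \<open>Z i\<close> makes \<open>Z i\<close> projective, and this splits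
  the next surjection, of \<open>P (Suc i)\<close> onto \<open>Z i\<close>.\<close>

lemma syzygy_retraction:
  assumes "projective_rmodule R M"
  obtains r where "r \<in> rhom R (P i) (Z i)" "\<And>x. x \<in> carrier (Z i) \<Longrightarrow> r x = x"
proof -
  have retr: "projective_rmodule R (Z i)" if "r \<in> rhom R (P i) (Z i)" "\<forall>x\<in>carrier (Z i). r x = x" for i r
  proof (rule projective_retract[OF syzygy_module proj fg _ that(1)])
    show "(\<lambda>x\<in>carrier (Z i). x) \<in> rhom R (Z i) (P i)"
      using rhom_inclusion[OF P_module syzygy_submodule[of i]] by (simp add: syzygy_def)
  qed (use that in auto)
  have "\<exists>r\<in>rhom R (P i) (Z i). \<forall>x\<in>carrier (Z i). r x = x"
  proof (induction i)
    case 0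
    show ?case
      by (rule kernel_retraction_of_projective[OF P_module assms fg_M e e_surj,
            unfolded syzygy_0, folded carrier_syzygy_0]) blast
  next
    case (Suc i)
    then have Zi: "projective_rmodule R (Z i)" using retr by blast
    show ?case
      by (rule kernel_retraction_of_projective[OF P_module Zi syzygy_fg d_syzygy d_surj,
            unfolded syzygy_Suc, folded carrier_syzygy_Suc]) blast
  qed
  then show ?thesis using that by blast
qed

text \<open>A cocycle vanishes on the kernel of \<open>d i\<close> and so factors through
  \<open>Z i\<close>; the retraction of \<open>P i\<close> onto \<open>Z i\<close> extends the
  factor to \<open>P i\<close>.\<close>

lemma hom_exact_of_projective:
  assumes "projective_rmodule R M" and N: "right_module R N"
  shows "hom_exact N"
  unfolding hom_exact_def
proof (intro allI ballI impI)
  fix i f assume f: "f \<in> rhom R (P (Suc i)) N" and 0: "\<forall>x\<in>carrier (P (Suc (Suc i))). f (d (Suc i) x) = \<zero>\<^bsub>N\<^esub>"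
  have "f x = \<zero>\<^bsub>N\<^esub>" if "x \<in> carrier (P (Suc i))" "d i x = \<zero>\<^bsub>Z i\<^esub>" for x
  proof -
    have "x \<in> d (Suc i) ` carrier (P (Suc (Suc i)))"
      using that by (simp add: d_surj carrier_syzygy_Suc rkernel_def)
    then show ?thesis using 0 by auto
  qed
  then obtain u where u: "u \<in> rhom R (Z i) N" "\<And>x. x \<in> carrier (P (Suc i)) \<Longrightarrow> u (d i x) = f x"
    using rhom_factor[OF P_module syzygy_module N d_syzygy d_surj f] by blast
  obtain r where r: "r \<in> rhom R (P i) (Z i)" "\<And>x. x \<in> carrier (Z i) \<Longrightarrow> r x = x"
    using syzygy_retraction[OF assms(1)] by blast
  have "f x = compose (carrier (P i)) u r (d i x)" if "x \<in> carrier (P (Suc i))" for x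
    using that u(2) r(2)[OF rhomD(1)[OF d_syzygy that]] rhomD(1)[OF d that] by (simp add: compose_def)
  then show "\<exists>v\<in>rhom R (P i) N. \<forall>x\<in>carrier (P (Suc i)). f x = v (d i x)"
    using rhom_compose[OF P_module r(1) u(1)] by blast
qed

lemma stably_retracts_syzygy:
  assumes "resolution R M' P' d' e'"
    and \<alpha>: "\<alpha> \<in> rhom R M M'" and \<beta>: "\<beta> \<in> rhom R M' M" and \<beta>\<alpha>: "\<And>x. x \<in> carrier M \<Longrightarrow> \<beta> (\<alpha> x) = x"
  shows "stably_retracts R (Z i) (syzygy P' d' M' e' i) (P i)"
proof (induction i)
  interpret M: right_module R M by (rule M)
  interpret P0: right_module R "P 0" by (rule P_module)
  interpret R': resolution R M' P' d' e' by fact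
  {
    case 0
    have z: "(\<lambda>x\<in>carrier M. \<zero>\<^bsub>P 0\<^esub>) \<in> rhom R M (P 0)" by (rule rhom_restrictI[OF M]) auto
    have z': "(\<lambda>x\<in>carrier (P 0). \<zero>\<^bsub>M\<^esub>) \<in> rhom R (P 0) M" by (rule rhom_restrictI[OF P_module]) auto
    \<comment> \<open>An honest retract is a stable one with zero correction. The module
      \<open>P 0\<close> is only a carrier for the two zero maps.\<close>
    have "stably_retracts R M M' (P 0)"
      unfolding stably_retracts_def
      by (intro bexI[OF _ \<alpha>] bexI[OF _ \<beta>] bexI[OF _ z] bexI[OF _ z']) (simp add: \<beta>\<alpha>)
    from stably_retracts_kernel[OF this proj fg R'.proj R'.fg proj fg M R'.M e e_surj R'.e R'.e_surj]
    show ?case unfolding syzygy_0 R'.syzygy_0 .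
  next
    case (Suc i)
    from stably_retracts_kernel[OF Suc proj fg R'.proj R'.fg proj fg syzygy_module R'.syzygy_module
        d_syzygy d_surj R'.d_syzygy R'.d_surj]
    show ?case unfolding syzygy_Suc R'.syzygy_Suc .
  }
qed

end

section \<open>Projective syzygies from finite global dimension\<close>

text \<open>Transport of structure along a map \<open>j\<close> that is injective on the carrier. It
  serves to move a module into the type \<open>(nat \<Rightarrow> 'a) set\<close> over which
  \<open>finite_global_dim\<close> quantifies.\<close>

definition image_rmodule :: "('m \<Rightarrow> 'n) \<Rightarrow> ('a, 'm) rmodule \<Rightarrow> ('a, 'n) rmodule" where
  "image_rmodule j M = (let i = inv_into (carrier M) j in
     \<lparr>carrier = j ` carrier M, monoid.mult = (\<lambda>x y. x), one = j \<zero>\<^bsub>M\<^esub>, zero = j \<zero>\<^bsub>M\<^esub>,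
      add = (\<lambda>x y. j (i x \<oplus>\<^bsub>M\<^esub> i y)), ract = (\<lambda>x a. j (i x \<triangleleft>\<^bsub>M\<^esub> a))\<rparr>)"

lemma image_rmodule:
  assumes M: "right_module R M" and j: "inj_on j (carrier M)"
  shows "right_module R (image_rmodule j M)"
    and "restrict j (carrier M) \<in> rhom R M (image_rmodule j M)"
    and "restrict (inv_into (carrier M) j) (carrier (image_rmodule j M)) \<in> rhom R (image_rmodule j M) M"
proof -
  interpret right_module R M by fact
  note [simp] = inv_into_f_f[OF j] image_rmodule_def Let_def ract_closed
  have "abelian_group (image_rmodule j M)"
  proof (rule abelian_groupI)
    show "\<exists>y\<in>carrier (image_rmodule j M). y \<oplus>\<^bsub>image_rmodule j M\<^esub> x = \<zero>\<^bsub>image_rmodule j M\<^esub>"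
      if x: "x \<in> carrier (image_rmodule j M)" for x
    proof -
      obtain x' where "x' \<in> carrier M" "x = j x'" using x by auto
      then show ?thesis by (intro bexI[of _ "j (\<ominus>\<^bsub>M\<^esub> x')"]) (auto simp: M.l_neg)
    qed
  qed (auto simp: M.a_ac)
  then show I: "right_module R (image_rmodule j M)"
    by (intro right_module.intro right_module_axioms.intro R.ring_axioms)
      (auto simp: ract_add_left ract_add_right ract_assoc ract_one)
  show "restrict j (carrier M) \<in> rhom R M (image_rmodule j M)"
    by (rule rhom_restrictI[OF M]) auto
  show "restrict (inv_into (carrier M) j) (carrier (image_rmodule j M)) \<in> rhom R (image_rmodule j M) M"
    by (rule rhom_restrictI[OF I]) auto
qed

text \<open>An element is encoded by its fibre under a surjection from some \<open>R^n\<close>; the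
  fibres are nonempty, so distinct elements have distinct fibres.\<close>

lemma fg_module_embeds:
  fixes M :: "('a, 'm) rmodule"
  assumes "fg_right_module R M"
  obtains j :: "'m \<Rightarrow> (nat \<Rightarrow> 'a) set" where "inj_on j (carrier M)"
proof -
  obtain n :: nat and f where f: "f ` carrier (free_rmodule R {..<n}) = carrier M"
    using fg_cover[OF assms] by metis
  have "inj_on (\<lambda>m. {x \<in> carrier (free_rmodule R {..<n}). f x = m}) (carrier M)"
  proof (rule inj_onI)
    fix m m' assume m: "m \<in> carrier M" and eq:
      "{x \<in> carrier (free_rmodule R {..<n}). f x = m} = {x \<in> carrier (free_rmodule R {..<n}). f x = m'}"
    have "m \<in> f ` carrier (free_rmodule R {..<n})" using m f by simp
    then obtain x where x: "x \<in> carrier (free_rmodule R {..<n})" "f x = m" by (auto simp only: image_iff)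
    then have "x \<in> {x \<in> carrier (free_rmodule R {..<n}). f x = m}" by simp
    then have "x \<in> {x \<in> carrier (free_rmodule R {..<n}). f x = m'}" unfolding eq .
    then show "m = m'" using x by simp
  qed
  then show ?thesis by (rule that)
qed

lemma resolution_of_proj_resolution:
  "right_module R M \<Longrightarrow> proj_resolution R M P d e \<Longrightarrow> resolution R M P d e"
  by (rule resolution.intro) (auto simp: proj_resolution_def)

text \<open>The bounded resolution supplied by the hypothesis belongs to a copy of \<open>M\<close>
  and is unrelated to \<open>P\<close>. Stable retraction makes each syzygy of \<open>P\<close> a
  stable retract of the corresponding syzygy of the bounded resolution, which is eventually
  zero.\<close>

lemma (in resolution) syzygy_projective:
  assumes "finite_global_dim R"
  obtains n where "projective_rmodule R (Z n)"
proof -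
  obtain n where n: "\<And>M :: ('a, (nat \<Rightarrow> 'a) set) rmodule. fg_right_module R M \<Longrightarrow> proj_dim_le R M n"
    using assms unfolding finite_global_dim_def by blast
  obtain j :: "'m \<Rightarrow> (nat \<Rightarrow> 'a) set" where j: "inj_on j (carrier M)" using fg_module_embeds[OF fg_M] by blast
  let ?M' = "image_rmodule j M"
  note im = image_rmodule[OF M j]
  have surj: "restrict j (carrier M) ` carrier M = carrier ?M'"
    by (simp add: image_rmodule_def Let_def)
  obtain P' d' e' where P': "proj_resolution R ?M' P' d' e'" "\<And>i. i > n \<Longrightarrow> carrier (P' i) = {\<zero>\<^bsub>P' i\<^esub>}"
    using n[OF fg_image[OF fg_M im(1,2) surj]] unfolding proj_dim_le_def by blast
  interpret R': resolution R ?M' P' d' e' by (rule resolution_of_proj_resolution[OF im(1) P'(1)])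
  have "stably_retracts R (Z (Suc n)) (R'.Z (Suc n)) (P (Suc n))"
    by (rule stably_retracts_syzygy[OF R'.resolution_axioms im(2,3)])
      (simp add: inv_into_f_f[OF j], simp add: image_rmodule_def Let_def)
  \<comment> \<open>Vanishing starts strictly above \<open>n\<close>, so \<open>Suc n\<close> is the
    first index at which the ambient module, and with it the syzygy, is known to be zero.\<close>
  moreover have "carrier (R'.Z (Suc n)) = {\<zero>\<^bsub>R'.Z (Suc n)\<^esub>}"
    using R'.syzygy_submodule[of "Suc n"] P'(2)[of "Suc n"] by (auto simp: submodule_of_def syzygy_def)
  ultimately have "projective_rmodule R (Z (Suc n))"
    using stably_retracts_trivial[OF _ syzygy_module R'.syzygy_module _ proj fg] by blast
  then show ?thesis by (rule that)
qed

lemma (in ring) right_module_regular: "right_module R (regular_rmodule R)"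
proof -
  have "abelian_group (regular_rmodule R)"
    by (rule abelian_groupI) (auto simp: regular_rmodule_def a_ac intro!: bexI[of _ "\<ominus>\<^bsub>R\<^esub> _"] l_neg)
  then show ?thesis
    by (intro right_module.intro right_module_axioms.intro ring_axioms)
      (auto simp: regular_rmodule_def l_distr r_distr m_assoc)
qed

theorem (in resolution) hom_exact_regular_iff:
  assumes "finite_global_dim R"
  shows "hom_exact (regular_rmodule R) \<longleftrightarrow> projective_rmodule R M"
proof -
  interpret M: right_module R M by (rule M)
  obtain n where "projective_rmodule R (Z n)" using syzygy_projective[OF assms] by blast
  then show ?thesis
    using projective_of_hom_exact hom_exact_of_projective M.R.right_module_regular by blast
qed

section \<open>Restriction of scalars\<close>

lemma right_module_restrict_scalars:
  assumes "ring R" "\<phi> \<in> ring_hom R S" "right_module S M"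
  shows "right_module R (restrict_scalars \<phi> M)"
proof -
  interpret M: right_module S M by fact
  have "abelian_group (restrict_scalars \<phi> M)"
  proof (rule abelian_groupI)
    show "\<exists>y\<in>carrier (restrict_scalars \<phi> M). y \<oplus>\<^bsub>restrict_scalars \<phi> M\<^esub> x = \<zero>\<^bsub>restrict_scalars \<phi> M\<^esub>"
      if "x \<in> carrier (restrict_scalars \<phi> M)" for x
      using that by (intro bexI[of _ "\<ominus>\<^bsub>M\<^esub> x"]) (auto simp: restrict_scalars_def M.M.l_neg)
  qed (auto simp: restrict_scalars_def M.M.a_ac)
  then show ?thesis
    using assms(1)
    by (intro right_module.intro right_module_axioms.intro)
      (auto simp: restrict_scalars_def M.ract_closed M.ract_add_left M.ract_add_right M.ract_assoc M.ract_one
        ring_hom_closed[OF assms(2)] ring_hom_add[OF assms(2)] ring_hom_mult[OF assms(2)] ring_hom_one[OF assms(2)])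
qed

lemma rhom_restrict_scalars:
  assumes "\<phi> \<in> ring_hom R S" "f \<in> rhom S M N"
  shows "f \<in> rhom R (restrict_scalars \<phi> M) (restrict_scalars \<phi> N)"
  using assms(2) ring_hom_closed[OF assms(1)] by (auto simp: rhom_def restrict_scalars_def)

lemma submodule_of_restrict_scalars:
  assumes "\<phi> \<in> ring_hom R S" "submodule_of S M W"
  shows "submodule_of R (restrict_scalars \<phi> M) W"
  using assms(2) ring_hom_closed[OF assms(1)] by (auto simp: submodule_of_def restrict_scalars_def)

lemma restrict_scalars_simps [simp]:
  "carrier (restrict_scalars \<phi> M) = carrier M"
  "zero (restrict_scalars \<phi> M) = zero M"
  "add (restrict_scalars \<phi> M) = add M"
  "ract (restrict_scalars \<phi> M) = (\<lambda>m a. m \<triangleleft>\<^bsub>M\<^esub> \<phi> a)"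
  by (simp_all add: restrict_scalars_def)

text \<open>Every submodule over \<open>S\<close> is one over \<open>R\<close>, so generators over
  \<open>R\<close> also generate over \<open>S\<close>.\<close>

lemma fg_of_fg_restrict_scalars:
  assumes "\<phi> \<in> ring_hom R S" "right_module S M" "fg_right_module R (restrict_scalars \<phi> M)"
  shows "fg_right_module S M"
proof -
  obtain T where T: "finite T" "generates R (restrict_scalars \<phi> M) T"
    using assms(3) unfolding fg_right_module_iff by blast
  have "generates S M T"
    using T(2) submodule_of_restrict_scalars[OF assms(1)] by (auto simp: generates_def)
  then show ?thesis using T(1) assms(2) unfolding fg_right_module_iff by blast
qed


section \<open>Modules over the dual extension\<close>

text \<open>All that remains of the grading here is the sign map as an involutive ring endomorphism.
  Involutivity lets a coefficient pass \<epsilon> in either direction.\<close>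

locale dual_extension = A?: ring A for A :: "('a, 'b) ring_scheme" (structure) +
  fixes \<sigma> :: "'a \<Rightarrow> 'a"
  assumes \<sigma>: "\<sigma> \<in> ring_hom A A" and \<sigma>\<sigma>: "a \<in> carrier A \<Longrightarrow> \<sigma> (\<sigma> a) = a"
begin

abbreviation E where "E \<equiv> dual_ext A \<sigma>"
abbreviation res where "res M \<equiv> restrict_scalars (\<lambda>a. pure_tensor A a 0) M"
abbreviation \<epsilon> where "\<epsilon> \<equiv> (\<zero>, \<one>)"

lemmas \<sigma>_simps = ring_hom_closed[OF \<sigma>] ring_hom_add[OF \<sigma>] ring_hom_mult[OF \<sigma>] ring_hom_one[OF \<sigma>] \<sigma>\<sigma>

lemma \<sigma>_zero: "\<sigma> \<zero> = \<zero>"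
  by (rule ring_hom_zero[OF \<sigma> A.ring_axioms A.ring_axioms])

lemma E_ring: "ring E"
  by (rule ring_dual_ext[OF A.ring_axioms \<sigma>])

lemma pure_tensor_0: "pure_tensor A a 0 = (a, \<zero>)"
  by (simp add: pure_tensor_def)

lemma E_simps:
  "carrier E = carrier A \<times> carrier A"
  "(a, b) \<otimes>\<^bsub>E\<^esub> (c, d) = (a \<otimes> c, a \<otimes> d \<oplus> b \<otimes> \<sigma> c)"
  "(a, b) \<oplus>\<^bsub>E\<^esub> (c, d) = (a \<oplus> c, b \<oplus> d)"
  "\<one>\<^bsub>E\<^esub> = (\<one>, \<zero>)" "\<zero>\<^bsub>E\<^esub> = (\<zero>, \<zero>)"
  by (simp_all add: dual_ext_def)

lemma inclusion_ring_hom: "(\<lambda>a. pure_tensor A a 0) \<in> ring_hom A E"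
  by (rule ring_hom_memI) (auto simp: pure_tensor_0 E_simps \<sigma>_simps)

lemma res_module: "right_module E M \<Longrightarrow> right_module A (res M)"
  by (rule right_module_restrict_scalars[OF A.ring_axioms inclusion_ring_hom])

lemma rhom_res: "f \<in> rhom E M N \<Longrightarrow> f \<in> rhom A (res M) (res N)"
  by (rule rhom_restrict_scalars[OF inclusion_ring_hom])

text \<open>Everything follows from two ways of writing the \<epsilon>-part: \<open>(0, b)\<close>
  is \<open>(b, 0)\<close> times \<epsilon>, and also \<epsilon> times
  \<open>(\<sigma> b, 0)\<close>. The last equation is the square-zero relation.\<close>

lemma ract_E:
  assumes "right_module E X" "x \<in> carrier X" "a \<in> carrier A" "b \<in> carrier A"
  shows "x \<triangleleft>\<^bsub>X\<^esub> (a, b) = x \<triangleleft>\<^bsub>X\<^esub> (a, \<zero>) \<oplus>\<^bsub>X\<^esub> x \<triangleleft>\<^bsub>X\<^esub> (b, \<zero>) \<triangleleft>\<^bsub>X\<^esub> \<epsilon>"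
    and "x \<triangleleft>\<^bsub>X\<^esub> (a, b) = x \<triangleleft>\<^bsub>X\<^esub> (a, \<zero>) \<oplus>\<^bsub>X\<^esub> x \<triangleleft>\<^bsub>X\<^esub> \<epsilon> \<triangleleft>\<^bsub>X\<^esub> (\<sigma> b, \<zero>)"
    and "x \<triangleleft>\<^bsub>X\<^esub> (a, b) \<triangleleft>\<^bsub>X\<^esub> \<epsilon> = x \<triangleleft>\<^bsub>X\<^esub> \<epsilon> \<triangleleft>\<^bsub>X\<^esub> (\<sigma> a, \<zero>)"
    and "x \<triangleleft>\<^bsub>X\<^esub> \<epsilon> \<triangleleft>\<^bsub>X\<^esub> \<epsilon> = \<zero>\<^bsub>X\<^esub>"
proof -
  interpret X: right_module E X by fact
  have *: "x \<triangleleft>\<^bsub>X\<^esub> (a, b) = x \<triangleleft>\<^bsub>X\<^esub> (a, \<zero>) \<oplus>\<^bsub>X\<^esub> x \<triangleleft>\<^bsub>X\<^esub> (\<zero>, b)"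
    using X.ract_add_right[of x "(a, \<zero>)" "(\<zero>, b)"] assms by (simp add: E_simps)
  show "x \<triangleleft>\<^bsub>X\<^esub> (a, b) = x \<triangleleft>\<^bsub>X\<^esub> (a, \<zero>) \<oplus>\<^bsub>X\<^esub> x \<triangleleft>\<^bsub>X\<^esub> (b, \<zero>) \<triangleleft>\<^bsub>X\<^esub> \<epsilon>"
    using X.ract_assoc[of x "(b, \<zero>)" \<epsilon>] assms unfolding * by (simp add: E_simps \<sigma>_zero)
  show "x \<triangleleft>\<^bsub>X\<^esub> (a, b) = x \<triangleleft>\<^bsub>X\<^esub> (a, \<zero>) \<oplus>\<^bsub>X\<^esub> x \<triangleleft>\<^bsub>X\<^esub> \<epsilon> \<triangleleft>\<^bsub>X\<^esub> (\<sigma> b, \<zero>)"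
    using X.ract_assoc[of x \<epsilon> "(\<sigma> b, \<zero>)"] assms unfolding * by (simp add: E_simps \<sigma>_zero \<sigma>_simps)
  show "x \<triangleleft>\<^bsub>X\<^esub> (a, b) \<triangleleft>\<^bsub>X\<^esub> \<epsilon> = x \<triangleleft>\<^bsub>X\<^esub> \<epsilon> \<triangleleft>\<^bsub>X\<^esub> (\<sigma> a, \<zero>)"
    using X.ract_assoc[of x \<epsilon> "(\<sigma> a, \<zero>)"] X.ract_assoc[of x "(a, b)" \<epsilon>] assms
    by (simp add: E_simps \<sigma>_zero \<sigma>_simps)
  show "x \<triangleleft>\<^bsub>X\<^esub> \<epsilon> \<triangleleft>\<^bsub>X\<^esub> \<epsilon> = \<zero>\<^bsub>X\<^esub>"
    using X.ract_assoc[of x \<epsilon> \<epsilon>] X.ract_zero_right[of x] assms by (simp add: E_simps \<sigma>_zero)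
qed

text \<open>As a right \<open>A\<close>-module, \<open>E\<close> is generated by 1 and \<epsilon>,
  so generators \<open>S\<close> over \<open>E\<close> yield the generators \<open>S\<close> and
  \<open>S \<epsilon>\<close> over \<open>A\<close>.\<close>

lemma fg_res_iff:
  assumes M: "right_module E M"
  shows "fg_right_module A (res M) \<longleftrightarrow> fg_right_module E M"
proof
  assume "fg_right_module A (res M)"
  then show "fg_right_module E M" by (rule fg_of_fg_restrict_scalars[OF inclusion_ring_hom M])
next
  interpret M: right_module E M by fact
  have \<epsilon>E: "\<epsilon> \<in> carrier E" by (simp add: E_simps)
  assume "fg_right_module E M"
  then obtain S where S: "finite S" "generates E M S" unfolding fg_right_module_iff by blast
  then have SM: "S \<subseteq> carrier M" by (simp add: generates_def)
  have "generates A (res M) (S \<union> (\<lambda>x. x \<triangleleft>\<^bsub>M\<^esub> \<epsilon>) ` S)"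
    unfolding generates_def
  proof (intro conjI allI impI)
    show "S \<union> (\<lambda>x. x \<triangleleft>\<^bsub>M\<^esub> \<epsilon>) ` S \<subseteq> carrier (res M)" using SM M.ract_closed[OF _ \<epsilon>E] by auto
    fix W assume W: "submodule_of A (res M) W \<and> S \<union> (\<lambda>x. x \<triangleleft>\<^bsub>M\<^esub> \<epsilon>) ` S \<subseteq> W"
    then have Wd: "W \<subseteq> carrier M" "\<zero>\<^bsub>M\<^esub> \<in> W" "\<And>x y. x \<in> W \<Longrightarrow> y \<in> W \<Longrightarrow> x \<oplus>\<^bsub>M\<^esub> y \<in> W"
      "\<And>x a. x \<in> W \<Longrightarrow> a \<in> carrier A \<Longrightarrow> x \<triangleleft>\<^bsub>M\<^esub> (a, \<zero>) \<in> W"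
      by (auto simp: submodule_of_def pure_tensor_0)
    \<comment> \<open>The largest \<open>E\<close>-submodule inside \<open>W\<close>. It is stable
      because moving \<epsilon> past a scalar only twists the scalar by \<sigma>, and
      \<open>W\<close> is stable under \<open>A\<close>.\<close>
    let ?V = "{x \<in> W. x \<triangleleft>\<^bsub>M\<^esub> \<epsilon> \<in> W}"
    have "submodule_of E M ?V"
      unfolding submodule_of_def
    proof (intro conjI ballI)
      show "?V \<subseteq> carrier M" using Wd(1) by blast
      show "\<zero>\<^bsub>M\<^esub> \<in> ?V" using Wd(2) M.ract_zero_left[OF \<epsilon>E] by simp
      show "x \<oplus>\<^bsub>M\<^esub> y \<in> ?V" if "x \<in> ?V" "y \<in> ?V" for x y
        using that Wd(3) M.ract_add_left[OF _ _ \<epsilon>E, of x y] subsetD[OF Wd(1)] by simp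
      fix x r assume x: "x \<in> ?V" and "r \<in> carrier E"
      then obtain a b where r: "r = (a, b)" "a \<in> carrier A" "b \<in> carrier A" by (auto simp: E_simps)
      have xM: "x \<in> carrier M" using x Wd(1) by blast
      have "x \<triangleleft>\<^bsub>M\<^esub> r \<in> W" unfolding r(1) ract_E(2)[OF M xM r(2,3)]
        using x Wd(3,4) r(2,3) \<sigma>_simps(1) by simp
      moreover have "x \<triangleleft>\<^bsub>M\<^esub> r \<triangleleft>\<^bsub>M\<^esub> \<epsilon> \<in> W" unfolding r(1) ract_E(3)[OF M xM r(2,3)]
        using x Wd(4) r(2,3) \<sigma>_simps(1) by simp
      ultimately show "x \<triangleleft>\<^bsub>M\<^esub> r \<in> ?V" by simp
    qed
    moreover have "S \<subseteq> ?V" using W by auto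
    ultimately have "?V = carrier M" using S(2) by (simp add: generates_def)
    then show "W = carrier (res M)" using Wd(1) by auto
  qed
  then show "fg_right_module A (res M)"
    using S(1) unfolding fg_right_module_iff
    by (intro conjI exI[of _ "S \<union> (\<lambda>x. x \<triangleleft>\<^bsub>M\<^esub> \<epsilon>) ` S"] res_module M) auto
qed

section \<open>Coinduction along the inclusion of \<open>A\<close> into its dual extension\<close>

text \<open>
  The coinduced module \<open>Hom\<^sub>A(E, N)\<close>: a hom is given by its values at \<open>1\<close> and \<open>\<epsilon>\<close>. Coinduction is an exact
  right adjoint of restriction, so restriction preserves projectives.
\<close>

definition coind :: "('a, 'n) rmodule \<Rightarrow> ('a \<times> 'a, 'n \<times> 'n) rmodule" where
  "coind N = \<lparr>carrier = carrier N \<times> carrier N, monoid.mult = (\<lambda>x y. x), one = (\<zero>\<^bsub>N\<^esub>, \<zero>\<^bsub>N\<^esub>),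
     zero = (\<zero>\<^bsub>N\<^esub>, \<zero>\<^bsub>N\<^esub>), add = (\<lambda>(x, y) (x', y'). (x \<oplus>\<^bsub>N\<^esub> x', y \<oplus>\<^bsub>N\<^esub> y')),
     ract = (\<lambda>(x, y) (c, d). (x \<triangleleft>\<^bsub>N\<^esub> c \<oplus>\<^bsub>N\<^esub> y \<triangleleft>\<^bsub>N\<^esub> \<sigma> d, y \<triangleleft>\<^bsub>N\<^esub> \<sigma> c))\<rparr>"

lemma coind_module:
  assumes "right_module A N"
  shows "right_module E (coind N)"
proof -
  interpret N: right_module A N by fact
  have "abelian_group (coind N)"
  proof (rule abelian_groupI)
    show "\<exists>y\<in>carrier (coind N). y \<oplus>\<^bsub>coind N\<^esub> x = \<zero>\<^bsub>coind N\<^esub>" if "x \<in> carrier (coind N)" for x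
      using that by (intro bexI[of _ "(\<ominus>\<^bsub>N\<^esub> fst x, \<ominus>\<^bsub>N\<^esub> snd x)"]) (auto simp: coind_def N.M.l_neg)
  qed (auto simp: coind_def N.M.a_ac)
  then show ?thesis
    by (intro right_module.intro right_module_axioms.intro E_ring)
      (auto simp: coind_def E_simps \<sigma>_simps \<sigma>_zero N.ract_closed N.ract_add_left N.ract_add_right
        N.ract_assoc N.ract_one N.M.a_ac)
qed

text \<open>The adjunct of \<open>f\<close> sends \<open>x\<close> to the hom
  \<open>r \<mapsto> f (x r)\<close>, recorded here by its values at 1 and \<epsilon>.\<close>

lemma rhom_coind:
  assumes X: "right_module E X" and N: "right_module A N" and f: "f \<in> rhom A (res X) N"
  shows "(\<lambda>x\<in>carrier X. (f x, f (x \<triangleleft>\<^bsub>X\<^esub> \<epsilon>))) \<in> rhom E X (coind N)"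
proof (rule rhom_restrictI[OF X])
  interpret X: right_module E X by fact
  note fD = rhomD(1-3)[OF f, simplified, unfolded pure_tensor_0]
  have \<epsilon>E: "\<epsilon> \<in> carrier E" "\<And>a. a \<in> carrier A \<Longrightarrow> (a, \<zero>) \<in> carrier E" by (simp_all add: E_simps)
  fix x assume x: "x \<in> carrier X"
  show "(f x, f (x \<triangleleft>\<^bsub>X\<^esub> \<epsilon>)) \<in> carrier (coind N)"
    using x fD(1) X.ract_closed[OF x \<epsilon>E(1)] by (simp add: coind_def)
  show "(f (x \<oplus>\<^bsub>X\<^esub> y), f ((x \<oplus>\<^bsub>X\<^esub> y) \<triangleleft>\<^bsub>X\<^esub> \<epsilon>)) = (f x, f (x \<triangleleft>\<^bsub>X\<^esub> \<epsilon>)) \<oplus>\<^bsub>coind N\<^esub> (f y, f (y \<triangleleft>\<^bsub>X\<^esub> \<epsilon>))"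
    if "y \<in> carrier X" for y
    using x that fD(2) X.ract_closed[OF _ \<epsilon>E(1)] by (simp add: coind_def X.ract_add_left \<epsilon>E)
  fix r assume "r \<in> carrier E"
  then obtain a b where r: "r = (a, b)" "a \<in> carrier A" "b \<in> carrier A" by (auto simp: E_simps)
  have "f (x \<triangleleft>\<^bsub>X\<^esub> r) = f x \<triangleleft>\<^bsub>N\<^esub> a \<oplus>\<^bsub>N\<^esub> f (x \<triangleleft>\<^bsub>X\<^esub> \<epsilon>) \<triangleleft>\<^bsub>N\<^esub> \<sigma> b"
    unfolding r(1) ract_E(2)[OF X x r(2,3)]
    using x r(2,3) \<sigma>_simps(1) X.ract_closed[OF x \<epsilon>E(1)] X.ract_closed \<epsilon>E(2) fD(2,3) by simp
  moreover have "f (x \<triangleleft>\<^bsub>X\<^esub> r \<triangleleft>\<^bsub>X\<^esub> \<epsilon>) = f (x \<triangleleft>\<^bsub>X\<^esub> \<epsilon>) \<triangleleft>\<^bsub>N\<^esub> \<sigma> a"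
    unfolding r(1) ract_E(3)[OF X x r(2,3)]
    using x r(2,3) \<sigma>_simps(1) X.ract_closed[OF x \<epsilon>E(1)] fD(3) by simp
  ultimately show "(f (x \<triangleleft>\<^bsub>X\<^esub> r), f (x \<triangleleft>\<^bsub>X\<^esub> r \<triangleleft>\<^bsub>X\<^esub> \<epsilon>)) = (f x, f (x \<triangleleft>\<^bsub>X\<^esub> \<epsilon>)) \<triangleleft>\<^bsub>coind N\<^esub> r"
    by (simp add: coind_def r(1))
qed

lemma projective_res:
  assumes P: "projective_rmodule E P" "fg_right_module E P"
  shows "projective_rmodule A (res P)"
  unfolding projective_rmodule_def
proof (intro conjI allI ballI impI, goal_cases)
  case 1 show ?case using P(2) by (intro res_module fg_right_moduleD)
next
  case (2 M N g f)
  then have M: "right_module A M" and N: "right_module A N" and g: "g \<in> rhom A M N" "g ` carrier M = carrier N"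
    and f: "f \<in> rhom A (res P) N" by auto
  have rP: "right_module E P" using P(2) by (rule fg_right_moduleD)
  interpret M: right_module A M by fact
  let ?g = "\<lambda>x\<in>carrier (coind M). (g (fst x), g (snd x))"
  have "?g \<in> rhom E (coind M) (coind N)"
    using rhomD(1-3)[OF g(1)]
    by (intro rhom_restrictI coind_module M) (auto simp: coind_def E_simps \<sigma>_simps M.ract_closed)
  moreover have "?g ` carrier (coind M) = carrier (coind N)"
    using map_prod_surj_on[OF g(2) g(2)]
    by (simp add: coind_def map_prod_def case_prod_unfold)
  \<comment> \<open>The coinduced modules have pairs as elements, which is not a type named in
    \<open>projective_rmodule\<close>; this is a use of lifting in arbitrary types.\<close>
  ultimately obtain h where h: "h \<in> rhom E P (coind M)"
    "\<And>x. x \<in> carrier P \<Longrightarrow> ?g (h x) = (\<lambda>x\<in>carrier P. (f x, f (x \<triangleleft>\<^bsub>P\<^esub> \<epsilon>))) x"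
    using projective_lift[OF P coind_module[OF M] coind_module[OF N] _ _ rhom_coind[OF rP N f]] by blast
  have gh: "g (fst (h x)) = f x" if "x \<in> carrier P" for x
    using h(2)[OF that] rhomD(1)[OF h(1) that] that by simp
  \<comment> \<open>The first component is evaluation at 1, the counit of the adjunction; it turns
    the lift over \<open>E\<close> into one over \<open>A\<close>.\<close>
  have "(\<lambda>x\<in>carrier (res P). fst (h x)) \<in> rhom A (res P) M"
  proof (rule rhom_restrictI[OF res_module[OF rP]])
    show "fst (h x) \<in> carrier M" if "x \<in> carrier (res P)" for x
      using rhomD(1)[OF h(1)] that by (simp add: coind_def mem_Times_iff)
    show "fst (h (x \<oplus>\<^bsub>res P\<^esub> y)) = fst (h x) \<oplus>\<^bsub>M\<^esub> fst (h y)"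
      if "x \<in> carrier (res P)" "y \<in> carrier (res P)" for x y
      using rhomD(2)[OF h(1)] that by (simp add: coind_def split_def)
    show "fst (h (x \<triangleleft>\<^bsub>res P\<^esub> a)) = fst (h x) \<triangleleft>\<^bsub>M\<^esub> a"
      if "x \<in> carrier (res P)" "a \<in> carrier A" for x a
      using rhomD(3)[OF h(1), of x "(a, \<zero>)"] rhomD(1)[OF h(1), of x] that
      by (auto simp: coind_def split_def pure_tensor_0 E_simps \<sigma>_zero M.ract_closed)
  qed
  moreover have "compose (carrier (res P)) g (\<lambda>x\<in>carrier (res P). fst (h x)) = f"
    using gh rhomD(4)[OF f] by (intro extensionalityI[where A = "carrier P"]) (auto simp: compose_def)
  ultimately show ?case by blast
qed

text \<open>Restriction changes neither carriers nor maps, so exactness is literally the same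
  statement; the content is that finite generation and projectivity survive.\<close>

lemma resolution_res:
  assumes "resolution E M P d e"
  shows "resolution A (res M) (\<lambda>i. res (P i)) d e"
proof -
  interpret resolution E M P d e by fact
  show ?thesis
  proof (rule resolution.intro)
    show "right_module A (res M)" by (rule res_module[OF M])
    show "fg_right_module A (res (P i))" for i using fg_res_iff[OF P_module] fg by blast
    show "projective_rmodule A (res (P i))" for i by (rule projective_res[OF proj fg])
  qed (use rhom_res[OF d] rhom_res[OF e] e_surj exact_0 exact_Suc in \<open>simp_all add: rkernel_def\<close>)
qed

lemma E_regular: "right_module E (regular_rmodule E)"
  by (rule ring.right_module_regular[OF E_ring])

section \<open>Homs into the dual extension\<close>

text \<open>
  The coinduced module of \<open>A\<close> is \<open>E\<close> itself, so homs into \<open>E\<close> over \<open>E\<close> correspond to homs into \<open>A\<close> over \<open>A\<close>.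
\<close>

lemma rhom_from_dual:
  assumes X: "right_module E X" and f: "f \<in> rhom E X (regular_rmodule E)"
  shows "(\<lambda>x\<in>carrier X. \<sigma> (snd (f x))) \<in> rhom A (res X) (regular_rmodule A)"
proof -
  have "(\<lambda>x\<in>carrier (res X). \<sigma> (snd (f x))) \<in> rhom A (res X) (regular_rmodule A)"
  proof (rule rhom_restrictI[OF res_module[OF X]])
    have fE: "fst (f x) \<in> carrier A" "snd (f x) \<in> carrier A" if "x \<in> carrier X" for x
      using rhomD(1)[OF f that] by (auto simp: regular_rmodule_def E_simps)
    show "\<sigma> (snd (f x)) \<in> carrier (regular_rmodule A)" if "x \<in> carrier (res X)" for x
      using fE that by (simp add: regular_rmodule_def \<sigma>_simps)
    show "\<sigma> (snd (f (x \<oplus>\<^bsub>res X\<^esub> y))) = \<sigma> (snd (f x)) \<oplus>\<^bsub>regular_rmodule A\<^esub> \<sigma> (snd (f y))"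
      if "x \<in> carrier (res X)" "y \<in> carrier (res X)" for x y
      using rhomD(2)[OF f, of x y] fE[of x] fE[of y] that
      by (simp add: regular_rmodule_def dual_ext_def split_def \<sigma>_simps)
    show "\<sigma> (snd (f (x \<triangleleft>\<^bsub>res X\<^esub> a))) = \<sigma> (snd (f x)) \<triangleleft>\<^bsub>regular_rmodule A\<^esub> a"
      if "x \<in> carrier (res X)" "a \<in> carrier A" for x a
      using rhomD(3)[OF f, of x "(a, \<zero>)"] fE[of x] that
      by (simp add: regular_rmodule_def pure_tensor_0 dual_ext_def split_def \<sigma>_simps)
  qed
  then show ?thesis by simp
qed

lemma rhom_to_dual:
  assumes X: "right_module E X" and g: "g \<in> rhom A (res X) (regular_rmodule A)"
  shows "(\<lambda>x\<in>carrier X. (\<sigma> (g (x \<triangleleft>\<^bsub>X\<^esub> \<epsilon>)), \<sigma> (g x))) \<in> rhom E X (regular_rmodule E)"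
proof -
  let ?h = "\<lambda>x\<in>carrier X. (g x, g (x \<triangleleft>\<^bsub>X\<^esub> \<epsilon>))"
  have h: "?h \<in> rhom E X (coind (regular_rmodule A))"
    by (rule rhom_coind[OF X A.right_module_regular g])
  \<comment> \<open>The isomorphism from the coinduced module of \<open>A\<close> to
    \<open>E\<close>. The swap is forced: in \<open>E\<close> the \<epsilon>-coefficient absorbs the
    other one under multiplication by \<epsilon>, whereas in the coinduced module the first
    component absorbs the second.\<close>
  let ?i = "\<lambda>y\<in>carrier (coind (regular_rmodule A)). (\<sigma> (snd y), \<sigma> (fst y))"
  have i: "?i \<in> rhom E (coind (regular_rmodule A)) (regular_rmodule E)"
    by (rule rhom_restrictI[OF coind_module[OF A.right_module_regular]])
      (auto simp: coind_def regular_rmodule_def E_simps \<sigma>_simps A.a_ac)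
  have "compose (carrier X) ?i ?h = (\<lambda>x\<in>carrier X. (\<sigma> (g (x \<triangleleft>\<^bsub>X\<^esub> \<epsilon>)), \<sigma> (g x)))"
    using rhomD(1)[OF h] by (intro extensionalityI[where A = "carrier X"]) (auto simp: compose_def)
  then show ?thesis using rhom_compose[OF X h i] by simp
qed

text \<open>Multiplying \<open>f x\<close> by \<epsilon> moves its first component to the
  \<epsilon>-place, so linearity recovers \<open>f\<close> from its \<epsilon>-coefficient
  alone.\<close>

lemma dual_hom_eq:
  assumes X: "right_module E X" and f: "f \<in> rhom E X (regular_rmodule E)" and x: "x \<in> carrier X"
  shows "f x = (snd (f (x \<triangleleft>\<^bsub>X\<^esub> \<epsilon>)), snd (f x))"
proof -
  have "f (x \<triangleleft>\<^bsub>X\<^esub> \<epsilon>) = f x \<otimes>\<^bsub>E\<^esub> \<epsilon>" using rhomD(3)[OF f x, of \<epsilon>] by (simp add: regular_rmodule_def E_simps)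
  moreover have "fst (f x) \<in> carrier A" "snd (f x) \<in> carrier A"
    using rhomD(1)[OF f x] by (auto simp: regular_rmodule_def E_simps)
  ultimately show ?thesis by (cases "f x") (simp add: E_simps \<sigma>_zero)
qed

text \<open>The two translations of homs are natural in the module: they commute with composition by
  the \<open>E\<close>-linear differentials. Hence cocycles correspond to cocycles and a bounding
  hom on one side yields one on the other.\<close>

lemma hom_exact_res_iff:
  assumes "resolution E M P d e"
  shows "resolution.hom_exact E P d (regular_rmodule E)
    \<longleftrightarrow> resolution.hom_exact A (\<lambda>i. res (P i)) d (regular_rmodule A)"
proof -
  interpret E: resolution E M P d e by fact
  interpret A': resolution A "res M" "\<lambda>i. res (P i)" d e by (rule resolution_res[OF assms])
  have \<epsilon>E: "\<epsilon> \<in> carrier E" by (simp add: E_simps)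
  have \<epsilon>cl: "x \<triangleleft>\<^bsub>P i\<^esub> \<epsilon> \<in> carrier (P i)" if "x \<in> carrier (P i)" for x i
    using right_module.ract_closed[OF E.P_module that \<epsilon>E] .
  have d\<epsilon>: "d i (x \<triangleleft>\<^bsub>P (Suc i)\<^esub> \<epsilon>) = d i x \<triangleleft>\<^bsub>P i\<^esub> \<epsilon>" if "x \<in> carrier (P (Suc i))" for x i
    by (rule rhomD(3)[OF E.d that \<epsilon>E])
  note dcl = rhomD(1)[OF E.d]
  have z: "\<zero>\<^bsub>regular_rmodule E\<^esub> = (\<zero>, \<zero>)" "\<zero>\<^bsub>regular_rmodule A\<^esub> = \<zero>"
    by (simp_all add: regular_rmodule_def E_simps)
  show ?thesis
  proof
    assume ex: "E.hom_exact (regular_rmodule E)"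
    show "A'.hom_exact (regular_rmodule A)"
      unfolding A'.hom_exact_def
    proof (intro allI ballI impI)
      fix i f assume f: "f \<in> rhom A (res (P (Suc i))) (regular_rmodule A)"
        and 0: "\<forall>x\<in>carrier (res (P (Suc (Suc i)))). f (d (Suc i) x) = \<zero>\<^bsub>regular_rmodule A\<^esub>"
      let ?F = "\<lambda>x\<in>carrier (P (Suc i)). (\<sigma> (f (x \<triangleleft>\<^bsub>P (Suc i)\<^esub> \<epsilon>)), \<sigma> (f x))"
      have F: "?F \<in> rhom E (P (Suc i)) (regular_rmodule E)" by (rule rhom_to_dual[OF E.P_module f])
      \<comment> \<open>Both components vanish, since \<open>d\<close> commutes with \<epsilon> and
        \<open>f\<close> kills the image of \<open>d\<close>.\<close>
      have "?F (d (Suc i) x) = \<zero>\<^bsub>regular_rmodule E\<^esub>" if "x \<in> carrier (P (Suc (Suc i)))" for x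
        using that 0 \<epsilon>cl[OF that] dcl[OF that] by (simp add: d\<epsilon>[symmetric] z \<sigma>_zero)
      then obtain V where V: "V \<in> rhom E (P i) (regular_rmodule E)"
        "\<And>x. x \<in> carrier (P (Suc i)) \<Longrightarrow> ?F x = V (d i x)"
        using ex F unfolding E.hom_exact_def by blast
      have "f x = (\<lambda>x\<in>carrier (P i). \<sigma> (snd (V x))) (d i x)" if "x \<in> carrier (P (Suc i))" for x
      proof -
        have "f x \<in> carrier A" using rhomD(1)[OF f] that by (simp add: regular_rmodule_def)
        then have "\<sigma> (snd (?F x)) = f x" using that by (simp add: \<sigma>_simps)
        then show ?thesis using V(2)[OF that] dcl[OF that] by simp
      qed
      then show "\<exists>v\<in>rhom A (res (P i)) (regular_rmodule A). \<forall>x\<in>carrier (res (P (Suc i))). f x = v (d i x)"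
        using rhom_from_dual[OF E.P_module V(1)] by (intro bexI) auto
    qed
  next
    assume ex: "A'.hom_exact (regular_rmodule A)"
    show "E.hom_exact (regular_rmodule E)"
      unfolding E.hom_exact_def
    proof (intro allI ballI impI)
      fix i F assume F: "F \<in> rhom E (P (Suc i)) (regular_rmodule E)"
        and 0: "\<forall>x\<in>carrier (P (Suc (Suc i))). F (d (Suc i) x) = \<zero>\<^bsub>regular_rmodule E\<^esub>"
      let ?f = "\<lambda>x\<in>carrier (P (Suc i)). \<sigma> (snd (F x))"
      have f: "?f \<in> rhom A (res (P (Suc i))) (regular_rmodule A)" by (rule rhom_from_dual[OF E.P_module F])
      have "?f (d (Suc i) x) = \<zero>\<^bsub>regular_rmodule A\<^esub>" if "x \<in> carrier (P (Suc (Suc i)))" for x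
        using that 0 dcl[OF that] by (simp add: z \<sigma>_zero)
      then obtain v where v: "v \<in> rhom A (res (P i)) (regular_rmodule A)"
        "\<And>x. x \<in> carrier (P (Suc i)) \<Longrightarrow> ?f x = v (d i x)"
        using ex[unfolded A'.hom_exact_def, rule_format, OF f] by auto
      have "F x = (\<lambda>x\<in>carrier (P i). (\<sigma> (v (x \<triangleleft>\<^bsub>P i\<^esub> \<epsilon>)), \<sigma> (v x))) (d i x)"
        if x: "x \<in> carrier (P (Suc i))" for x
      proof -
        have s: "\<sigma> (v (d i y)) = snd (F y)" if "y \<in> carrier (P (Suc i))" for y
          using v(2)[OF that, symmetric] that rhomD(1)[OF F that] by (auto simp: regular_rmodule_def E_simps \<sigma>_simps)
        show ?thesis
          using dual_hom_eq[OF E.P_module F x] s[OF x] s[OF \<epsilon>cl[OF x]] dcl[OF x] by (simp add: d\<epsilon>[OF x])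
      qed
      then show "\<exists>v\<in>rhom E (P i) (regular_rmodule E). \<forall>x\<in>carrier (P (Suc i)). F x = v (d i x)"
        using rhom_to_dual[OF E.P_module v(1)] by blast
    qed
  qed
qed

end

section \<open>Noetherian rings and resolutions\<close>

text \<open>Only submodules of the modules \<open>R^n\<close> are mentioned: these are the kernels
  that occur when a free resolution is built.\<close>

definition right_noetherian :: "('a, 'b) ring_scheme \<Rightarrow> bool" where
  "right_noetherian R \<longleftrightarrow> (\<forall>(n :: nat) W. submodule_of R (free_rmodule R {..<n}) W
     \<longrightarrow> fg_right_module R (free_rmodule R {..<n}\<lparr>carrier := W\<rparr>))"

text \<open>Each kernel is finitely generated and is covered by a new free module. The recursion
  runs over pairs of a rank and a submodule, the kernel still to be covered; such pairs have one
  fixed type, and the differentials are chosen afterwards.\<close>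

lemma proj_resolution_exists:
  assumes R: "ring R" "right_noetherian R" and M: "fg_right_module R (M :: ('a, 'm) rmodule)"
  obtains P d e where "proj_resolution R M P d e"
proof -
  let ?F = "\<lambda>n :: nat. free_rmodule R {..<n}"
  have F: "right_module R (?F n)" for n by (rule right_module_free[OF R(1)])
  have rM: "right_module R M" using M by (rule fg_right_moduleD)
  obtain n0 :: nat and e where e: "e \<in> rhom R (?F n0) M" "e ` carrier (?F n0) = carrier M" by (rule fg_cover[OF M])
  \<comment> \<open>Admissible transitions: some hom between the free modules of ranks
    \<open>fst y\<close> and \<open>fst x\<close> has image \<open>snd x\<close> and kernel
    \<open>snd y\<close>.\<close>
  let ?Q = "\<lambda>x y. \<exists>f\<in>rhom R (?F (fst y)) (?F (fst x)). f ` carrier (?F (fst y)) = snd x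
      \<and> snd y = rkernel (?F (fst y)) (?F (fst x)) f"
  have "\<exists>s. \<forall>i. (submodule_of R (?F (fst (s i))) (snd (s i)) \<and> (i = 0 \<longrightarrow> s i = (n0, rkernel (?F n0) M e)))
      \<and> ?Q (s i) (s (Suc i))"
  proof (rule dependent_nat_choice)
    show "\<exists>x. submodule_of R (?F (fst x)) (snd x) \<and> ((0::nat) = 0 \<longrightarrow> x = (n0, rkernel (?F n0) M e))"
      using submodule_of_rkernel[OF F rM e(1)] by auto
  next
    fix x :: "nat \<times> (nat \<Rightarrow> 'a) set" and i :: nat
    assume x: "submodule_of R (?F (fst x)) (snd x) \<and> (i = 0 \<longrightarrow> x = (n0, rkernel (?F n0) M e))"
    let ?W = "?F (fst x)\<lparr>carrier := snd x\<rparr>"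
    have W: "fg_right_module R ?W" using R(2) x unfolding right_noetherian_def by blast
    obtain n :: nat and f where f: "f \<in> rhom R (?F n) ?W" "f ` carrier (?F n) = carrier ?W"
      by (rule fg_cover[OF W])
    have f': "f \<in> rhom R (?F n) (?F (fst x))"
      using conjunct1[OF x] by (intro rhom_from_submodule_into[OF f(1)]) (simp add: submodule_of_def)
    have "f ` carrier (?F n) = snd x" using f(2) by simp
    then have "?Q x (n, rkernel (?F n) (?F (fst x)) f)"
      unfolding fst_conv snd_conv using f' by blast
    then show "\<exists>y. (submodule_of R (?F (fst y)) (snd y) \<and> (Suc i = 0 \<longrightarrow> y = (n0, rkernel (?F n0) M e))) \<and> ?Q x y"
      using submodule_of_rkernel[OF F F f']
      by (intro exI[of _ "(n, rkernel (?F n) (?F (fst x)) f)"]) simp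
  qed
  then obtain s where s: "\<And>i. i = 0 \<longrightarrow> s i = (n0, rkernel (?F n0) M e)" "\<And>i. ?Q (s i) (s (Suc i))"
    by auto
  have s0: "s 0 = (n0, rkernel (?F n0) M e)" using s(1)[of 0] by simp
  have "\<exists>d. \<forall>i. d i \<in> rhom R (?F (fst (s (Suc i)))) (?F (fst (s i)))
      \<and> d i ` carrier (?F (fst (s (Suc i)))) = snd (s i)
      \<and> snd (s (Suc i)) = rkernel (?F (fst (s (Suc i)))) (?F (fst (s i))) (d i)"
    by (rule choice) (use s(2) in \<open>simp add: Bex_def\<close>)
  then obtain d where d': "\<And>i. d i \<in> rhom R (?F (fst (s (Suc i)))) (?F (fst (s i)))
      \<and> d i ` carrier (?F (fst (s (Suc i)))) = snd (s i)
      \<and> snd (s (Suc i)) = rkernel (?F (fst (s (Suc i)))) (?F (fst (s i))) (d i)"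
    by (elim exE) (rule that, erule spec)
  note d = d'[THEN conjunct1] d'[THEN conjunct2, THEN conjunct1] d'[THEN conjunct2, THEN conjunct2]
  have "proj_resolution R M (\<lambda>i. ?F (fst (s i))) d e"
    unfolding proj_resolution_def
  proof (intro conjI allI)
    show "fg_right_module R (?F (fst (s i)))" for i by (intro fg_free_rmodule R(1)) simp
    show "projective_rmodule R (?F (fst (s i)))" for i by (intro projective_free_rmodule R(1)) simp
    show "d i \<in> rhom R (?F (fst (s (Suc i)))) (?F (fst (s i)))" for i by (rule d(1))
    show "e \<in> rhom R (?F (fst (s 0))) M" "e ` carrier (?F (fst (s 0))) = carrier M"
      using e by (simp_all add: s0)
    show "d 0 ` carrier (?F (fst (s (Suc 0)))) = rkernel (?F (fst (s 0))) M e"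
      unfolding d(2) by (simp add: s0)
    show "d (Suc i) ` carrier (?F (fst (s (Suc (Suc i)))))
        = rkernel (?F (fst (s (Suc i)))) (?F (fst (s i))) (d i)" for i
      unfolding d(2) by (rule d(3))
  qed
  then show ?thesis by (rule that)
qed

section \<open>Spans, and subspaces over a division ring\<close>

definition rspan :: "('a, 'b) ring_scheme \<Rightarrow> ('a, 'm) rmodule \<Rightarrow> 'm set \<Rightarrow> 'm set" where
  "rspan R M S = \<Inter>{W. submodule_of R M W \<and> S \<subseteq> W}"

lemma subset_rspan: "S \<subseteq> rspan R M S"
  by (auto simp: rspan_def)

lemma rspan_least: "submodule_of R M W \<Longrightarrow> S \<subseteq> W \<Longrightarrow> rspan R M S \<subseteq> W"
  by (auto simp: rspan_def)

lemma submodule_of_rspan: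
  assumes "right_module R M" "S \<subseteq> carrier M" shows "submodule_of R M (rspan R M S)"
  using submodule_of_carrier[OF assms(1)] assms(2) unfolding submodule_of_def rspan_def by blast

lemma rspan_mono: "S \<subseteq> T \<Longrightarrow> rspan R M S \<subseteq> rspan R M T"
  unfolding rspan_def by blast

lemma generates_rspan:
  assumes "right_module R M" "generates R M S"
  shows "rspan R M S = carrier M"
  using assms(2) submodule_of_rspan[OF assms(1)] subset_rspan[of S R M] by (simp add: generates_def)

text \<open>The elements of the required form make up a submodule that contains \<open>u\<close> and
  \<open>S\<close>.\<close>

lemma rspan_insert:
  assumes V: "right_module R V" and S: "S \<subseteq> carrier V" and u: "u \<in> carrier V"
    and x: "x \<in> rspan R V (insert u S)"
  obtains c w where "c \<in> carrier R" "w \<in> rspan R V S" "x = u \<triangleleft>\<^bsub>V\<^esub> c \<oplus>\<^bsub>V\<^esub> w"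
proof -
  interpret right_module R V by fact
  let ?H = "rspan R V S"
  let ?W = "{u \<triangleleft>\<^bsub>V\<^esub> c \<oplus>\<^bsub>V\<^esub> w | c w. c \<in> carrier R \<and> w \<in> ?H}"
  note H = submodule_of_rspan[OF V S, unfolded submodule_of_def]
  have Hc: "w \<in> carrier V" if "w \<in> ?H" for w using H that by blast
  have "submodule_of R V ?W"
    unfolding submodule_of_def
  proof (intro conjI ballI)
    show "?W \<subseteq> carrier V" using u Hc by (auto intro!: ract_closed M.a_closed)
    show "\<zero>\<^bsub>V\<^esub> \<in> ?W" using u H by (intro CollectI exI[of _ "\<zero>\<^bsub>R\<^esub>"] exI[of _ "\<zero>\<^bsub>V\<^esub>"]) auto
  next
    fix y y' assume "y \<in> ?W" "y' \<in> ?W"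
    then obtain c w c' w' where y: "c \<in> carrier R" "w \<in> ?H" "y = u \<triangleleft>\<^bsub>V\<^esub> c \<oplus>\<^bsub>V\<^esub> w"
      "c' \<in> carrier R" "w' \<in> ?H" "y' = u \<triangleleft>\<^bsub>V\<^esub> c' \<oplus>\<^bsub>V\<^esub> w'" by blast
    have "y \<oplus>\<^bsub>V\<^esub> y' = u \<triangleleft>\<^bsub>V\<^esub> (c \<oplus>\<^bsub>R\<^esub> c') \<oplus>\<^bsub>V\<^esub> (w \<oplus>\<^bsub>V\<^esub> w')"
      using y u Hc by (simp add: ract_add_right ract_closed M.a_ac)
    then show "y \<oplus>\<^bsub>V\<^esub> y' \<in> ?W" using y H by blast
  next
    fix y a assume "y \<in> ?W" and a: "a \<in> carrier R"
    then obtain c w where y: "c \<in> carrier R" "w \<in> ?H" "y = u \<triangleleft>\<^bsub>V\<^esub> c \<oplus>\<^bsub>V\<^esub> w" by blast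
    have "y \<triangleleft>\<^bsub>V\<^esub> a = u \<triangleleft>\<^bsub>V\<^esub> (c \<otimes>\<^bsub>R\<^esub> a) \<oplus>\<^bsub>V\<^esub> w \<triangleleft>\<^bsub>V\<^esub> a"
      using y u a Hc by (simp add: ract_add_left ract_assoc ract_closed)
    then show "y \<triangleleft>\<^bsub>V\<^esub> a \<in> ?W" using y a H R.m_closed by blast
  qed
  moreover have "insert u S \<subseteq> ?W"
  proof (intro insert_subsetI subsetI CollectI)
    show "\<exists>c w. u = u \<triangleleft>\<^bsub>V\<^esub> c \<oplus>\<^bsub>V\<^esub> w \<and> c \<in> carrier R \<and> w \<in> ?H"
      using u H by (intro exI[of _ "\<one>\<^bsub>R\<^esub>"] exI[of _ "\<zero>\<^bsub>V\<^esub>"]) (simp add: ract_one)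
    show "\<exists>c w. s = u \<triangleleft>\<^bsub>V\<^esub> c \<oplus>\<^bsub>V\<^esub> w \<and> c \<in> carrier R \<and> w \<in> ?H" if "s \<in> S" for s
      using u that S subset_rspan[of S R V] by (intro exI[of _ "\<zero>\<^bsub>R\<^esub>"] exI[of _ s]) auto
  qed
  ultimately have "x \<in> ?W" using x rspan_least by blast
  then show ?thesis using that by blast
qed

text \<open>Gaussian elimination by induction on \<open>S\<close>. Besides the intersection of
  \<open>N\<close> with the span of the remaining vectors, at most one further vector
  \<open>n0\<close> is required: its coefficient at \<open>u\<close> is invertible and clears that
  of every other element of \<open>N\<close>.\<close>

lemma subspace_finitely_spanned:
  assumes inv: "\<And>c. c \<in> carrier R \<Longrightarrow> c \<noteq> \<zero>\<^bsub>R\<^esub> \<Longrightarrow> \<exists>b\<in>carrier R. c \<otimes>\<^bsub>R\<^esub> b = \<one>\<^bsub>R\<^esub>"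
    and V: "right_module R V" and S: "finite S" "S \<subseteq> carrier V"
    and N: "submodule_of R V N" "N \<subseteq> rspan R V S"
  obtains T where "finite T" "T \<subseteq> N" "N \<subseteq> rspan R V T"
proof -
  interpret right_module R V by fact
  have "\<exists>T. finite T \<and> T \<subseteq> N \<and> N \<subseteq> rspan R V T" using S N
  proof (induction S arbitrary: N)
    case empty
    then show ?case by blast
  next
    case (insert u S)
    let ?H = "rspan R V S"
    have SV: "S \<subseteq> carrier V" "u \<in> carrier V" using insert.prems by auto
    note H = submodule_of_rspan[OF V SV(1)]
    note Hd = H[unfolded submodule_of_def] and Nd = insert.prems(2)[unfolded submodule_of_def]
    have "submodule_of R V (N \<inter> ?H)" using Hd Nd by (auto simp: submodule_of_def)
    then obtain T where T: "finite T" "T \<subseteq> N \<inter> ?H" "N \<inter> ?H \<subseteq> rspan R V T"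
      using insert.IH[OF SV(1), of "N \<inter> ?H"] by blast
    show ?case
    proof (cases "N \<subseteq> ?H")
      case True
      then show ?thesis using T by blast
    next
      case False
      then obtain n0 where n0: "n0 \<in> N" "n0 \<notin> ?H" by blast
      have n0V: "n0 \<in> carrier V" using n0(1) Nd by blast
      obtain c w where c: "c \<in> carrier R" "w \<in> ?H" "n0 = u \<triangleleft>\<^bsub>V\<^esub> c \<oplus>\<^bsub>V\<^esub> w"
        using rspan_insert[OF V SV] insert.prems(3) n0(1) by blast
      have wV: "w \<in> carrier V" using c(2) Hd by blast
      have "c \<noteq> \<zero>\<^bsub>R\<^esub>" using c n0(2) SV(2) wV by auto
      then obtain b where b: "b \<in> carrier R" "c \<otimes>\<^bsub>R\<^esub> b = \<one>\<^bsub>R\<^esub>" using inv[OF c(1)] by blast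
      let ?T = "insert n0 T"
      have TV: "?T \<subseteq> carrier V" using n0V T(2) Nd by blast
      note HT = submodule_of_rspan[OF V TV, unfolded submodule_of_def]
      have "n \<in> rspan R V ?T" if n: "n \<in> N" for n
      proof -
        obtain c' w' where c': "c' \<in> carrier R" "w' \<in> ?H" "n = u \<triangleleft>\<^bsub>V\<^esub> c' \<oplus>\<^bsub>V\<^esub> w'"
          using rspan_insert[OF V SV] insert.prems(3) n by blast
        have nV: "n \<in> carrier V" "w' \<in> carrier V" using n Nd c'(2) Hd by blast+
        \<comment> \<open>With \<open>c b = 1\<close>, this multiple of \<open>n0\<close> has the
          same coefficient \<open>c'\<close> at \<open>u\<close> as \<open>n\<close>, so the
          difference lies in the span of \<open>S\<close>.\<close>
        let ?y = "n0 \<triangleleft>\<^bsub>V\<^esub> (b \<otimes>\<^bsub>R\<^esub> c')"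
        have "c \<otimes>\<^bsub>R\<^esub> (b \<otimes>\<^bsub>R\<^esub> c') = c'" using b c c' by (simp add: R.m_assoc[symmetric])
        then have y: "?y = u \<triangleleft>\<^bsub>V\<^esub> c' \<oplus>\<^bsub>V\<^esub> w \<triangleleft>\<^bsub>V\<^esub> (b \<otimes>\<^bsub>R\<^esub> c')"
          using b c c' wV SV(2) ract_assoc[of u c "b \<otimes>\<^bsub>R\<^esub> c'"] by (simp add: ract_add_left ract_closed)
        have wy: "w \<triangleleft>\<^bsub>V\<^esub> (b \<otimes>\<^bsub>R\<^esub> c') \<in> ?H" using Hd c(2) b(1) c'(1) by simp
        have yV: "?y \<in> carrier V" using n0V b(1) c'(1) by (simp add: ract_closed)
        have "n \<oplus>\<^bsub>V\<^esub> \<ominus>\<^bsub>V\<^esub> ?y = w' \<oplus>\<^bsub>V\<^esub> \<ominus>\<^bsub>V\<^esub> (w \<triangleleft>\<^bsub>V\<^esub> (b \<otimes>\<^bsub>R\<^esub> c'))"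
        proof -
          have "u \<triangleleft>\<^bsub>V\<^esub> c' \<in> carrier V" "w \<triangleleft>\<^bsub>V\<^esub> (b \<otimes>\<^bsub>R\<^esub> c') \<in> carrier V"
            using SV(2) wV b(1) c'(1) by (simp_all add: ract_closed)
          then show ?thesis
            unfolding y c'(3) using nV(2)
            by (simp add: M.minus_add M.a_ac M.r_neg1 M.r_neg2)
        qed
        also have "\<dots> \<in> ?H" using c'(2) wy submodule_of_minus[OF V H] Hd by blast
        finally have "n \<oplus>\<^bsub>V\<^esub> \<ominus>\<^bsub>V\<^esub> ?y \<in> ?H" .
        moreover have "?y \<in> N" using n0(1) Nd b(1) c'(1) by simp
        then have "n \<oplus>\<^bsub>V\<^esub> \<ominus>\<^bsub>V\<^esub> ?y \<in> N" using n submodule_of_minus[OF V insert.prems(2)] Nd by blast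
        ultimately have "n \<oplus>\<^bsub>V\<^esub> \<ominus>\<^bsub>V\<^esub> ?y \<in> rspan R V ?T"
          using T(3) rspan_mono[of T ?T R V] by blast
        moreover have "?y \<in> rspan R V ?T" using HT subset_rspan[of ?T R V] b(1) c'(1) by simp
        ultimately have "(n \<oplus>\<^bsub>V\<^esub> \<ominus>\<^bsub>V\<^esub> ?y) \<oplus>\<^bsub>V\<^esub> ?y \<in> rspan R V ?T" using HT by blast
        then show ?thesis using nV yV by (simp add: M.a_assoc M.l_neg)
      qed
      then show ?thesis using T n0(1) by (intro exI[of _ ?T]) auto
    qed
  qed
  then show ?thesis using that by blast
qed

text \<open>The products of generators of \<open>M\<close> over \<open>S\<close> with generators of
  \<open>S\<close> over \<open>R\<close> generate \<open>M\<close> over \<open>R\<close>.\<close>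

lemma fg_restrict_scalars:
  assumes "ring R" and \<phi>: "\<phi> \<in> ring_hom R S" and reg: "fg_right_module R (restrict_scalars \<phi> (regular_rmodule S))"
    and M: "fg_right_module S M"
  shows "fg_right_module R (restrict_scalars \<phi> M)"
proof -
  have rM: "right_module S M" using M by (rule fg_right_moduleD)
  interpret M: right_module S M by fact
  obtain U where U: "finite U" "generates R (restrict_scalars \<phi> (regular_rmodule S)) U"
    using reg unfolding fg_right_module_iff by blast
  obtain T where T: "finite T" "generates S M T" using M unfolding fg_right_module_iff by blast
  have UT: "U \<subseteq> carrier S" "T \<subseteq> carrier M" using U(2) T(2) by (auto simp: generates_def regular_rmodule_def)
  let ?G = "(\<lambda>(t, u). t \<triangleleft>\<^bsub>M\<^esub> u) ` (T \<times> U)"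
  have "generates R (restrict_scalars \<phi> M) ?G"
    unfolding generates_def
  proof (intro conjI allI impI)
    show "?G \<subseteq> carrier (restrict_scalars \<phi> M)" using UT by (auto intro!: M.ract_closed)
    fix W assume W: "submodule_of R (restrict_scalars \<phi> M) W \<and> ?G \<subseteq> W"
    then have Wd: "W \<subseteq> carrier M" "\<zero>\<^bsub>M\<^esub> \<in> W" "\<And>x y. x \<in> W \<Longrightarrow> y \<in> W \<Longrightarrow> x \<oplus>\<^bsub>M\<^esub> y \<in> W"
      "\<And>x a. x \<in> W \<Longrightarrow> a \<in> carrier R \<Longrightarrow> x \<triangleleft>\<^bsub>M\<^esub> \<phi> a \<in> W"
      by (auto simp: submodule_of_def)
    have tW: "t \<triangleleft>\<^bsub>M\<^esub> a \<in> W" if t: "t \<in> T" and a: "a \<in> carrier S" for t a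
    proof -
      have tM: "t \<in> carrier M" using t UT by blast
      have "submodule_of R (restrict_scalars \<phi> (regular_rmodule S)) {a \<in> carrier S. t \<triangleleft>\<^bsub>M\<^esub> a \<in> W}"
        using tM Wd ring_hom_closed[OF \<phi>]
        by (auto simp: submodule_of_def regular_rmodule_def M.ract_add_right M.ract_assoc)
      moreover have "U \<subseteq> {a \<in> carrier S. t \<triangleleft>\<^bsub>M\<^esub> a \<in> W}" using W t UT by auto
      ultimately have "{a \<in> carrier S. t \<triangleleft>\<^bsub>M\<^esub> a \<in> W} = carrier S"
        using U(2) by (simp add: generates_def regular_rmodule_def)
      then show ?thesis using a by blast
    qed
    \<comment> \<open>The largest \<open>S\<close>-submodule inside \<open>W\<close>; by
      \<open>tW\<close> it contains the generators \<open>T\<close>.\<close>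
    let ?V = "{x \<in> carrier M. \<forall>a\<in>carrier S. x \<triangleleft>\<^bsub>M\<^esub> a \<in> W}"
    have "submodule_of S M ?V"
      using Wd by (auto simp: submodule_of_def M.ract_closed M.ract_add_left M.ract_assoc[symmetric])
    moreover have "T \<subseteq> ?V" using tW subsetD[OF UT(2)] by (intro subsetI CollectI conjI ballI)
    ultimately have V: "?V = carrier M" using T(2) unfolding generates_def by blast
    have "x \<in> W" if "x \<in> carrier M" for x
    proof -
      have "x \<triangleleft>\<^bsub>M\<^esub> \<one>\<^bsub>S\<^esub> \<in> W" using V that M.R.one_closed by blast
      then show ?thesis using that by (simp add: M.ract_one)
    qed
    then show "W = carrier (restrict_scalars \<phi> M)" using Wd(1) by auto
  qed
  moreover have "finite ?G" using U(1) T(1) by simp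
  ultimately show ?thesis
    using right_module_restrict_scalars[OF assms(1) \<phi> rM] unfolding fg_right_module_iff by blast
qed

text \<open>A submodule of \<open>R^n\<close> is a subspace of a finitely spanned space over
  \<open>K\<close>, and a finite spanning set over \<open>K\<close> also generates over
  \<open>R\<close>.\<close>

lemma right_noetherian_of_field:
  assumes K: "ring K" and inv: "\<And>c. c \<in> carrier K \<Longrightarrow> c \<noteq> \<zero>\<^bsub>K\<^esub> \<Longrightarrow> \<exists>b\<in>carrier K. c \<otimes>\<^bsub>K\<^esub> b = \<one>\<^bsub>K\<^esub>"
    and R: "ring R" and \<phi>: "\<phi> \<in> ring_hom K R"
    and fin: "fg_right_module K (restrict_scalars \<phi> (regular_rmodule R))"
  shows "right_noetherian R"
  unfolding right_noetherian_def
proof (intro allI impI)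
  fix n :: nat and W
  let ?F = "free_rmodule R {..<n}"
  assume W: "submodule_of R ?F W"
  have F: "fg_right_module R ?F" by (intro fg_free_rmodule R) simp
  then have rF: "right_module R ?F" by (rule fg_right_moduleD)
  let ?V = "restrict_scalars \<phi> ?F"
  have V: "fg_right_module K ?V" by (rule fg_restrict_scalars[OF K \<phi> fin F])
  then have rV: "right_module K ?V" by (rule fg_right_moduleD)
  obtain S where S: "finite S" "generates K ?V S" using V unfolding fg_right_module_iff by blast
  then have SV: "S \<subseteq> carrier ?V" "rspan K ?V S = carrier ?V"
    using generates_rspan[OF rV] by (simp_all add: generates_def)
  have KW: "submodule_of K ?V W" by (rule submodule_of_restrict_scalars[OF \<phi> W])
  then have "W \<subseteq> rspan K ?V S" using SV(2) by (simp add: submodule_of_def)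
  then obtain T where T: "finite T" "T \<subseteq> W" "W \<subseteq> rspan K ?V T"
    using subspace_finitely_spanned[OF inv rV S(1) SV(1) KW] by blast
  have rW: "right_module R (?F\<lparr>carrier := W\<rparr>)" by (rule right_module_submodule[OF rF W])
  have "generates R (?F\<lparr>carrier := W\<rparr>) T"
    unfolding generates_def
  proof (intro conjI allI impI)
    show "T \<subseteq> carrier (?F\<lparr>carrier := W\<rparr>)" using T(2) by simp
    fix X assume X: "submodule_of R (?F\<lparr>carrier := W\<rparr>) X \<and> T \<subseteq> X"
    then have XW: "X \<subseteq> W" by (simp add: submodule_of_def)
    have "submodule_of R ?F X" using X W by (auto simp: submodule_of_def)
    then have "rspan K ?V T \<subseteq> X" using X by (intro rspan_least submodule_of_restrict_scalars[OF \<phi>]) auto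
    then show "X = carrier (?F\<lparr>carrier := W\<rparr>)" using T(3) XW by auto
  qed
  then show "fg_right_module R (?F\<lparr>carrier := W\<rparr>)" using rW T(1) unfolding fg_right_module_iff by blast
qed


section \<open>Vanishing of Ext\<close>

text \<open>If the quotient is trivial, every coset equals \<open>H\<close>; as \<open>H\<close>
  contains the unit, each \<open>x\<close> lies in its own coset and so in \<open>H\<close>.\<close>

lemma trivial_group_Mod_iff:
  assumes "comm_group G" "H \<subseteq> carrier G" "\<one>\<^bsub>G\<^esub> \<in> H"
  shows "trivial_group (G Mod H) \<longleftrightarrow> H = carrier G"
proof
  interpret comm_group G by fact
  assume "trivial_group (G Mod H)"
  then have "carrier (G Mod H) = {H}" by (simp add: trivial_group_def FactGroup_def)
  then have "H #>\<^bsub>G\<^esub> x = H" if "x \<in> carrier G" for x using that by (auto simp: carrier_FactGroup)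
  moreover have "x \<in> H #>\<^bsub>G\<^esub> x" if "x \<in> carrier G" for x
    using assms(3) that by (auto simp: r_coset_def intro!: bexI[of _ "\<one>\<^bsub>G\<^esub>"])
  ultimately show "H = carrier G" using assms(2) by blast
next
  interpret comm_group G by fact
  assume H: "H = carrier G"
  have "H \<lhd> G" unfolding H by (intro subgroup_imp_normal subgroup_self)
  then have "group (G Mod H)" by (rule normal.factorgroup_is_group)
  moreover have "H #>\<^bsub>G\<^esub> x = H" if "x \<in> carrier G" for x
    using coset_join2[OF that subgroup_self that] H by simp
  then have "carrier (G Mod H) = {\<one>\<^bsub>G Mod H\<^esub>}"
    using one_closed by (auto simp: carrier_FactGroup simp del: one_closed)
  ultimately show "trivial_group (G Mod H)" by (simp add: trivial_group_def)
qed

text \<open>Cocycles form a commutative group under pointwise addition. Since homs are extensional,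
  being a coboundary is a pointwise condition on the carrier.\<close>

lemma (in resolution) trivial_cohomology_iff:
  assumes N: "right_module R N"
  shows "trivial_group (\<lparr>carrier = ext_cocycles R P d N (Suc i),
        monoid.mult = (\<lambda>f g. \<lambda>x\<in>carrier (P (Suc i)). f x \<oplus>\<^bsub>N\<^esub> g x),
        one = (\<lambda>x\<in>carrier (P (Suc i)). \<zero>\<^bsub>N\<^esub>)\<rparr> Mod ext_coboundaries R P d N (Suc i))
    \<longleftrightarrow> (\<forall>f\<in>ext_cocycles R P d N (Suc i). \<exists>v\<in>rhom R (P i) N. \<forall>x\<in>carrier (P (Suc i)). f x = v (d i x))"
    (is "trivial_group (?G Mod ?B) \<longleftrightarrow> ?ex")
proof -
  interpret N: right_module R N by fact
  let ?P = "P (Suc i)"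
  have cc: "f \<in> carrier ?G \<longleftrightarrow> f \<in> rhom R ?P N \<and> (\<forall>x\<in>carrier (P (Suc (Suc i))). f (d (Suc i) x) = \<zero>\<^bsub>N\<^esub>)" for f
    by (auto simp: ext_cocycles_def)
  have bb: "f \<in> ?B \<longleftrightarrow> (\<exists>v\<in>rhom R (P i) N. f = compose (carrier ?P) v (d i))" for f
    by (auto simp: ext_coboundaries_def)
  note dcl = rhomD(1)[OF d]
  have zero: "(\<lambda>x\<in>carrier (P j). \<zero>\<^bsub>N\<^esub>) \<in> rhom R (P j) N" for j
    by (rule rhom_restrictI[OF P_module]) auto
  have "comm_group ?G"
  proof (rule comm_groupI)
    show one: "\<one>\<^bsub>?G\<^esub> \<in> carrier ?G" unfolding cc using zero dcl by simp
    fix f assume f: "f \<in> carrier ?G"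
    then have f': "f \<in> rhom R ?P N" "\<And>x. x \<in> carrier (P (Suc (Suc i))) \<Longrightarrow> f (d (Suc i) x) = \<zero>\<^bsub>N\<^esub>"
      unfolding cc by auto
    note fc = rhomD(1)[OF f'(1)]
    show "\<one>\<^bsub>?G\<^esub> \<otimes>\<^bsub>?G\<^esub> f = f"
      using rhomD(4)[OF f'(1)] fc by (intro extensionalityI[where A = "carrier ?P"]) auto
    have "(\<lambda>x\<in>carrier ?P. \<ominus>\<^bsub>N\<^esub> f x) \<in> carrier ?G"
      unfolding cc using rhom_uminus[OF P_module N f'(1)] f'(2) dcl by simp
    moreover have "(\<lambda>x\<in>carrier ?P. \<ominus>\<^bsub>N\<^esub> f x) \<otimes>\<^bsub>?G\<^esub> f = \<one>\<^bsub>?G\<^esub>"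
      using fc by (auto simp: N.M.l_neg intro!: restrict_ext)
    ultimately show "\<exists>g\<in>carrier ?G. g \<otimes>\<^bsub>?G\<^esub> f = \<one>\<^bsub>?G\<^esub>" by blast
    fix g assume g: "g \<in> carrier ?G"
    then have g': "g \<in> rhom R ?P N" "\<And>x. x \<in> carrier (P (Suc (Suc i))) \<Longrightarrow> g (d (Suc i) x) = \<zero>\<^bsub>N\<^esub>"
      unfolding cc by auto
    note gc = rhomD(1)[OF g'(1)]
    show "f \<otimes>\<^bsub>?G\<^esub> g \<in> carrier ?G" unfolding cc using rhom_add[OF P_module N f'(1) g'(1)] f'(2) g'(2) dcl by simp
    show "f \<otimes>\<^bsub>?G\<^esub> g = g \<otimes>\<^bsub>?G\<^esub> f" using fc gc by (auto simp: N.M.a_comm intro!: restrict_ext)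
    fix h assume "h \<in> carrier ?G"
    then have hc: "h x \<in> carrier N" if "x \<in> carrier ?P" for x
      using rhomD(1)[of h R ?P N] that unfolding cc by blast
    show "f \<otimes>\<^bsub>?G\<^esub> g \<otimes>\<^bsub>?G\<^esub> h = f \<otimes>\<^bsub>?G\<^esub> (g \<otimes>\<^bsub>?G\<^esub> h)"
      using fc gc hc by (auto simp: N.M.a_assoc intro!: restrict_ext)
  qed
  moreover have BG: "?B \<subseteq> carrier ?G"
  proof
    fix f assume "f \<in> ?B"
    then obtain v where v: "v \<in> rhom R (P i) N" "f = compose (carrier ?P) v (d i)" unfolding bb by blast
    have "f (d (Suc i) x) = \<zero>\<^bsub>N\<^esub>" if "x \<in> carrier (P (Suc (Suc i)))" for x
    proof -
      have "d (Suc i) x \<in> rkernel ?P (P i) (d i)" using exact_Suc[of i] that by blast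
      then show ?thesis using rhom_zero[OF P_module N v(1)] by (simp add: v(2) compose_def rkernel_def)
    qed
    then show "f \<in> carrier ?G" unfolding cc using v rhom_compose[OF P_module d v(1)] by blast
  qed
  moreover have "\<one>\<^bsub>?G\<^esub> \<in> ?B"
    unfolding bb using zero dcl by (intro bexI[OF _ zero]) (auto simp: compose_def intro!: restrict_ext)
  ultimately have "trivial_group (?G Mod ?B) \<longleftrightarrow> ?B = carrier ?G" by (rule trivial_group_Mod_iff)
  also have "\<dots> \<longleftrightarrow> (\<forall>f\<in>carrier ?G. f \<in> ?B)" using BG by blast
  also have "\<dots> \<longleftrightarrow> ?ex"
  proof -
    have "f \<in> ?B \<longleftrightarrow> (\<exists>v\<in>rhom R (P i) N. \<forall>x\<in>carrier ?P. f x = v (d i x))" if "f \<in> carrier ?G" for f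
    proof -
      have "f \<in> extensional (carrier ?P)" using that unfolding cc by (auto dest: rhomD(4))
      then have "f = compose (carrier ?P) v (d i) \<longleftrightarrow> (\<forall>x\<in>carrier ?P. f x = v (d i x))" for v
        by (auto simp: compose_def intro!: extensionalityI[where A = "carrier ?P"])
      then show ?thesis unfolding bb by simp
    qed
    then show ?thesis by simp
  qed
  finally show ?thesis .
qed

text \<open>The given resolution only certifies that the choice inside \<open>Ext\<close> succeeds.
  The resolution obtained is the chosen one and may be a different one.\<close>

lemma trivial_Ext_iff_hom_exact:
  fixes M :: "('a, 'm) rmodule"
  assumes M: "right_module R M" and N: "right_module R N" and ex: "proj_resolution R M P0 d0 e0"
  obtains P d e where "proj_resolution R M P d e"
    "(\<forall>i>0. trivial_group (Ext R i M N)) \<longleftrightarrow> resolution.hom_exact R P d N"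
proof -
  obtain P d e where c: "(SOME (P, d, e). proj_resolution R M P d e) = (P, d, e)" by (rule prod_cases3)
  have "(\<lambda>(P, d, e). proj_resolution R M P d e) (SOME (P, d, e). proj_resolution R M P d e)"
    by (rule someI[where x = "(P0, d0, e0)"]) (simp add: ex)
  then have P: "proj_resolution R M P d e" by (simp add: c)
  then interpret resolution R M P d e by (rule resolution_of_proj_resolution[OF M])
  have "(\<forall>i>0. trivial_group (Ext R i M N)) \<longleftrightarrow> (\<forall>i. trivial_group (Ext R (Suc i) M N))"
    by (metis gr0_conv_Suc)
  also have "\<dots> \<longleftrightarrow> hom_exact N"
    unfolding Ext_def c Let_def prod.case trivial_cohomology_iff[OF N] hom_exact_def
    by (auto simp: ext_cocycles_def)
  finally show ?thesis using P that by blast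
qed

context dual_extension
begin

text \<open>The very resolution that \<open>Ext\<close> picks over \<open>E\<close> is restricted to
  \<open>A\<close>, where the projectivity criterion holds for every resolution, whatever its
  type.\<close>

theorem maximal_CM_iff:
  assumes "finite_global_dim A" "right_noetherian E" and M: "fg_right_module E M"
  shows "maximal_CM E M \<longleftrightarrow> projective_rmodule A (res M)"
proof -
  have rM: "right_module E M" using M by (rule fg_right_moduleD)
  obtain P0 d0 e0 where "proj_resolution E M P0 d0 e0"
    using proj_resolution_exists[OF E_ring assms(2) M] by blast
  then obtain P d e where P: "proj_resolution E M P d e"
    "(\<forall>i>0. trivial_group (Ext E i M (regular_rmodule E))) \<longleftrightarrow> resolution.hom_exact E P d (regular_rmodule E)"
    using trivial_Ext_iff_hom_exact[OF rM E_regular] by blast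
  have res: "resolution E M P d e" by (rule resolution_of_proj_resolution[OF rM P(1)])
  show ?thesis
    using M P(2) hom_exact_res_iff[OF res] resolution.hom_exact_regular_iff[OF resolution_res[OF res] assms(1)]
    by (simp add: maximal_CM_def)
qed

end

section \<open>Differential modules\<close>

text \<open>\<open>is_equivalence\<close> hides the inverse behind an existential quantifier. Naming
  it allows both functors to be restricted to full subcategories, where the same natural
  isomorphisms remain available.\<close>

definition quasi_inverse ::
  "('o, 'f) cat \<Rightarrow> ('p, 'g) cat \<Rightarrow> ('o, 'f, 'p, 'g) ftor \<Rightarrow> ('p, 'g, 'o, 'f) ftor \<Rightarrow> bool" where
  "quasi_inverse C D F G \<longleftrightarrow> is_functor C D F \<and> is_functor D C G
     \<and> naturally_isomorphic C C (comp_ftor G F) id_ftor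
     \<and> naturally_isomorphic D D (comp_ftor F G) id_ftor"

lemma is_equivalence_of_quasi_inverse: "quasi_inverse C D F G \<Longrightarrow> is_equivalence C D F"
  by (auto simp: quasi_inverse_def is_equivalence_def)

lemma category_full_subcat: "category C \<Longrightarrow> category (full_subcat C P)"
  unfolding category_def full_subcat_def by simp

lemma is_functor_full_subcat:
  assumes "is_functor C D F" "\<And>X. X \<in> Ob C \<Longrightarrow> P X \<Longrightarrow> Q (FOb F X)"
  shows "is_functor (full_subcat C P) (full_subcat D Q) F"
  using assms(1) assms(2) category_full_subcat[of C P] category_full_subcat[of D Q]
  unfolding is_functor_def by (simp add: full_subcat_def)

lemma naturally_isomorphic_full_subcat:
  "naturally_isomorphic C D F G \<Longrightarrow> naturally_isomorphic (full_subcat C P) (full_subcat D Q) F G"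
  unfolding naturally_isomorphic_def iso_arrow_def full_subcat_def by simp blast

lemma quasi_inverse_full_subcat:
  assumes "quasi_inverse C D F G"
    and "\<And>X. X \<in> Ob C \<Longrightarrow> P X \<Longrightarrow> Q (FOb F X)" "\<And>Y. Y \<in> Ob D \<Longrightarrow> Q Y \<Longrightarrow> P (FOb G Y)"
  shows "quasi_inverse (full_subcat C P) (full_subcat D Q) F G"
  using assms unfolding quasi_inverse_def
  by (blast intro: is_functor_full_subcat naturally_isomorphic_full_subcat)

lemma category_mod_cat:
  assumes "ring R" shows "category (mod_cat R :: (('a, 'm) rmodule, 'm \<Rightarrow> 'm) cat)"
proof
  fix W X Y Z :: "('a, 'm) rmodule" and f g h
  assume X: "X \<in> Ob (mod_cat R)"
  then have X': "right_module R X" by (auto simp: mod_cat_def intro: fg_right_moduleD)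
  show "Idn (mod_cat R) X \<in> Hom (mod_cat R) X X" using rhom_id[OF X'] by (simp add: mod_cat_def)
  assume f: "f \<in> Hom (mod_cat R) X Y"
  then have f': "f \<in> rhom R X Y" by (simp add: mod_cat_def)
  show "Comp (mod_cat R) X Y Y (Idn (mod_cat R) Y) f = f" "Comp (mod_cat R) X X Y f (Idn (mod_cat R) X) = f"
    using rhomD(1,4)[OF f']
    by (auto simp: mod_cat_def compose_def intro!: extensionalityI[where A = "carrier X"])
  assume g: "g \<in> Hom (mod_cat R) Y Z"
  show "Comp (mod_cat R) X Y Z g f \<in> Hom (mod_cat R) X Z"
    using rhom_compose[OF X' f'] g by (simp add: mod_cat_def)
next
  fix W X Y Z :: "('a, 'm) rmodule" and f g h
  assume f: "f \<in> Hom (mod_cat R) W X"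
  then have "f \<in> rhom R W X" by (simp add: mod_cat_def)
  from rhomD(1)[OF this] show "Comp (mod_cat R) W X Z (Comp (mod_cat R) X Y Z h g) f
      = Comp (mod_cat R) W Y Z h (Comp (mod_cat R) W X Y g f)"
    by (auto simp: mod_cat_def compose_def intro!: restrict_ext)
qed

text \<open>\<open>G_spans\<close> is an induction principle: \<open>A\<close> is the additive
  closure of its homogeneous elements.\<close>

locale graded_dual_extension = dual_extension A \<sigma>
  for A :: "('a, 'b) ring_scheme" (structure) and \<sigma> +
  fixes \<iota> :: "'k \<Rightarrow> 'a" and G :: "int \<Rightarrow> 'a set"
  assumes G_closed: "G n \<subseteq> carrier A"
    and \<sigma>_G: "a \<in> G n \<Longrightarrow> \<sigma> a = (if even n then a else \<ominus> a)"
    and G_spans: "\<lbrakk>\<And>n. G n \<subseteq> W; \<zero> \<in> W; \<And>x y. \<lbrakk>x \<in> W; y \<in> W\<rbrakk> \<Longrightarrow> x \<oplus> y \<in> W\<rbrakk> \<Longrightarrow> carrier A \<subseteq> W"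
    and \<iota>_closed: "\<iota> c \<in> carrier A" and \<sigma>_\<iota>: "\<sigma> (\<iota> c) = \<iota> c"
begin

lemma differential_moduleD:
  assumes "differential_module A \<iota> G (M, d)"
  shows "fg_right_module A M" "right_module A M"
    and "x \<in> carrier M \<Longrightarrow> d x \<in> carrier M" "d \<in> extensional (carrier M)"
    and "\<lbrakk>x \<in> carrier M; y \<in> carrier M\<rbrakk> \<Longrightarrow> d (x \<oplus>\<^bsub>M\<^esub> y) = d x \<oplus>\<^bsub>M\<^esub> d y"
    and "x \<in> carrier M \<Longrightarrow> d (d x) = \<zero>\<^bsub>M\<^esub>"
    and "\<lbrakk>x \<in> carrier M; a \<in> G n\<rbrakk> \<Longrightarrow> d (x \<triangleleft>\<^bsub>M\<^esub> a) = (if even n then d x \<triangleleft>\<^bsub>M\<^esub> a else \<ominus>\<^bsub>M\<^esub> (d x \<triangleleft>\<^bsub>M\<^esub> a))"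
  using assms fg_right_moduleD unfolding differential_module_def by (auto simp: PiE_def)

lemma differential_zero:
  assumes "differential_module A \<iota> G (M, d)"
  shows "d \<zero>\<^bsub>M\<^esub> = \<zero>\<^bsub>M\<^esub>"
proof -
  note D = differential_moduleD[OF assms]
  interpret M: right_module A M by (rule D(2))
  have "d \<zero>\<^bsub>M\<^esub> \<oplus>\<^bsub>M\<^esub> d \<zero>\<^bsub>M\<^esub> = d \<zero>\<^bsub>M\<^esub>" using D(5)[of "\<zero>\<^bsub>M\<^esub>" "\<zero>\<^bsub>M\<^esub>"] by simp
  then show ?thesis using M.M.add.r_cancel_one D(3) by simp
qed

text \<open>The sign rule is given for homogeneous \<open>a\<close> only. Written with \<sigma>,
  both sides are additive in \<open>a\<close>, so it extends along \<open>G_spans\<close>.\<close>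

lemma differential_twisted:
  assumes M: "differential_module A \<iota> G (M, d)" and x: "x \<in> carrier M" and a: "a \<in> carrier A"
  shows "d (x \<triangleleft>\<^bsub>M\<^esub> a) = d x \<triangleleft>\<^bsub>M\<^esub> \<sigma> a"
proof -
  note D = differential_moduleD[OF M]
  interpret M: right_module A M by (rule D(2))
  have "carrier A \<subseteq> {a \<in> carrier A. d (x \<triangleleft>\<^bsub>M\<^esub> a) = d x \<triangleleft>\<^bsub>M\<^esub> \<sigma> a}"
  proof (rule G_spans)
    show "G n \<subseteq> {a \<in> carrier A. d (x \<triangleleft>\<^bsub>M\<^esub> a) = d x \<triangleleft>\<^bsub>M\<^esub> \<sigma> a}" for n
    proof (intro subsetI CollectI conjI)
      fix a assume a: "a \<in> G n"
      then show aA: "a \<in> carrier A" using G_closed by blast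
      show "d (x \<triangleleft>\<^bsub>M\<^esub> a) = d x \<triangleleft>\<^bsub>M\<^esub> \<sigma> a"
        using D(7)[OF x a] aA M.ract_minus_right[OF D(3)[OF x] aA] by (simp add: \<sigma>_G[OF a])
    qed
    show "\<zero> \<in> {a \<in> carrier A. d (x \<triangleleft>\<^bsub>M\<^esub> a) = d x \<triangleleft>\<^bsub>M\<^esub> \<sigma> a}"
      using x D(3)[OF x] differential_zero[OF M] by (simp add: \<sigma>_zero)
    show "a \<oplus> b \<in> {a \<in> carrier A. d (x \<triangleleft>\<^bsub>M\<^esub> a) = d x \<triangleleft>\<^bsub>M\<^esub> \<sigma> a}"
      if "a \<in> {a \<in> carrier A. d (x \<triangleleft>\<^bsub>M\<^esub> a) = d x \<triangleleft>\<^bsub>M\<^esub> \<sigma> a}"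
        "b \<in> {a \<in> carrier A. d (x \<triangleleft>\<^bsub>M\<^esub> a) = d x \<triangleleft>\<^bsub>M\<^esub> \<sigma> a}" for a b
      using that x D(3)[OF x] D(5) by (simp add: M.ract_add_right M.ract_closed \<sigma>_simps)
  qed
  then show ?thesis using a by blast
qed

lemma Gamma_simps:
  "FOb (Gamma A) M = (res M, \<lambda>m\<in>carrier M. m \<triangleleft>\<^bsub>M\<^esub> \<epsilon>)" "FArr (Gamma A) M N f = f"
  by (simp_all add: Gamma_def pure_tensor_def)

lemma differential_module_Gamma:
  assumes M: "fg_right_module E M"
  shows "differential_module A \<iota> G (FOb (Gamma A) M)"
proof -
  have rM: "right_module E M" using M by (rule fg_right_moduleD)
  interpret M: right_module E M by fact
  have \<epsilon>E: "\<epsilon> \<in> carrier E" and incl: "\<And>a. a \<in> carrier A \<Longrightarrow> (a, \<zero>) \<in> carrier E" by (simp_all add: E_simps)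
  note cl = M.ract_closed[OF _ \<epsilon>E] M.ract_closed[OF _ incl]
  have tw: "x \<triangleleft>\<^bsub>M\<^esub> (a, \<zero>) \<triangleleft>\<^bsub>M\<^esub> \<epsilon> = x \<triangleleft>\<^bsub>M\<^esub> \<epsilon> \<triangleleft>\<^bsub>M\<^esub> (\<sigma> a, \<zero>)" if "x \<in> carrier M" "a \<in> carrier A" for x a
    using ract_E(3)[OF rM that A.zero_closed] .
  have neg: "x \<triangleleft>\<^bsub>M\<^esub> (\<ominus> a, \<zero>) = \<ominus>\<^bsub>res M\<^esub> (x \<triangleleft>\<^bsub>M\<^esub> (a, \<zero>))" if "x \<in> carrier M" "a \<in> carrier A" for x a
    using right_module.ract_minus_right[OF res_module[OF rM], of x a] that by (simp add: pure_tensor_0)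
  show ?thesis
    unfolding Gamma_simps differential_module_def prod.case
  proof (intro conjI ballI allI)
    show "fg_right_module A (res M)" using fg_res_iff[OF rM] M by blast
    show "(\<lambda>m\<in>carrier M. m \<triangleleft>\<^bsub>M\<^esub> \<epsilon>) \<in> carrier (res M) \<rightarrow>\<^sub>E carrier (res M)" using cl by simp
  next
    fix n a x assume a: "a \<in> G n" and x: "x \<in> carrier (res M)"
    then have "a \<in> carrier A" "x \<in> carrier M" using G_closed by auto
    then show "(\<lambda>m\<in>carrier M. m \<triangleleft>\<^bsub>M\<^esub> \<epsilon>) (x \<triangleleft>\<^bsub>res M\<^esub> a) =
       (if even n then (\<lambda>m\<in>carrier M. m \<triangleleft>\<^bsub>M\<^esub> \<epsilon>) x \<triangleleft>\<^bsub>res M\<^esub> a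
        else \<ominus>\<^bsub>res M\<^esub> ((\<lambda>m\<in>carrier M. m \<triangleleft>\<^bsub>M\<^esub> \<epsilon>) x \<triangleleft>\<^bsub>res M\<^esub> a))"
      using cl by (simp add: pure_tensor_0 tw \<sigma>_G[OF a] neg)
  qed (use cl in \<open>auto simp: pure_tensor_0 tw \<sigma>_\<iota> \<iota>_closed M.ract_add_left[OF _ _ \<epsilon>E] ract_E(4)[OF rM _ A.zero_closed A.zero_closed]\<close>)
qed

text \<open>The quasi-inverse of \<^const>\<open>Gamma\<close>: \<open>a \<otimes> 1 + b \<otimes> \<epsilon>\<close> acts on \<open>(M, d)\<close> by \<open>x \<mapsto> xa + d(xb)\<close>.\<close>

definition Lambda_module :: "('a, 'm) rmodule \<times> ('m \<Rightarrow> 'm) \<Rightarrow> ('a \<times> 'a, 'm) rmodule" where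
  "Lambda_module X = (case X of (M, d) \<Rightarrow> \<lparr>carrier = carrier M, monoid.mult = mult M, one = one M,
     zero = zero M, add = add M, ract = (\<lambda>x (a, b). x \<triangleleft>\<^bsub>M\<^esub> a \<oplus>\<^bsub>M\<^esub> d (x \<triangleleft>\<^bsub>M\<^esub> b))\<rparr>)"

definition Lambda ::
  "(('a, 'm) rmodule \<times> ('m \<Rightarrow> 'm), 'm \<Rightarrow> 'm, ('a \<times> 'a, 'm) rmodule, 'm \<Rightarrow> 'm) ftor" where
  "Lambda = \<lparr>FOb = Lambda_module, FArr = (\<lambda>X Y f. f)\<rparr>"

lemma Lambda_simps:
  "carrier (Lambda_module (M, d)) = carrier M"
  "zero (Lambda_module (M, d)) = zero M"
  "add (Lambda_module (M, d)) = add M"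
  "x \<triangleleft>\<^bsub>Lambda_module (M, d)\<^esub> (a, b) = x \<triangleleft>\<^bsub>M\<^esub> a \<oplus>\<^bsub>M\<^esub> d (x \<triangleleft>\<^bsub>M\<^esub> b)"
  by (simp_all add: Lambda_module_def)

text \<open>Associativity is where the axioms on \<open>d\<close> enter: twisted linearity produces
  the \<sigma> in the product of \<open>E\<close>, and \<open>d\<close> squared being zero removes
  the product of two \<epsilon>-parts.\<close>

lemma Lambda_module:
  assumes X: "differential_module A \<iota> G (M, d)"
  shows "right_module E (Lambda_module (M, d))"
proof -
  note D = differential_moduleD[OF X] and tw = differential_twisted[OF X] and zero = differential_zero[OF X]
  interpret M: right_module A M by (rule D(2))
  let ?L = "Lambda_module (M, d)"
  have "abelian_group ?L"
  proof (rule abelian_groupI)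
    show "\<exists>y\<in>carrier ?L. y \<oplus>\<^bsub>?L\<^esub> x = \<zero>\<^bsub>?L\<^esub>" if "x \<in> carrier ?L" for x
      using that by (intro bexI[of _ "\<ominus>\<^bsub>M\<^esub> x"]) (auto simp: Lambda_simps M.M.l_neg)
  qed (auto simp: Lambda_simps M.M.a_ac)
  then show ?thesis
    by (intro right_module.intro right_module_axioms.intro E_ring)
      (auto simp: Lambda_simps E_simps \<sigma>_simps \<sigma>_zero zero D(3,5,6) tw M.ract_closed M.ract_add_left
        M.ract_add_right M.ract_assoc M.ract_one M.M.a_ac)
qed

lemma res_Lambda:
  assumes X: "differential_module A \<iota> G (M, d)" and "x \<in> carrier M" "a \<in> carrier A"
  shows "x \<triangleleft>\<^bsub>res (Lambda_module (M, d))\<^esub> a = x \<triangleleft>\<^bsub>M\<^esub> a"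
proof -
  interpret M: right_module A M by (rule differential_moduleD(2)[OF X])
  show ?thesis using assms(2,3) differential_zero[OF X] by (simp add: Lambda_simps pure_tensor_0 M.ract_closed)
qed

text \<open>The action is recovered only on the carrier, so the two records may differ; the identity
  map is an isomorphism that carries finite generation and projectivity across.\<close>

lemma rhom_res_Lambda:
  assumes X: "differential_module A \<iota> G (M, d)"
  shows "(\<lambda>x\<in>carrier M. x) \<in> rhom A M (res (Lambda_module (M, d)))"
    and "(\<lambda>x\<in>carrier M. x) \<in> rhom A (res (Lambda_module (M, d))) M"
proof -
  interpret M: right_module A M by (rule differential_moduleD(2)[OF X])
  show "(\<lambda>x\<in>carrier M. x) \<in> rhom A M (res (Lambda_module (M, d)))"
    by (rule rhom_restrictI[OF M.right_module_axioms])
      (simp_all add: res_Lambda[OF X] Lambda_simps del: restrict_scalars_simps(4))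
  have "(\<lambda>x\<in>carrier (res (Lambda_module (M, d))). x) \<in> rhom A (res (Lambda_module (M, d))) M"
    by (rule rhom_restrictI[OF res_module[OF Lambda_module[OF X]]])
      (simp_all add: res_Lambda[OF X] Lambda_simps del: restrict_scalars_simps(4))
  then show "(\<lambda>x\<in>carrier M. x) \<in> rhom A (res (Lambda_module (M, d))) M" by (simp add: Lambda_simps)
qed

lemma fg_Lambda:
  assumes X: "differential_module A \<iota> G (M, d)"
  shows "fg_right_module E (Lambda_module (M, d))"
proof -
  have "fg_right_module A (res (Lambda_module (M, d)))"
    by (rule fg_image[OF differential_moduleD(1)[OF X] res_module[OF Lambda_module[OF X]] rhom_res_Lambda(1)[OF X]])
      (simp add: Lambda_simps)
  then show ?thesis using fg_res_iff[OF Lambda_module[OF X]] by blast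
qed

lemma projective_res_Lambda:
  assumes X: "differential_module A \<iota> G (M, d)" and "projective_rmodule A M"
  shows "projective_rmodule A (res (Lambda_module (M, d)))"
  by (rule projective_retract[OF res_module[OF Lambda_module[OF X]] assms(2) differential_moduleD(1)[OF X]
        rhom_res_Lambda(2,1)[OF X]]) (simp add: Lambda_simps)

lemma category_Dif_cat: "category (Dif_cat A \<iota> G :: (('a, 'm) rmodule \<times> ('m \<Rightarrow> 'm), 'm \<Rightarrow> 'm) cat)"
proof -
  have ob: "right_module A (fst X)" "x \<in> carrier (fst X) \<Longrightarrow> snd X x \<in> carrier (fst X)"
    if "X \<in> Ob (Dif_cat A \<iota> G)" for X :: "('a, 'm) rmodule \<times> ('m \<Rightarrow> 'm)" and x
    using that differential_moduleD(2,3)[of "fst X" "snd X"] by (auto simp: Dif_cat_def)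
  show ?thesis
  proof
    fix W X Y Z :: "('a, 'm) rmodule \<times> ('m \<Rightarrow> 'm)" and f g h
    assume X: "X \<in> Ob (Dif_cat A \<iota> G)"
    show "Idn (Dif_cat A \<iota> G) X \<in> Hom (Dif_cat A \<iota> G) X X"
      using rhom_id[OF ob(1)[OF X]] ob(2)[OF X] by (simp add: Dif_cat_def dif_hom_def)
    assume f: "f \<in> Hom (Dif_cat A \<iota> G) X Y"
    then have f': "f \<in> rhom A (fst X) (fst Y)" "\<And>x. x \<in> carrier (fst X) \<Longrightarrow> f (snd X x) = snd Y (f x)"
      by (auto simp: Dif_cat_def dif_hom_def)
    show "Comp (Dif_cat A \<iota> G) X Y Y (Idn (Dif_cat A \<iota> G) Y) f = f"
      "Comp (Dif_cat A \<iota> G) X X Y f (Idn (Dif_cat A \<iota> G) X) = f"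
      using rhomD(1,4)[OF f'(1)]
      by (auto simp: Dif_cat_def compose_def intro!: extensionalityI[where A = "carrier (fst X)"])
    assume g: "g \<in> Hom (Dif_cat A \<iota> G) Y Z"
    then have g': "g \<in> rhom A (fst Y) (fst Z)" "\<And>x. x \<in> carrier (fst Y) \<Longrightarrow> g (snd Y x) = snd Z (g x)"
      by (auto simp: Dif_cat_def dif_hom_def)
    show "Comp (Dif_cat A \<iota> G) X Y Z g f \<in> Hom (Dif_cat A \<iota> G) X Z"
      using rhom_compose[OF ob(1)[OF X] f'(1) g'(1)] ob(2)[OF X] rhomD(1)[OF f'(1)] f'(2) g'(2)
      by (simp add: Dif_cat_def dif_hom_def compose_def)
  next
    fix W X Y Z :: "('a, 'm) rmodule \<times> ('m \<Rightarrow> 'm)" and f g h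
    assume f: "f \<in> Hom (Dif_cat A \<iota> G) W X"
    then have "f \<in> rhom A (fst W) (fst X)" by (simp add: Dif_cat_def dif_hom_def)
    from rhomD(1)[OF this] show "Comp (Dif_cat A \<iota> G) W X Z (Comp (Dif_cat A \<iota> G) X Y Z h g) f
        = Comp (Dif_cat A \<iota> G) W Y Z h (Comp (Dif_cat A \<iota> G) W X Y g f)"
      by (auto simp: Dif_cat_def compose_def intro!: restrict_ext)
  qed
qed

lemma is_functor_Gamma:
  "is_functor (mod_cat E :: (('a \<times> 'a, 'm) rmodule, 'm \<Rightarrow> 'm) cat) (Dif_cat A \<iota> G) (Gamma A)"
proof -
  have "f \<in> dif_hom A (FOb (Gamma A) M) (FOb (Gamma A) N)" if f: "f \<in> rhom E M N" and M: "right_module E M"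
    for M N :: "('a \<times> 'a, 'm) rmodule" and f
  proof -
    have "\<epsilon> \<in> carrier E" by (simp add: E_simps)
    then show ?thesis using rhom_res[OF f] rhomD(1,3)[OF f] by (simp add: dif_hom_def Gamma_simps)
  qed
  then show ?thesis
    unfolding is_functor_def
    using category_mod_cat[OF E_ring] category_Dif_cat differential_module_Gamma fg_right_moduleD
    by (simp add: mod_cat_def Dif_cat_def Gamma_simps) blast
qed

lemma rhom_Lambda:
  assumes X: "differential_module A \<iota> G X" and Y: "differential_module A \<iota> G Y" and f: "f \<in> dif_hom A X Y"
  shows "f \<in> rhom E (Lambda_module X) (Lambda_module Y)"
proof -
  obtain M d N d' where XY: "X = (M, d)" "Y = (N, d')" by (cases X, cases Y)
  have f': "f \<in> rhom A M N" "\<And>x. x \<in> carrier M \<Longrightarrow> f (d x) = d' (f x)"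
    using f by (auto simp: XY dif_hom_def)
  note D = differential_moduleD[OF X[unfolded XY]]
  interpret M: right_module A M by (rule D(2))
  show ?thesis
    unfolding XY
  proof (rule rhomI)
    fix x r assume "x \<in> carrier (Lambda_module (M, d))" "r \<in> carrier E"
    then obtain a b where "x \<in> carrier M" "r = (a, b)" "a \<in> carrier A" "b \<in> carrier A"
      by (auto simp: E_simps Lambda_simps)
    then show "f (x \<triangleleft>\<^bsub>Lambda_module (M, d)\<^esub> r) = f x \<triangleleft>\<^bsub>Lambda_module (N, d')\<^esub> r"
      using D(3) by (simp add: Lambda_simps rhomD(2,3)[OF f'(1)] f'(2) M.ract_closed)
  qed (use rhomD(1,2,4)[OF f'(1)] in \<open>simp_all add: Lambda_simps\<close>)
qed

lemma is_functor_Lambda: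
  "is_functor (Dif_cat A \<iota> G) (mod_cat E :: (('a \<times> 'a, 'm) rmodule, 'm \<Rightarrow> 'm) cat) Lambda"
proof -
  have "carrier (Lambda_module X) = carrier (fst X)" for X :: "('a, 'm) rmodule \<times> ('m \<Rightarrow> 'm)"
    by (cases X) (simp add: Lambda_simps)
  moreover have "fg_right_module E (Lambda_module X)" if "differential_module A \<iota> G X"
    for X :: "('a, 'm) rmodule \<times> ('m \<Rightarrow> 'm)"
    using fg_Lambda that by (cases X) auto
  ultimately show ?thesis
    unfolding is_functor_def
    by (intro conjI category_mod_cat[OF E_ring] category_Dif_cat)
      (simp_all add: mod_cat_def Dif_cat_def Lambda_def rhom_Lambda del: split_paired_All)
qed

section \<open>The natural isomorphisms and the two equivalences\<close>

lemma Lambda_Gamma: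
  "naturally_isomorphic (mod_cat E :: (('a \<times> 'a, 'm) rmodule, 'm \<Rightarrow> 'm) cat) (mod_cat E)
     (comp_ftor Lambda (Gamma A)) id_ftor"
proof -
  have car: "carrier (Lambda_module (FOb (Gamma A) M)) = carrier M" for M :: "('a \<times> 'a, 'm) rmodule"
    by (simp add: Gamma_simps Lambda_simps)
  have iso: "(\<lambda>x\<in>carrier M. x) \<in> rhom E (Lambda_module (FOb (Gamma A) M)) M"
    "(\<lambda>x\<in>carrier M. x) \<in> rhom E M (Lambda_module (FOb (Gamma A) M))"
    if M: "fg_right_module E M" for M :: "('a \<times> 'a, 'm) rmodule"
  proof -
    let ?L = "Lambda_module (FOb (Gamma A) M)"
    have rM: "right_module E M" using M by (rule fg_right_moduleD)
    then interpret M: right_module E M .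
    have "right_module E ?L"
      using Lambda_module differential_module_Gamma[OF M] by (simp add: Gamma_simps)
    note L = this
    have ract: "x \<triangleleft>\<^bsub>?L\<^esub> r = x \<triangleleft>\<^bsub>M\<^esub> r" if "x \<in> carrier M" "r \<in> carrier E" for x r
    proof -
      obtain a b where r: "r = (a, b)" "a \<in> carrier A" "b \<in> carrier A" using \<open>r \<in> carrier E\<close> by (auto simp: E_simps)
      then have "x \<triangleleft>\<^bsub>M\<^esub> (b, \<zero>) \<in> carrier M" using that by (intro M.ract_closed) (auto simp: E_simps)
      \<comment> \<open>Splitting the action of a pair with the scalar in front of \<epsilon> gives
        exactly the formula that defines \<open>Lambda_module\<close>.\<close>
      then show ?thesis
        unfolding r(1) ract_E(1)[OF rM that(1) r(2,3)] by (simp add: Gamma_simps Lambda_simps pure_tensor_0)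
    qed
    have add: "add ?L = add M" by (simp add: Gamma_simps Lambda_simps)
    show "(\<lambda>x\<in>carrier M. x) \<in> rhom E M ?L"
      by (rule rhom_restrictI[OF rM]) (simp_all add: car ract add)
    have "(\<lambda>x\<in>carrier ?L. x) \<in> rhom E ?L M"
      by (rule rhom_restrictI[OF L]) (simp_all add: car ract add)
    then show "(\<lambda>x\<in>carrier M. x) \<in> rhom E ?L M" unfolding car .
  qed
  show ?thesis
    unfolding naturally_isomorphic_def
  proof (intro exI[of _ "\<lambda>M. \<lambda>x\<in>carrier M. x"] conjI ballI)
    fix M :: "('a \<times> 'a, 'm) rmodule" assume "M \<in> Ob (mod_cat E)"
    then have M: "fg_right_module E M" by (simp add: mod_cat_def)
    show "iso_arrow (mod_cat E) (FOb (comp_ftor Lambda (Gamma A)) M) (FOb id_ftor M) (\<lambda>x\<in>carrier M. x)"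
      unfolding iso_arrow_def using iso[OF M]
      by (intro conjI bexI[of _ "\<lambda>x\<in>carrier M. x"])
        (auto simp: mod_cat_def comp_ftor_def Lambda_def id_ftor_def car compose_def intro!: restrict_ext)
    fix N :: "('a \<times> 'a, 'm) rmodule" and f assume "f \<in> Hom (mod_cat E) M N"
    then have "f \<in> rhom E M N" by (simp add: mod_cat_def)
    from rhomD(1)[OF this]
    show "Comp (mod_cat E) (FOb (comp_ftor Lambda (Gamma A)) M) (FOb (comp_ftor Lambda (Gamma A)) N)
         (FOb id_ftor N) (\<lambda>x\<in>carrier N. x) (FArr (comp_ftor Lambda (Gamma A)) M N f) =
        Comp (mod_cat E) (FOb (comp_ftor Lambda (Gamma A)) M) (FOb id_ftor M) (FOb id_ftor N)
         (FArr id_ftor M N f) (\<lambda>x\<in>carrier M. x)"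
      by (auto simp: mod_cat_def comp_ftor_def Lambda_def id_ftor_def car compose_def Gamma_simps(2)
          intro!: restrict_ext)
  qed
qed

lemma Gamma_Lambda:
  "naturally_isomorphic (Dif_cat A \<iota> G :: (('a, 'm) rmodule \<times> ('m \<Rightarrow> 'm), 'm \<Rightarrow> 'm) cat) (Dif_cat A \<iota> G)
     (comp_ftor (Gamma A) Lambda) id_ftor"
proof -
  have car: "carrier (fst (FOb (Gamma A) (Lambda_module X))) = carrier (fst X)"
    for X :: "('a, 'm) rmodule \<times> ('m \<Rightarrow> 'm)"
    by (cases X) (simp add: Gamma_simps Lambda_simps)
  have iso: "(\<lambda>x\<in>carrier (fst X). x) \<in> dif_hom A (FOb (Gamma A) (Lambda_module X)) X"
    "(\<lambda>x\<in>carrier (fst X). x) \<in> dif_hom A X (FOb (Gamma A) (Lambda_module X))"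
    if X': "differential_module A \<iota> G X" for X :: "('a, 'm) rmodule \<times> ('m \<Rightarrow> 'm)"
  proof -
    obtain M d where XM: "X = (M, d)" by (cases X)
    note X = X'[unfolded XM]
    interpret M: right_module A M by (rule differential_moduleD(2)[OF X])
    note D = differential_moduleD[OF X]
    have "x \<triangleleft>\<^bsub>Lambda_module (M, d)\<^esub> \<epsilon> = d x" if "x \<in> carrier M" for x
      using that D(3) by (simp add: Lambda_simps M.ract_one)
    then show "(\<lambda>x\<in>carrier (fst X). x) \<in> dif_hom A (FOb (Gamma A) (Lambda_module X)) X"
      "(\<lambda>x\<in>carrier (fst X). x) \<in> dif_hom A X (FOb (Gamma A) (Lambda_module X))"
      using rhom_res_Lambda[OF X] D(3) by (simp_all add: XM dif_hom_def Gamma_simps Lambda_simps(1))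
  qed
  show ?thesis
    unfolding naturally_isomorphic_def
  proof (intro exI[of _ "\<lambda>X. \<lambda>x\<in>carrier (fst X). x"] conjI ballI)
    fix X :: "('a, 'm) rmodule \<times> ('m \<Rightarrow> 'm)" assume "X \<in> Ob (Dif_cat A \<iota> G)"
    then have X: "differential_module A \<iota> G X" by (simp add: Dif_cat_def)
    show "iso_arrow (Dif_cat A \<iota> G) (FOb (comp_ftor (Gamma A) Lambda) X) (FOb id_ftor X)
        (\<lambda>x\<in>carrier (fst X). x)"
      unfolding iso_arrow_def using iso[OF X]
      by (intro conjI bexI[of _ "\<lambda>x\<in>carrier (fst X). x"])
        (auto simp: Dif_cat_def comp_ftor_def Lambda_def id_ftor_def car compose_def intro!: restrict_ext)
    fix Y :: "('a, 'm) rmodule \<times> ('m \<Rightarrow> 'm)" and f assume "f \<in> Hom (Dif_cat A \<iota> G) X Y"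
    then have "f \<in> rhom A (fst X) (fst Y)" by (simp add: Dif_cat_def dif_hom_def)
    from rhomD(1)[OF this]
    show "Comp (Dif_cat A \<iota> G) (FOb (comp_ftor (Gamma A) Lambda) X) (FOb (comp_ftor (Gamma A) Lambda) Y)
         (FOb id_ftor Y) (\<lambda>x\<in>carrier (fst Y). x) (FArr (comp_ftor (Gamma A) Lambda) X Y f) =
        Comp (Dif_cat A \<iota> G) (FOb (comp_ftor (Gamma A) Lambda) X) (FOb id_ftor X) (FOb id_ftor Y)
         (FArr id_ftor X Y f) (\<lambda>x\<in>carrier (fst X). x)"
      by (auto simp: Dif_cat_def comp_ftor_def Lambda_def id_ftor_def car compose_def Gamma_simps(2)
          intro!: restrict_ext)
  qed
qed

lemma quasi_inverse_Gamma:
  "quasi_inverse (mod_cat E :: (('a \<times> 'a, 'm) rmodule, 'm \<Rightarrow> 'm) cat) (Dif_cat A \<iota> G) (Gamma A) Lambda"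
  unfolding quasi_inverse_def
  by (intro conjI is_functor_Gamma is_functor_Lambda Lambda_Gamma Gamma_Lambda)

theorem Gamma_equivalences:
  assumes "finite_global_dim A" "right_noetherian E"
  shows "is_equivalence (mod_cat E :: (('a \<times> 'a, 'm) rmodule, 'm \<Rightarrow> 'm) cat) (Dif_cat A \<iota> G) (Gamma A)"
    and "is_equivalence (CM_cat E :: (('a \<times> 'a, 'm) rmodule, 'm \<Rightarrow> 'm) cat) (proj_Dif_cat A \<iota> G) (Gamma A)"
proof -
  note q = quasi_inverse_Gamma[where ?'m = 'm]
  show "is_equivalence (mod_cat E :: (('a \<times> 'a, 'm) rmodule, 'm \<Rightarrow> 'm) cat) (Dif_cat A \<iota> G) (Gamma A)"
    by (rule is_equivalence_of_quasi_inverse[OF q])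
  have "quasi_inverse (CM_cat E :: (('a \<times> 'a, 'm) rmodule, 'm \<Rightarrow> 'm) cat) (proj_Dif_cat A \<iota> G) (Gamma A) Lambda"
    unfolding CM_cat_def proj_Dif_cat_def
  proof (rule quasi_inverse_full_subcat[OF q])
    fix M :: "('a \<times> 'a, 'm) rmodule" assume "M \<in> Ob (mod_cat E)" "maximal_CM E M"
    then show "projective_rmodule A (fst (FOb (Gamma A) M))"
      by (simp add: maximal_CM_iff[OF assms] mod_cat_def Gamma_simps)
  next
    fix X :: "('a, 'm) rmodule \<times> ('m \<Rightarrow> 'm)" assume X: "X \<in> Ob (Dif_cat A \<iota> G)" "projective_rmodule A (fst X)"
    obtain M d where XM: "X = (M, d)" by (cases X)
    have Md: "differential_module A \<iota> G (M, d)" using X(1) by (simp add: Dif_cat_def XM)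
    then show "maximal_CM E (FOb Lambda X)"
      using maximal_CM_iff[OF assms fg_Lambda[OF Md]] projective_res_Lambda[OF Md] X(2)
      by (simp add: XM Lambda_def)
  qed
  then show "is_equivalence (CM_cat E :: (('a \<times> 'a, 'm) rmodule, 'm \<Rightarrow> 'm) cat) (proj_Dif_cat A \<iota> G) (Gamma A)"
    by (rule is_equivalence_of_quasi_inverse)
qed

end

section \<open>Bound quiver algebras\<close>

text \<open>The type class \<open>field\<close> repackaged as a ring record, so that vector spaces
  are right modules and the lemmas on finite generation apply to them.\<close>

definition field_ring :: "'k::field ring" where
  "field_ring = \<lparr>carrier = UNIV, monoid.mult = (*), one = 1, zero = 0, add = (+)\<rparr>"

lemma field_ring_simps [simp]:
  "carrier field_ring = UNIV" "x \<otimes>\<^bsub>field_ring\<^esub> y = x * y" "\<one>\<^bsub>field_ring\<^esub> = 1"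
  "\<zero>\<^bsub>field_ring\<^esub> = 0" "x \<oplus>\<^bsub>field_ring\<^esub> y = x + y"
  by (simp_all add: field_ring_def)

lemma ring_field_ring: "ring (field_ring :: 'k::field ring)"
proof (rule ringI)
  show "abelian_group (field_ring :: 'k ring)"
    by (rule abelian_groupI) (auto simp: add_ac intro: exI[of _ "- _"])
  show "Group.monoid (field_ring :: 'k ring)"
    by (rule monoidI) (auto simp: mult_ac)
qed (auto simp: algebra_simps)

text \<open>\<open>dimension\<close> builds the space by adding lines of left multiples of a vector,
  whereas right modules ask for right multiples; centrality of the scalars reconciles the
  two.\<close>

lemma fg_regular_of_finite_dimensional:
  fixes \<iota> :: "'k::field \<Rightarrow> 'a"
  assumes R: "ring R" and \<iota>: "\<iota> \<in> ring_hom field_ring R"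
    and central: "\<And>c a. a \<in> carrier R \<Longrightarrow> \<iota> c \<otimes>\<^bsub>R\<^esub> a = a \<otimes>\<^bsub>R\<^esub> \<iota> c"
    and fin: "finite_dimensional_algebra R \<iota>"
  shows "fg_right_module field_ring (restrict_scalars \<iota> (regular_rmodule R))"
proof -
  interpret ring R by fact
  let ?V = "restrict_scalars \<iota> (regular_rmodule R)"
  have V: "right_module field_ring ?V"
    by (rule right_module_restrict_scalars[OF ring_field_ring \<iota> right_module_regular])
  obtain n where n: "dimension n (range \<iota>) (carrier R)"
    using fin by (auto simp: finite_dimensional_algebra_def)
  have "\<exists>S. finite S \<and> S \<subseteq> carrier R \<and> (\<forall>W. submodule_of field_ring ?V W \<and> S \<subseteq> W \<longrightarrow> F \<subseteq> W)"
    if "dimension n K F" "K = range \<iota>" for n K F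
    using that
  proof induction
    case (zero_dim K)
    show ?case by (intro exI[of _ "{}"]) (auto simp: submodule_of_def regular_rmodule_def)
  next
    case (Suc_dim v F n K)
    from Suc_dim.IH[OF Suc_dim.prems] obtain S where S: "finite S" "S \<subseteq> carrier R"
      "\<And>W. submodule_of field_ring ?V W \<Longrightarrow> S \<subseteq> W \<Longrightarrow> F \<subseteq> W" by (elim exE conjE) blast
    have "line_extension K v F \<subseteq> W" if W: "submodule_of field_ring ?V W" "insert v S \<subseteq> W" for W
    proof
      fix u assume "u \<in> line_extension K v F"
      then obtain c w where u: "w \<in> F" "u = \<iota> c \<otimes>\<^bsub>R\<^esub> v \<oplus>\<^bsub>R\<^esub> w"
        using Suc_dim.prems by (auto simp: line_extension_mem_iff)
      have "v \<otimes>\<^bsub>R\<^esub> \<iota> c \<in> W" using W by (auto simp: submodule_of_def regular_rmodule_def)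
      moreover have "w \<in> W" using S(3)[OF W(1)] W(2) u(1) by blast
      ultimately show "u \<in> W"
        using W(1) u(2) central[OF Suc_dim.hyps(1)] by (simp add: submodule_of_def regular_rmodule_def)
    qed
    then show ?case using S(1,2) Suc_dim.hyps(1) by (intro exI[of _ "insert v S"]) auto
  qed
  from this[OF n refl] obtain S where S: "finite S" "S \<subseteq> carrier R"
    "\<And>W. submodule_of field_ring ?V W \<Longrightarrow> S \<subseteq> W \<Longrightarrow> carrier R \<subseteq> W" by (elim exE conjE) blast
  have "generates field_ring ?V S"
    using S(2,3) by (auto simp: generates_def submodule_of_def regular_rmodule_def)
  then show ?thesis using V S(1) unfolding fg_right_module_iff by blast
qed

lemma (in ring) generates_regular: "generates R (regular_rmodule R) {\<one>}"
  unfolding generates_def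
proof (intro conjI allI impI)
  show "{\<one>} \<subseteq> carrier (regular_rmodule R)" by (simp add: regular_rmodule_def)
  fix W assume W: "submodule_of R (regular_rmodule R) W \<and> {\<one>} \<subseteq> W"
  have "a \<in> W" if "a \<in> carrier R" for a
  proof -
    have "\<one> \<otimes> a \<in> W" using W that by (auto simp: submodule_of_def regular_rmodule_def)
    then show ?thesis using that by simp
  qed
  then show "W = carrier (regular_rmodule R)" using W by (auto simp: submodule_of_def regular_rmodule_def)
qed

lemma (in ring) fg_regular: "fg_right_module R (regular_rmodule R)"
  unfolding fg_right_module_iff using right_module_regular generates_regular by blast

text \<open>Finite generation climbs the tower from the field through \<open>A\<close> to
  \<open>E\<close>.\<close>

lemma (in dual_extension) right_noetherian_E:
  fixes \<iota> :: "'k::field \<Rightarrow> 'a"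
  assumes \<iota>: "\<iota> \<in> ring_hom field_ring A"
    and fin: "fg_right_module field_ring (restrict_scalars \<iota> (regular_rmodule A))"
  shows "right_noetherian E"
proof -
  have "fg_right_module A (res (regular_rmodule E))"
    using fg_res_iff[OF E_regular] ring.fg_regular[OF E_ring] by blast
  then have "fg_right_module field_ring (restrict_scalars \<iota> (res (regular_rmodule E)))"
    by (rule fg_restrict_scalars[OF ring_field_ring \<iota> fin])
  moreover have "restrict_scalars \<iota> (res (regular_rmodule E))
      = restrict_scalars ((\<lambda>a. pure_tensor A a 0) \<circ> \<iota>) (regular_rmodule E)"
    by (simp add: restrict_scalars_def)
  ultimately have E: "fg_right_module field_ring (restrict_scalars ((\<lambda>a. pure_tensor A a 0) \<circ> \<iota>) (regular_rmodule E))"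
    by simp
  show ?thesis
  proof (rule right_noetherian_of_field[OF ring_field_ring _ E_ring _ E])
    show "\<exists>b\<in>carrier field_ring. c \<otimes>\<^bsub>field_ring\<^esub> b = \<one>\<^bsub>field_ring\<^esub>"
      if "c \<noteq> \<zero>\<^bsub>field_ring\<^esub>" for c :: 'k
      using that by (intro bexI[of _ "inverse c"]) auto
    show "(\<lambda>a. pure_tensor A a 0) \<circ> \<iota> \<in> ring_hom field_ring E"
      by (rule ring_hom_trans[OF \<iota> inclusion_ring_hom])
  qed
qed

text \<open>Multiplicativity of \<open>\<sigma>\<close> is associativity for the products \<open>(1 \<otimes> \<epsilon>)(c \<otimes> 1)(d \<otimes> 1)\<close>.\<close>

lemma ring_hom_of_ring_dual_ext:
  assumes "ring A" "ring (dual_ext A \<sigma>)" "\<And>a. a \<in> carrier A \<Longrightarrow> \<sigma> a \<in> carrier A"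
  shows "\<sigma> \<in> ring_hom A A"
proof -
  interpret A: ring A by fact
  interpret D: ring "dual_ext A \<sigma>" by fact
  let ?e = "(\<zero>\<^bsub>A\<^esub>, \<one>\<^bsub>A\<^esub>)"
  have e: "?e \<in> carrier (dual_ext A \<sigma>)" and c: "\<And>a. a \<in> carrier A \<Longrightarrow> (a, \<zero>\<^bsub>A\<^esub>) \<in> carrier (dual_ext A \<sigma>)"
    by (simp_all add: dual_ext_def)
  show ?thesis
  proof (rule ring_hom_memI)
    show "\<sigma> (a \<otimes>\<^bsub>A\<^esub> b) = \<sigma> a \<otimes>\<^bsub>A\<^esub> \<sigma> b" if "a \<in> carrier A" "b \<in> carrier A" for a b
      using D.m_assoc[OF e c[OF that(1)] c[OF that(2)]] that assms(3) by (simp add: dual_ext_def)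
    show "\<sigma> (a \<oplus>\<^bsub>A\<^esub> b) = \<sigma> a \<oplus>\<^bsub>A\<^esub> \<sigma> b" if "a \<in> carrier A" "b \<in> carrier A" for a b
      using D.r_distr[OF c[OF that(1)] c[OF that(2)] e] that assms(3) by (simp add: dual_ext_def)
    show "\<sigma> \<one>\<^bsub>A\<^esub> = \<one>\<^bsub>A\<^esub>" using D.r_one[OF e] assms(3) by (simp add: dual_ext_def)
  qed (rule assms(3))
qed

section \<open>The graded algebra of a bound quiver\<close>

context
  fixes Q :: "('v, 'e) pre_digraph" and \<delta> :: "'e \<Rightarrow> int" and I :: "(('v, 'e) path \<Rightarrow> 'k::field) set"
  assumes Q: "graded_bound_quiver Q \<delta> I"
begin

lemma ideal_path_algebra: "ideal I (path_algebra Q)"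
  and homogeneous: "homogeneous_ideal \<delta> I" and fin_digraph_Q: "fin_digraph Q"
  using Q by (auto simp: graded_bound_quiver_def admissible_ideal_def)

interpretation I: ideal I "path_algebra Q"
  by (rule ideal_path_algebra)

lemma wf_Q: "wf_digraph Q" and finite_verts_Q: "finite (verts Q)"
proof -
  interpret fin_digraph Q by (rule fin_digraph_Q)
  show "wf_digraph Q" by (rule wf_digraph_axioms)
  show "finite (verts Q)" by (rule finite_verts)
qed

lemma ring_quiver_algebra: "ring (quiver_algebra Q I)"
  unfolding quiver_algebra_def by (rule I.quotient_is_ring)

lemma carrier_quiver_algebra: "carrier (quiver_algebra Q I) = (\<lambda>x. I +>\<^bsub>path_algebra Q\<^esub> x) ` carrier (path_algebra Q)"
  by (auto simp: quiver_algebra_def FactRing_def A_RCOSETS_def')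

lemma coset_add: "\<lbrakk>x \<in> carrier (path_algebra Q); y \<in> carrier (path_algebra Q)\<rbrakk> \<Longrightarrow>
    (I +>\<^bsub>path_algebra Q\<^esub> x) \<oplus>\<^bsub>quiver_algebra Q I\<^esub> (I +>\<^bsub>path_algebra Q\<^esub> y)
      = I +>\<^bsub>path_algebra Q\<^esub> (x \<oplus>\<^bsub>path_algebra Q\<^esub> y)"
  by (simp add: quiver_algebra_def FactRing_def I.a_rcos_sum)

lemma coset_mult: "\<lbrakk>x \<in> carrier (path_algebra Q); y \<in> carrier (path_algebra Q)\<rbrakk> \<Longrightarrow>
    (I +>\<^bsub>path_algebra Q\<^esub> x) \<otimes>\<^bsub>quiver_algebra Q I\<^esub> (I +>\<^bsub>path_algebra Q\<^esub> y)
      = I +>\<^bsub>path_algebra Q\<^esub> (x \<otimes>\<^bsub>path_algebra Q\<^esub> y)"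
  by (simp add: quiver_algebra_def FactRing_def I.rcoset_mult_add)

lemma coset_zero: "I +>\<^bsub>path_algebra Q\<^esub> (\<lambda>p. 0) = \<zero>\<^bsub>quiver_algebra Q I\<^esub>"
proof -
  have "I +>\<^bsub>path_algebra Q\<^esub> \<zero>\<^bsub>path_algebra Q\<^esub> = I"
    by (rule I.a_rcos_const) (rule additive_subgroup.zero_closed[OF I.is_additive_subgroup])
  then show ?thesis by (simp add: quiver_algebra_def FactRing_def path_algebra_def)
qed

lemma quiver_algebra_sign_simps:
  assumes "a \<in> carrier (quiver_algebra Q I)"
  shows "quiver_algebra_sign \<delta> a \<in> carrier (quiver_algebra Q I)"
    and "quiver_algebra_sign \<delta> (quiver_algebra_sign \<delta> a) = a"
proof -
  obtain x where x: "x \<in> carrier (path_algebra Q)" "a = I +>\<^bsub>path_algebra Q\<^esub> x"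
    using assms by (auto simp: carrier_quiver_algebra)
  note sign = quiver_algebra_sign_coset[OF ideal_path_algebra homogeneous]
  have "{p. path_sign \<delta> x p \<noteq> 0} = {p. x p \<noteq> 0}" by (auto simp: path_sign_def)
  then have "path_sign \<delta> x \<in> carrier (path_algebra Q)" using x(1) by (simp add: path_algebra_def)
  then show "quiver_algebra_sign \<delta> a \<in> carrier (quiver_algebra Q I)"
    by (simp add: x(2) sign carrier_quiver_algebra)
  have "path_sign \<delta> (path_sign \<delta> x) = x" by (auto simp: path_sign_def)
  then show "quiver_algebra_sign \<delta> (quiver_algebra_sign \<delta> a) = a" by (simp add: x(2) sign)
qed

text \<open>Every path is homogeneous, so an element is a finite sum of homogeneous ones; the
  induction runs over a finite set containing its support.\<close>

lemma quiver_algebra_degree_spans: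
  assumes "\<And>n. quiver_algebra_degree Q \<delta> I n \<subseteq> W" "\<zero>\<^bsub>quiver_algebra Q I\<^esub> \<in> W"
    and "\<And>x y. \<lbrakk>x \<in> W; y \<in> W\<rbrakk> \<Longrightarrow> x \<oplus>\<^bsub>quiver_algebra Q I\<^esub> y \<in> W"
  shows "carrier (quiver_algebra Q I) \<subseteq> W"
proof -
  have "I +>\<^bsub>path_algebra Q\<^esub> x \<in> W" if "finite T" "x \<in> carrier (path_algebra Q)" "{p. x p \<noteq> 0} \<subseteq> T" for T x
    using that
  proof (induction T arbitrary: x)
    case empty
    then have "x = (\<lambda>p. 0)" by auto
    then show ?case using assms(2) by (simp only: coset_zero)
  next
    case (insert p T)
    \<comment> \<open>The term of \<open>x\<close> at the path \<open>p\<close>, and the rest, whose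
      support lies in \<open>T\<close>.\<close>
    let ?y = "\<lambda>q. if q = p then x q else 0" and ?z = "\<lambda>q. if q = p then 0 else x q"
    have "{q. ?y q \<noteq> 0} \<subseteq> {q. x q \<noteq> 0}" "{q. ?z q \<noteq> 0} \<subseteq> {q. x q \<noteq> 0}" by auto
    then have yz: "?y \<in> carrier (path_algebra Q)" "?z \<in> carrier (path_algebra Q)"
      using insert.prems(1) by (auto simp: path_algebra_def intro: finite_subset)
    have "I +>\<^bsub>path_algebra Q\<^esub> ?y \<in> quiver_algebra_degree Q \<delta> I (path_deg \<delta> p)"
      using yz(1) unfolding quiver_algebra_degree_def by (intro CollectI exI[of _ ?y]) auto
    moreover have "I +>\<^bsub>path_algebra Q\<^esub> ?z \<in> W"
      using insert.prems(2) by (intro insert.IH yz) auto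
    moreover have "x = ?y \<oplus>\<^bsub>path_algebra Q\<^esub> ?z" by (auto simp: path_algebra_def)
    ultimately show ?case
      using assms(3)[of "I +>\<^bsub>path_algebra Q\<^esub> ?y" "I +>\<^bsub>path_algebra Q\<^esub> ?z"] subsetD[OF assms(1)]
      by (simp only: coset_add[OF yz])
  qed
  then show ?thesis by (auto simp: carrier_quiver_algebra) (auto simp: path_algebra_def)
qed

text \<open>Scalars are supported on trivial paths, whose degree is an empty sum. It follows that
  the sign map fixes them.\<close>

lemma quiver_algebra_scalar_degree: "quiver_algebra_scalar Q I c \<in> quiver_algebra_degree Q \<delta> I 0"
  using path_scalar_closed[OF finite_verts_Q, of c]
  by (auto simp: quiver_algebra_scalar_def quiver_algebra_degree_def path_scalar_def path_deg_def path_length_def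
      split: if_splits intro!: exI[of _ "path_scalar Q c"])

lemma quiver_algebra_degree_closed: "quiver_algebra_degree Q \<delta> I n \<subseteq> carrier (quiver_algebra Q I)"
  by (auto simp: quiver_algebra_degree_def carrier_quiver_algebra)

lemma quiver_algebra_scalar_hom: "quiver_algebra_scalar Q I \<in> ring_hom field_ring (quiver_algebra Q I)"
proof (rule ring_hom_memI)
  note pc = path_scalar_closed[OF finite_verts_Q]
  fix c d :: 'k
  show "quiver_algebra_scalar Q I c \<in> carrier (quiver_algebra Q I)"
    using quiver_algebra_scalar_degree quiver_algebra_degree_closed by blast
  have "path_scalar Q c \<otimes>\<^bsub>path_algebra Q\<^esub> path_scalar Q d = path_scalar Q (c * d)"
    unfolding path_scalar_mult(1)[OF wf_Q pc] by (auto simp: path_scalar_def)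
  then show "quiver_algebra_scalar Q I (c \<otimes>\<^bsub>field_ring\<^esub> d)
      = quiver_algebra_scalar Q I c \<otimes>\<^bsub>quiver_algebra Q I\<^esub> quiver_algebra_scalar Q I d"
    by (simp add: quiver_algebra_scalar_def coset_mult[OF pc pc])
  have "path_scalar Q c \<oplus>\<^bsub>path_algebra Q\<^esub> path_scalar Q d = path_scalar Q (c + d)"
    by (auto simp: path_scalar_def path_algebra_def)
  then show "quiver_algebra_scalar Q I (c \<oplus>\<^bsub>field_ring\<^esub> d)
      = quiver_algebra_scalar Q I c \<oplus>\<^bsub>quiver_algebra Q I\<^esub> quiver_algebra_scalar Q I d"
    by (simp add: quiver_algebra_scalar_def coset_add[OF pc pc])
next
  show "quiver_algebra_scalar Q I \<one>\<^bsub>field_ring\<^esub> = \<one>\<^bsub>quiver_algebra Q I\<^esub>"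
    by (simp add: quiver_algebra_scalar_def quiver_algebra_def FactRing_def path_algebra_def)
qed

lemma quiver_algebra_scalar_central:
  assumes "a \<in> carrier (quiver_algebra Q I)"
  shows "quiver_algebra_scalar Q I c \<otimes>\<^bsub>quiver_algebra Q I\<^esub> a = a \<otimes>\<^bsub>quiver_algebra Q I\<^esub> quiver_algebra_scalar Q I c"
proof -
  obtain x where x: "x \<in> carrier (path_algebra Q)" "a = I +>\<^bsub>path_algebra Q\<^esub> x"
    using assms by (auto simp: carrier_quiver_algebra)
  note pc = path_scalar_closed[OF finite_verts_Q]
  show ?thesis
    by (simp add: x(2) quiver_algebra_scalar_def coset_mult[OF pc x(1)] coset_mult[OF x(1) pc]
        path_scalar_mult[OF wf_Q x(1)] mult.commute)
qed

lemma graded_dual_extension_quiver: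
  "graded_dual_extension (quiver_algebra Q I) (quiver_algebra_sign \<delta>) (quiver_algebra_scalar Q I)
     (quiver_algebra_degree Q \<delta> I)"
proof (intro graded_dual_extension.intro dual_extension.intro dual_extension_axioms.intro
    graded_dual_extension_axioms.intro)
  show "ring (quiver_algebra Q I)" by (rule ring_quiver_algebra)
  show "quiver_algebra_sign \<delta> \<in> ring_hom (quiver_algebra Q I) (quiver_algebra Q I)"
    using ring_quiver_dual_ext[OF Q] quiver_algebra_sign_simps(1)
    by (intro ring_hom_of_ring_dual_ext ring_quiver_algebra) (auto simp: quiver_dual_ext_def)
  show "quiver_algebra_sign \<delta> (quiver_algebra_sign \<delta> a) = a" if "a \<in> carrier (quiver_algebra Q I)" for a
    using that by (rule quiver_algebra_sign_simps)
  show "quiver_algebra_degree Q \<delta> I n \<subseteq> carrier (quiver_algebra Q I)" for n by (rule quiver_algebra_degree_closed)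
  show "quiver_algebra_sign \<delta> a = (if even n then a else \<ominus>\<^bsub>quiver_algebra Q I\<^esub> a)"
    if "a \<in> quiver_algebra_degree Q \<delta> I n" for a n
    by (rule quiver_algebra_sign_homogeneous[OF Q that])
  show "carrier (quiver_algebra Q I) \<subseteq> W"
    if "\<And>n. quiver_algebra_degree Q \<delta> I n \<subseteq> W" "\<zero>\<^bsub>quiver_algebra Q I\<^esub> \<in> W"
      "\<And>x y. \<lbrakk>x \<in> W; y \<in> W\<rbrakk> \<Longrightarrow> x \<oplus>\<^bsub>quiver_algebra Q I\<^esub> y \<in> W" for W
    using that by (rule quiver_algebra_degree_spans)
  show "quiver_algebra_scalar Q I c \<in> carrier (quiver_algebra Q I)" for c
    using quiver_algebra_scalar_degree quiver_algebra_degree_closed by blast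
  show "quiver_algebra_sign \<delta> (quiver_algebra_scalar Q I c) = quiver_algebra_scalar Q I c" for c
    using quiver_algebra_sign_homogeneous[OF Q quiver_algebra_scalar_degree] by simp
qed

end

theorem mainTheorem6:
  fixes Q :: "('v, 'e) pre_digraph"
    and \<delta> :: "'e \<Rightarrow> int"
    and I :: "(('v, 'e) path \<Rightarrow> 'k::field) set"
  defines "A \<equiv> quiver_algebra Q I"
    and "\<iota> \<equiv> quiver_algebra_scalar Q I"
    and "G \<equiv> quiver_algebra_degree Q \<delta> I"
    and "A' \<equiv> quiver_dual_ext Q \<delta> I"
  assumes "graded_bound_quiver Q \<delta> I"
    and "finite_dimensional_algebra A \<iota>"
    and "finite_global_dim A"
  shows "is_equivalence
           (mod_cat A' :: (((('v, 'e) path \<Rightarrow> 'k) set \<times> (('v, 'e) path \<Rightarrow> 'k) set, 'm) rmodule, 'm \<Rightarrow> 'm) cat)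
           (Dif_cat A \<iota> G) (Gamma A)
       \<and> is_equivalence
           (CM_cat A' :: (((('v, 'e) path \<Rightarrow> 'k) set \<times> (('v, 'e) path \<Rightarrow> 'k) set, 'm) rmodule, 'm \<Rightarrow> 'm) cat)
           (proj_Dif_cat A \<iota> G) (Gamma A)"
proof -
  note Q = assms(5)
  interpret graded_dual_extension A "quiver_algebra_sign \<delta>" \<iota> G
    unfolding A_def \<iota>_def G_def by (rule graded_dual_extension_quiver[OF Q])
  have \<iota>: "\<iota> \<in> ring_hom field_ring A"
    unfolding A_def \<iota>_def by (rule quiver_algebra_scalar_hom[OF Q])
  have "fg_right_module field_ring (restrict_scalars \<iota> (regular_rmodule A))"
    using quiver_algebra_scalar_central[OF Q] assms(6)
    by (intro fg_regular_of_finite_dimensional[OF A.ring_axioms \<iota>]) (auto simp: A_def \<iota>_def)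
  then have "right_noetherian E" by (rule right_noetherian_E[OF \<iota>])
  from Gamma_equivalences[OF assms(7) this] show ?thesis
    unfolding A'_def quiver_dual_ext_def A_def[symmetric] by blast
qed

end
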